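(* Let $k$ be an algebraically closed field of characteristic $2$ and let $G=C_2\times C_2$ be the Klein four group. The representations $k[G]$, $TP_r$ ($r\ge 1$), $TI_r$ ($r\ge 0$), and $TR_{p,\lambda}$ ($p\ge 1$ and $\lambda\in\mathbb P^1(k)$) form, up to isomorphism, a complete list of the finite dimensional indecomposable $k$-linear representations of $G$; that is, each of them is indecomposable and each finite dimensional indecomposable representation of $G$ is isomorphic to one of them.
   Context: Let $g_1,g_2$ be generators of $G=C_2\times C_2$. A $k$-linear representation of $G$ is a $k$-vector space $X$ with a group homomorphism $G\to\mathrm{Aut}_k(X)$, $g\mapsto X_g$; morphisms are $G$-equivariant linear maps. $k[G]$ denotes the regular representation: the vector space with basis $G$ and $G$ acting by left multiplication. Indecomposable means non-zero and not a direct sum of two non-zero subrepresentations. The Kronecker quiver has vertices $1,2$ and arrows $\alpha_1,\alpha_2\colon1\to2$; a representation $X$ of it is a pair of linear maps $X_{\alpha_1},X_{\alpha_2}\colon X_1\to X_2$ of $k$-vector spaces. For such $X$, $TX$ is the representation of $G$ with underlying space $X_1\oplus X_2$ on which $g_i$ acts as $\mathrm{id}+\begin{bmatrix}0&0\\ X_{\alpha_i}&0\end{bmatrix}$ for $i=1,2$. The following Kronecker representations are used: - $P_r$: spaces $k^r,k^{r+1}$, maps $X_{\alpha_1}=\begin{bmatrix}\mathrm{id}_{k^r}\\0\end{bmatrix}$, $X_{\alpha_2}=\begin{bmatrix}0\\ \mathrm{id}_{k^r}\end{bmatrix}$. - $I_r$: spaces $k^{r+1},k^r$, maps $X_{\alpha_1}=\begin{bmatrix}\mathrm{id}_{k^r}&0\end{bmatrix}$,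 $X_{\alpha_2}=\begin{bmatrix}0&\mathrm{id}_{k^r}\end{bmatrix}$. - $R_{p,\lambda}$ for $\lambda\in\mathbb P^1(k)$ (pairs $(\lambda_0:\lambda_1)\ne(0:0)$ modulo non-zero scalars): both spaces $k^p$, with $(X_{\alpha_1},X_{\alpha_2})=(J(p,\lambda_0),\mathrm{id})$ if $\lambda=(\lambda_0:1)$ and $(\mathrm{id},J(p,\lambda_1))$ if $\lambda=(1:\lambda_1)$, where $J(p,\mu)$ is the $p\times p$ Jordan block with eigenvalue $\mu$; when both descriptions apply the two are isomorphic, so $R_{p,\lambda}$ is well defined up to isomorphism. *)

theory Defs
  imports
    "Jordan_Normal_Form.VS_Connect"
    "Jordan_Normal_Form.Jordan_Normal_Form"
    "HOL-Algebra.AbelCoset"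
    "HOL-Algebra.Bij"
    "HOL-Algebra.Elementary_Groups"
begin

section \<open>Linear representations of a group\<close>

record ('k, 'g, 'v) rep =
  rep_space :: "('k, 'v) module"
  rep_act :: "'g \<Rightarrow> 'v \<Rightarrow> 'v"

text \<open>As in the library's \<^const>\<open>AutoGroup\<close>, the elements of \<open>Aut\<^sub>K(V)\<close> are extensional functions
  (\<^term>\<open>undefined\<close> outside the carrier of \<open>V\<close>).\<close>

definition linear_auto_group ::
    "('k, 'm) ring_scheme \<Rightarrow> ('k, 'v, 'n) module_scheme \<Rightarrow> ('v \<Rightarrow> 'v) monoid" where
  "linear_auto_group K V =
     BijGroup (carrier V) \<lparr>carrier := Bij (carrier V) \<inter> LinearCombinations.module_hom K V V\<rparr>"

definition representation ::
    "('g, 'l) monoid_scheme \<Rightarrow> ('k, 'm) ring_scheme \<Rightarrow> ('k, 'g, 'v) rep \<Rightarrow> bool" where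
  "representation G K X \<longleftrightarrow>
     group G \<and> vectorspace K (rep_space X) \<and>
     rep_act X \<in> hom G (linear_auto_group K (rep_space X))"

definition subrepresentation ::
    "('g, 'l) monoid_scheme \<Rightarrow> ('k, 'm) ring_scheme \<Rightarrow> ('k, 'g, 'v) rep \<Rightarrow> 'v set \<Rightarrow> bool" where
  "subrepresentation G K X W \<longleftrightarrow>
     VectorSpace.subspace K W (rep_space X) \<and>
     (\<forall>g\<in>carrier G. \<forall>w\<in>W. rep_act X g w \<in> W)"

definition indecomposable_rep ::
    "('g, 'l) monoid_scheme \<Rightarrow> ('k, 'm) ring_scheme \<Rightarrow> ('k, 'g, 'v) rep \<Rightarrow> bool" where
  "indecomposable_rep G K X \<longleftrightarrow>
     (let V = rep_space X in
        carrier V \<noteq> {\<zero>\<^bsub>V\<^esub>} \<and>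
        \<not> (\<exists>U W. subrepresentation G K X U \<and> subrepresentation G K X W \<and>
              U \<noteq> {\<zero>\<^bsub>V\<^esub>} \<and> W \<noteq> {\<zero>\<^bsub>V\<^esub>} \<and>
              U \<inter> W = {\<zero>\<^bsub>V\<^esub>} \<and> set_add V U W = carrier V))"

definition fd_indecomposable_rep ::
    "('g, 'l) monoid_scheme \<Rightarrow> ('k, 'm) ring_scheme \<Rightarrow> ('k, 'g, 'v) rep \<Rightarrow> bool" where
  "fd_indecomposable_rep G K X \<longleftrightarrow>
     representation G K X \<and> vectorspace.fin_dim K (rep_space X) \<and> indecomposable_rep G K X"

definition iso_rep ::
    "('g, 'l) monoid_scheme \<Rightarrow> ('k, 'm) ring_scheme \<Rightarrow>
     ('k, 'g, 'v) rep \<Rightarrow> ('k, 'g, 'w) rep \<Rightarrow> bool" where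
  "iso_rep G K X Y \<longleftrightarrow>
     (\<exists>f\<in>LinearCombinations.module_hom K (rep_space X) (rep_space Y).
        bij_betw f (carrier (rep_space X)) (carrier (rep_space Y)) \<and>
        (\<forall>g\<in>carrier G. \<forall>x\<in>carrier (rep_space X). f (rep_act X g x) = rep_act Y g (f x)))"

text \<open>For finite \<open>G\<close>, an element \<open>\<Sum>\<^sub>h a\<^sub>h h\<close> of \<open>K[G]\<close> is encoded as its coefficient function
  \<open>h \<mapsto> a\<^sub>h\<close> on \<^term>\<open>carrier G\<close>.  Left multiplication by \<open>g\<close> yields \<open>\<Sum>\<^sub>h a\<^sub>h (g h)\<close>, whose
  coefficient at \<open>x\<close> is the old coefficient at \<open>g\<^sup>-\<^sup>1 x\<close>.\<close>

definition regular_rep ::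
    "('g, 'l) monoid_scheme \<Rightarrow> ('k, 'm) ring_scheme \<Rightarrow> ('k, 'g, 'g \<Rightarrow> 'k) rep" where
  "regular_rep G K =
     \<lparr>rep_space = ring.func_space K (carrier G),
      rep_act = (\<lambda>g. \<lambda>f \<in> carrier (ring.func_space K (carrier G)).
                   \<lambda>x \<in> carrier G. f (inv\<^bsub>G\<^esub> g \<otimes>\<^bsub>G\<^esub> x))\<rparr>"

abbreviation klein_four :: "(int \<times> int) monoid" where
  "klein_four \<equiv> integer_mod_group 2 \<times>\<times> integer_mod_group 2"


section \<open>Representations of the Kronecker quiver\<close>

record ('k, 'v, 'w) kronecker_rep =
  space1 :: "('k, 'v) module"
  space2 :: "('k, 'w) module"
  arrow1 :: "'v \<Rightarrow> 'w"
  arrow2 :: "'v \<Rightarrow> 'w"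

definition matrix_kronecker_rep ::
    "nat \<Rightarrow> nat \<Rightarrow> 'k mat \<Rightarrow> 'k mat \<Rightarrow> ('k :: field, 'k vec, 'k vec) kronecker_rep" where
  "matrix_kronecker_rep m n A B =
     \<lparr>space1 = module_vec TYPE('k) m, space2 = module_vec TYPE('k) n,
      arrow1 = (\<lambda>v. A *\<^sub>v v), arrow2 = (\<lambda>v. B *\<^sub>v v)\<rparr>"

definition P_rep :: "nat \<Rightarrow> ('k :: field, 'k vec, 'k vec) kronecker_rep" where
  "P_rep r = matrix_kronecker_rep r (r + 1) (1\<^sub>m r @\<^sub>r 0\<^sub>m 1 r) (0\<^sub>m 1 r @\<^sub>r 1\<^sub>m r)"

text \<open>The two matrices are the block rows \<open>[id 0]\<close> and \<open>[0 id]\<close>; the lower blocks have no rows.\<close>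

definition I_rep :: "nat \<Rightarrow> ('k :: field, 'k vec, 'k vec) kronecker_rep" where
  "I_rep r = matrix_kronecker_rep (r + 1) r
     (four_block_mat (1\<^sub>m r) (0\<^sub>m r 1) (0\<^sub>m 0 r) (0\<^sub>m 0 1))
     (four_block_mat (0\<^sub>m r 1) (1\<^sub>m r) (0\<^sub>m 0 1) (0\<^sub>m 0 r))"

text \<open>\<^term>\<open>proj_point a b\<close> is the point \<open>(a : b)\<close>, as the class of \<open>(a, b)\<close> modulo non-zero scalars.\<close>

definition proj_point :: "'k :: field \<Rightarrow> 'k \<Rightarrow> ('k \<times> 'k) set" where
  "proj_point a b = {(c * a, c * b) | c. c \<noteq> 0}"

definition proj_line :: "('k :: field \<times> 'k) set set" where
  "proj_line = {proj_point a b | a b. (a, b) \<noteq> (0, 0)}"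

text \<open>\<open>R\<^bsub>p,\<lambda>\<^esub>\<close> is only determined up to isomorphism: a point \<open>(a : b)\<close> with \<open>a\<close> and \<open>b\<close> non-zero
  has both descriptions below.  \<^term>\<open>R_reps p l\<close> consists of all (one or two) of its models.\<close>

definition R_reps ::
    "nat \<Rightarrow> ('k \<times> 'k) set \<Rightarrow> ('k :: field, 'k vec, 'k vec) kronecker_rep set" where
  "R_reps p l =
     {matrix_kronecker_rep p p (jordan_block p a) (1\<^sub>m p) | a. l = proj_point a 1} \<union>
     {matrix_kronecker_rep p p (1\<^sub>m p) (jordan_block p b) | b. l = proj_point 1 b}"

lemma R_reps_nonempty:
  assumes "l \<in> proj_line"
  shows "R_reps p l \<noteq> {}"
proof -
  obtain a b where l: "l = proj_point a b" and ab: "(a, b) \<noteq> (0, 0)"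
    using assms by (auto simp: proj_line_def)
  have scale: "proj_point (t * a) (t * b) = proj_point a b" if t: "t \<noteq> 0" for t
  proof
    show "proj_point (t * a) (t * b) \<subseteq> proj_point a b"
    proof
      fix x assume "x \<in> proj_point (t * a) (t * b)"
      then obtain c where "c \<noteq> 0" "x = (c * (t * a), c * (t * b))"
        by (auto simp: proj_point_def)
      then have "c * t \<noteq> 0 \<and> x = ((c * t) * a, (c * t) * b)"
        using t by (simp add: mult.assoc)
      then show "x \<in> proj_point a b" unfolding proj_point_def by blast
    qed
    show "proj_point a b \<subseteq> proj_point (t * a) (t * b)"
    proof
      fix x assume "x \<in> proj_point a b"
      then obtain c where "c \<noteq> 0" "x = (c * a, c * b)"
        by (auto simp: proj_point_def)
      then have "c / t \<noteq> 0 \<and> x = ((c / t) * (t * a), (c / t) * (t * b))"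
        using t by simp
      then show "x \<in> proj_point (t * a) (t * b)" unfolding proj_point_def by blast
    qed
  qed
  show ?thesis
  proof (cases "b = 0")
    case True
    then have "l = proj_point 1 0" using scale[of "1 / a"] l ab by simp
    then show ?thesis unfolding R_reps_def by blast
  next
    case False
    then have "l = proj_point (a / b) 1" using scale[of "1 / b"] l by simp
    then show ?thesis unfolding R_reps_def by blast
  qed
qed


section \<open>From Kronecker representations to representations of the Klein four group\<close>

text \<open>The automorphism \<open>id + [0, 0; \<phi>, 0]\<close> of \<open>V \<oplus> W\<close> for a linear map \<open>\<phi> : V \<rightarrow> W\<close>.\<close>

definition unipotent ::
    "('k, 'v) module \<Rightarrow> ('k, 'w) module \<Rightarrow> ('v \<Rightarrow> 'w) \<Rightarrow> 'v \<times> 'w \<Rightarrow> 'v \<times> 'w" where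
  "unipotent V W \<phi> =
     restrict (\<lambda>(x, y). (x, \<phi> x \<oplus>\<^bsub>W\<^esub> y)) (carrier (direct_sum V W))"

text \<open>Here \<open>g1\<close> and \<open>g2\<close> are meant to generate a Klein four group \<open>G\<close>, so that the last case below
  is \<open>g = g1 g2\<close>.\<close>

definition T_rep ::
    "('g, 'l) monoid_scheme \<Rightarrow> 'g \<Rightarrow> 'g \<Rightarrow> ('k, 'v, 'w) kronecker_rep \<Rightarrow> ('k, 'g, 'v \<times> 'w) rep" where
  "T_rep G g1 g2 X =
     (let V = direct_sum (space1 X) (space2 X);
          u1 = unipotent (space1 X) (space2 X) (arrow1 X);
          u2 = unipotent (space1 X) (space2 X) (arrow2 X)
      in \<lparr>rep_space = V,
          rep_act = (\<lambda>g. if g = \<one>\<^bsub>G\<^esub> then \<lambda>v \<in> carrier V. v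
                         else if g = g1 then u1
                         else if g = g2 then u2
                         else compose (carrier V) u1 u2)\<rparr>)"

end

theory Submission
  imports Defs "HOL-Library.Function_Algebras"
begin

text \<open>
  Put \<open>a = g\<^sub>1 - 1\<close> and \<open>b = g\<^sub>2 - 1\<close>.  In characteristic 2 a representation of the Klein four group
  is a vector space \<open>X\<close> with two commuting operators \<open>a\<close>, \<open>b\<close> of square zero, and subrepresentations
  are the subspaces stable under both.

  Let \<open>X\<close> be indecomposable and of finite dimension.  If \<open>a (b v) \<noteq> 0\<close> for some \<open>v\<close>, choose a linear form
  \<open>\<phi>\<close> with \<open>\<phi> (a (b v)) = 1\<close> that vanishes on \<open>v\<close>, \<open>a v\<close>, \<open>b v\<close>.  The forms \<open>\<phi>\<close>, \<open>\<phi> \<circ> a\<close>, \<open>\<phi> \<circ> b\<close>,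
  \<open>\<phi> \<circ> a \<circ> b\<close> are dual to the vectors \<open>a (b v)\<close>, \<open>b v\<close>, \<open>a v\<close>, \<open>v\<close>, so the span of these vectors and the
  common kernel of the forms are complementary.  Both are stable, hence the kernel is zero and \<open>X\<close> is
  the regular representation (\<open>free_case\<close>, \<open>iso_regular\<close>).  If \<open>a b = 0\<close>, then \<open>a\<close> and \<open>b\<close> vanish on
  \<open>W = a X + b X\<close>; for a complement \<open>U\<close> of \<open>W\<close> the two maps \<open>a, b : U \<rightarrow> W\<close> form an indecomposable
  Kronecker representation that \<open>T\<close> sends to \<open>X\<close> (\<open>square_zero_case\<close>, \<open>iso_T\<close>).

  It remains to find the indecomposable pairs \<open>a, b : U \<rightarrow> W\<close> with \<open>U \<noteq> 0\<close>, which is Kronecker's theorem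
  (\<open>kronecker_classification\<close>).  Each of its cases produces vectors and linear forms, on \<open>U\<close> and on \<open>W\<close>,
  that are dual to each other and between which \<open>a\<close> and \<open>b\<close> have the matrices of one of the models; the
  span of the vectors is then complemented by the common kernel of the forms, so that it is everything.
  The vectors come from a chain along the linear relation \<open>b a\<^sup>-\<^sup>1\<close>, the forms from a chain along the
  transposed relation, and taking one of the two as short as possible makes them dual.
  A shortest chain that starts at \<open>0\<close> and ends in the kernel of \<open>b\<close> gives \<open>I\<^sub>r\<close> (\<open>I_summand\<close>); the dual
  situation gives \<open>P\<^sub>r\<close> (\<open>P_summand\<close>).  Without chains of the dual kind an injective \<open>a\<close> is bijective,
  and an eigenvector of \<open>a\<^sup>-\<^sup>1 b\<close> starts a Jordan block (\<open>injective_summand\<close>); without chains of the first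
  kind a non-zero vector in the kernel of \<open>a\<close> starts a Jordan block of \<open>a\<close> against \<open>b\<close> with
  eigenvalue \<open>0\<close> (\<open>noninjective_summand\<close>).

  Conversely the models are indecomposable pairs, by looking at how shifts move the unit vectors
  (\<open>kronecker_model_indecomposable\<close>).  A decomposition \<open>M \<oplus> M'\<close> of \<open>T X\<close> induces one of \<open>X\<close>, by projecting
  to \<open>X\<^sub>1\<close> and intersecting with \<open>X\<^sub>2\<close>, as soon as the two maps have no common kernel and jointly span
  \<open>X\<^sub>2\<close> (\<open>indecomposable_T\<close>); among the listed models only the one-dimensional \<open>T I\<^sub>0\<close> escapes this
  condition.  In the regular representation every non-zero subrepresentation contains the sum of all
  group elements (\<open>fd_indecomposable_regular\<close>).

  The linear algebra takes place in a vector space that is a whole type, so that all maps are linear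
  everywhere and only the subspaces \<open>U\<close>, \<open>W\<close>, \<open>X\<close> vary.  A representation on an arbitrary carrier is
  brought into this form by a basis \<open>\<beta>\<close>: its space becomes the space of functions supported on \<open>\<beta>\<close>
  (\<open>vectorspace_coordinates\<close>).
\<close>

section \<open>Linear maps and linear forms\<close>

locale lin_space = V: vector_space scale
  for scale :: "'k :: field \<Rightarrow> 'b :: ab_group_add \<Rightarrow> 'b" (infixr "*s" 75)
begin

text \<open>\<open>E\<close> is for maps into the space itself, \<open>F\<close> for linear forms.\<close>
sublocale E: vector_space_pair scale scale by unfold_locales
sublocale F: vector_space_pair scale "(*) :: 'k \<Rightarrow> 'k \<Rightarrow> 'k"
  by unfold_locales (simp_all add: algebra_simps)

abbreviation endo :: "('b \<Rightarrow> 'b) \<Rightarrow> bool" where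
  "endo f \<equiv> Vector_Spaces.linear scale scale f"

abbreviation functional :: "('b \<Rightarrow> 'k) \<Rightarrow> bool" where
  "functional f \<equiv> Vector_Spaces.linear scale (*) f"

lemma functional_comp: "endo f \<Longrightarrow> functional g \<Longrightarrow> functional (\<lambda>x. g (f x))"
  using Vector_Spaces.linear_compose[of scale scale f "(*)" g] by (simp add: comp_def)

lemma endo_comp: "endo f \<Longrightarrow> endo g \<Longrightarrow> endo (\<lambda>x. g (f x))"
  using Vector_Spaces.linear_compose[of scale scale f scale g] by (simp add: comp_def)

lemma projection_exists:
  assumes "V.subspace Z"
  obtains p where "endo p" "range p \<subseteq> Z" "\<And>z. z \<in> Z \<Longrightarrow> p z = z"
  using E.linear_exists_left_inverse_on[OF V.linear_id assms] by auto

text \<open>The map \<open>g\<close> chooses preimages under \<open>N\<close> inside \<open>S\<close>.\<close>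
lemma section_exists:
  assumes "endo N" "V.subspace S"
  obtains g where "endo g" "range g \<subseteq> S" "\<And>x. x \<in> S \<Longrightarrow> N (g (N x)) = N x"
proof -
  obtain g where "g ` UNIV \<subseteq> S \<and> endo g \<and> (\<forall>v\<in>N ` S. N (g v) = v)"
    using E.linear_exists_right_inverse_on[OF assms] ..
  then show ?thesis by (intro that[of g]) auto
qed

text \<open>A linear form that is \<open>1\<close> at the image of \<open>w\<close> under a projection killing \<open>Z\<close> can be pulled back.\<close>
lemma functional_exists:
  assumes Z: "V.subspace Z" and w: "w \<notin> Z"
  obtains g where "functional g" "\<And>z. z \<in> Z \<Longrightarrow> g z = 0" "g w = 1"
proof -
  obtain p where p: "endo p" "range p \<subseteq> Z" "\<And>z. z \<in> Z \<Longrightarrow> p z = z"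
    by (rule projection_exists[OF Z]) blast
  have q: "endo (\<lambda>x. x - p x)"
    using E.linear_compose_sub[OF V.linear_id p(1)] by simp
  have qw: "w - p w \<noteq> 0" using p(2) w by auto
  then obtain h where h: "functional h" "h (w - p w) = 1"
    using F.linear_independent_extend[of "{w - p w}" "\<lambda>_. 1"] by auto
  have "h (z - p z) = 0" if "z \<in> Z" for z
    using p(3)[OF that] F.linear_0[OF h(1)] by simp
  then show ?thesis using that[OF functional_comp[OF q h(1)]] h(2) by blast
qed

text \<open>The hypothesis \<open>van\<close> says that \<open>g \<circ> B\<close> is zero on the kernel of \<open>U \<rightarrow> V / Z\<close> induced by \<open>A\<close>, so
  it factors through this map.  Passing from \<open>g\<close> to \<open>h\<close> is one step of the transpose of the linear
  relation \<open>B A\<^sup>-\<^sup>1\<close>.\<close>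
lemma functional_factor:
  assumes A: "endo A" and B: "endo B" and U: "V.subspace U" and Z: "V.subspace Z"
    and g: "functional g" and van: "\<And>x. x \<in> U \<Longrightarrow> A x \<in> Z \<Longrightarrow> g (B x) = 0"
  obtains h where "functional h" "\<And>z. z \<in> Z \<Longrightarrow> h z = 0" "\<And>x. x \<in> U \<Longrightarrow> h (A x) = g (B x)"
proof -
  obtain p where p: "endo p" "range p \<subseteq> Z" "\<And>z. z \<in> Z \<Longrightarrow> p z = z"
    by (rule projection_exists[OF Z]) blast
  define q where "q x = x - p x" for x
  have q: "endo q"
    using E.linear_compose_sub[OF V.linear_id p(1)] by (simp add: q_def[abs_def])
  define N where "N x = q (A x)" for x
  have N: "endo N" using endo_comp[OF A q] by (simp add: N_def[abs_def])
  obtain s where s: "endo s" "range s \<subseteq> U" "\<And>x. x \<in> U \<Longrightarrow> N (s (N x)) = N x"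
    by (rule section_exists[OF N U]) blast
  define h where "h y = g (B (s (q y)))" for y
  have h: "functional h"
    using functional_comp[OF endo_comp[OF endo_comp[OF q s(1)] B] g] by (simp add: h_def[abs_def])
  have h0: "h z = 0" if "z \<in> Z" for z
  proof -
    have "q z = 0" using p(3)[OF that] by (simp add: q_def)
    then show ?thesis
      unfolding h_def by (simp add: E.linear_0[OF s(1)] E.linear_0[OF B] F.linear_0[OF g])
  qed
  have hA: "h (A x) = g (B x)" if x: "x \<in> U" for x
  proof -
    define y where "y = s (N x) - x"
    have yU: "y \<in> U" unfolding y_def using s(2) x by (intro V.subspace_diff[OF U]) auto
    have "N y = 0" unfolding y_def E.linear_diff[OF N] using s(3)[OF x] by simp
    then have "A y \<in> Z" using p(2) by (auto simp: N_def q_def)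
    then have "g (B y) = 0" using van yU by blast
    then have "g (B (s (N x))) = g (B x)"
      unfolding y_def E.linear_diff[OF B] F.linear_diff[OF g] by simp
    then show ?thesis by (simp add: h_def N_def)
  qed
  show ?thesis by (rule that[OF h h0 hA])
qed

subsection \<open>Finite dimension\<close>

lemma dim_strict_mono:
  assumes "V.subspace Z" "Z \<subset> Z'" "Z' \<subseteq> V.span T" "finite T"
  shows "V.dim Z < V.dim Z'"
proof -
  obtain B where B: "B \<subseteq> Z" "V.independent B" "Z \<subseteq> V.span B" "card B = V.dim Z"
    using V.basis_exists by blast
  obtain x where x: "x \<in> Z'" "x \<notin> Z" using assms(2) by blast
  have sB: "V.span B \<subseteq> Z" using V.span_minimal[OF B(1) assms(1)] .
  have ind: "V.independent (insert x B)"
    using V.independent_insertI[of x B] B(2) sB x by blast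
  obtain C where C: "insert x B \<subseteq> C" "C \<subseteq> Z'" "V.independent C" "Z' \<subseteq> V.span C"
    using V.maximal_independent_subset_extend[of "insert x B" Z'] ind B(1) x assms(2) by blast
  have fC: "finite C"
    using V.independent_span_bound[OF assms(4) C(3)] C(2) assms(3) by blast
  have "x \<notin> B" using B(1) x by blast
  moreover have "finite B" using C(1) fC by (auto intro: finite_subset)
  ultimately have "card B < card (insert x B)" by simp
  also have "\<dots> \<le> card C" using C(1) fC by (rule card_mono[rotated])
  also have "\<dots> = V.dim Z'" using V.basis_card_eq_dim C by blast
  finally show ?thesis using B(4) by simp
qed

lemma finite_basis:
  assumes "V.subspace S" "S \<subseteq> V.span T" "finite T"
  obtains C where "finite C" "V.independent C" "V.span C = S" "card C = V.dim S"
proof -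
  obtain C where C: "C \<subseteq> S" "V.independent C" "S \<subseteq> V.span C" "card C = V.dim S"
    using V.basis_exists by blast
  moreover have "finite C" using V.independent_span_bound[OF assms(3) C(2)] C(1) assms(2) by blast
  moreover have "V.span C = S" using C V.span_minimal[OF C(1) assms(1)] by blast
  ultimately show ?thesis using that by blast
qed

lemma image_in_finite_span:
  assumes "endo f" "S \<subseteq> V.span T"
  shows "f ` S \<subseteq> V.span (f ` T)"
  using assms E.linear_span_image by blast

lemma dim_image_le:
  assumes f: "endo f" and S: "V.subspace S" "S \<subseteq> V.span T" "finite T"
  shows "V.dim (f ` S) \<le> V.dim S"
proof -
  obtain C where C: "finite C" "V.independent C" "V.span C = S" "card C = V.dim S"
    by (rule finite_basis[OF S]) blast
  have "V.dim (f ` S) \<le> card (f ` C)"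
    using V.dim_le_card[of "f ` S" "f ` C"] C E.linear_span_image[OF f, of C] by auto
  then show ?thesis using card_image_le[OF C(1), of f] C(4) by simp
qed

lemma dim_image_inj:
  assumes f: "endo f" and i: "inj_on f S" and S: "V.subspace S" "S \<subseteq> V.span T" "finite T"
  shows "V.dim (f ` S) = V.dim S"
proof -
  obtain C where C: "finite C" "V.independent C" "V.span C = S" "card C = V.dim S"
    by (rule finite_basis[OF S]) blast
  have "V.independent (f ` C)"
    using E.linear_independent_injective_image[OF f C(2)] i C(3) by simp
  then have "V.dim (f ` S) = card (f ` C)"
    using V.dim_span_eq_card_independent[of "f ` C"] E.linear_span_image[OF f, of C] C(3) by simp
  moreover have "card (f ` C) = card C"
    using inj_on_subset[OF i, of C] V.span_superset[of C] C(3) by (simp add: card_image)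
  ultimately show ?thesis using C(4) by simp
qed

text \<open>The dimension of \<open>N ` S\<close> is at most that of \<open>S\<close>, which is that of \<open>M ` S\<close>.\<close>
lemma injective_into_image_onto:
  assumes M: "endo M" and N: "endo N" and S: "V.subspace S" "S \<subseteq> V.span T" "finite T"
    and i: "inj_on M S" and sub: "M ` S \<subseteq> N ` S"
  shows "M ` S = N ` S"
proof (rule ccontr)
  assume "M ` S \<noteq> N ` S"
  with sub have "M ` S \<subset> N ` S" by auto
  then have "V.dim (M ` S) < V.dim (N ` S)"
    by (rule dim_strict_mono[OF E.linear_subspace_image[OF M S(1)] _ image_in_finite_span[OF N S(2)]])
      (simp add: S(3))
  then show False using dim_image_inj[OF M i S] dim_image_le[OF N S] by linarith
qed

text \<open>A section of \<open>N\<close> embeds \<open>N ` S = M ` S\<close>, whose dimension is that of \<open>S\<close>, into \<open>S\<close>; so it is onto,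
  and \<open>N\<close> is injective as its inverse.\<close>
lemma surjective_imp_injective:
  assumes M: "endo M" and N: "endo N" and S: "V.subspace S" "S \<subseteq> V.span T" "finite T"
    and i: "inj_on M S" and eq: "M ` S = N ` S"
  shows "inj_on N S"
proof -
  obtain g where g: "endo g" "range g \<subseteq> S" "\<And>x. x \<in> S \<Longrightarrow> N (g (N x)) = N x"
    by (rule section_exists[OF N S(1)]) blast
  have NS: "V.subspace (N ` S)" by (rule E.linear_subspace_image[OF N S(1)])
  have ig: "inj_on g (N ` S)" by (rule inj_on_inverseI[of _ N]) (use g(3) in auto)
  have "V.dim (g ` N ` S) = V.dim S"
    using dim_image_inj[OF g(1) ig NS image_in_finite_span[OF N S(2)] finite_imageI[OF S(3)]]
      dim_image_inj[OF M i S] unfolding eq by (rule trans)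
  then have "\<not> g ` N ` S \<subset> S"
    using dim_strict_mono[OF E.linear_subspace_image[OF g(1) NS] _ S(2,3)] by auto
  moreover have "g ` N ` S \<subseteq> S" using g(2) by blast
  ultimately have gS: "g ` N ` S = S" by (simp add: psubset_eq)
  show ?thesis
  proof (rule inj_onI)
    fix x y assume xy: "x \<in> S" "y \<in> S" "N x = N y"
    have gN: "g (N z) = z" if "z \<in> S" for z
    proof -
      have "z \<in> g ` N ` S" unfolding gS by (rule that)
      then obtain w where w: "w \<in> S" "z = g (N w)" by auto
      show ?thesis unfolding w(2) by (simp only: g(3)[OF w(1)])
    qed
    have "x = g (N x)" by (rule gN[OF xy(1), symmetric])
    also have "\<dots> = y" unfolding xy(3) by (rule gN[OF xy(2)])
    finally show "x = y" .
  qed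
qed

lemma increasing_stabilises:
  assumes Z: "\<And>j. V.subspace (Z j)" "\<And>j. Z j \<subseteq> Z (Suc j)" "\<And>j. Z j \<subseteq> V.span T" "finite T"
  obtains j where "Z (Suc j) = Z j"
proof (rule ccontr)
  assume *: "\<not> thesis"
  have "Z j \<subset> Z (Suc j)" for j using Z(2)[of j] that[of j] * by blast
  then have "V.dim (Z j) < V.dim (Z (Suc j))" for j
    by (rule dim_strict_mono[OF Z(1) _ Z(3,4)])
  then have less: "V.dim (Z j) < V.dim (Z (Suc j))" for j .
  have ge: "j \<le> V.dim (Z j)" for j
  proof (induction j)
    case (Suc j)
    then show ?case using less[of j] by simp
  qed simp
  have "V.dim (Z j) \<le> card T" for j by (rule V.dim_le_card[OF Z(3,4)])
  from this[of "Suc (card T)"] show False using ge[of "Suc (card T)"] by simp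
qed

lemma decreasing_stabilises:
  assumes Z: "\<And>j. V.subspace (Z j)" "\<And>j. Z (Suc j) \<subseteq> Z j" "\<And>j. Z j \<subseteq> V.span T" "finite T"
  obtains j where "Z (Suc j) = Z j"
proof (rule ccontr)
  assume *: "\<not> thesis"
  have "Z (Suc j) \<subset> Z j" for j using Z(2)[of j] that[of j] * by blast
  then have less: "V.dim (Z (Suc j)) < V.dim (Z j)" for j
    by (rule dim_strict_mono[OF Z(1) _ Z(3,4)])
  have "V.dim (Z j) + j \<le> V.dim (Z 0)" for j
  proof (induction j)
    case (Suc j)
    then show ?case using less[of j] by simp
  qed simp
  from this[of "Suc (V.dim (Z 0))"] show False by simp
qed

subsection \<open>Eigenvalues\<close>

text \<open>The vector \<open>q(f) u\<close>, by Horner's rule.\<close>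
definition poly_apply :: "('b \<Rightarrow> 'b) \<Rightarrow> 'b \<Rightarrow> 'k poly \<Rightarrow> 'b" where
  "poly_apply f u q = fold_coeffs (\<lambda>a x. a *s u + f x) q 0"

lemma poly_apply_0 [simp]: "poly_apply f u 0 = 0"
  by (simp add: poly_apply_def)

lemma poly_apply_pCons [simp]:
  assumes "endo f"
  shows "poly_apply f u (pCons a q) = a *s u + f (poly_apply f u q)"
  by (cases "a = 0 \<and> q = 0") (auto simp: poly_apply_def E.linear_0[OF assms])

lemma poly_apply_add:
  assumes "endo f"
  shows "poly_apply f u (q + r) = poly_apply f u q + poly_apply f u r"
  by (induction q r rule: poly_induct2)
    (simp_all add: assms E.linear_add[OF assms] V.scale_left_distrib algebra_simps)

lemma poly_apply_smult:
  assumes "endo f"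
  shows "poly_apply f u (Polynomial.smult c q) = c *s poly_apply f u q"
  by (induction q)
    (simp_all add: assms E.linear_scale[OF assms] V.scale_right_distrib)

lemma poly_apply_in:
  assumes "endo f" "V.subspace U" "f ` U \<subseteq> U" "u \<in> U"
  shows "poly_apply f u q \<in> U"
proof (induction q)
  case 0 then show ?case using assms by (simp add: V.subspace_0)
next
  case (pCons a q)
  then show ?case using assms by (auto intro!: V.subspace_add V.subspace_scale)
qed

end

locale lin_space_alg_closed = lin_space scale
  for scale :: "'k :: alg_closed_field \<Rightarrow> 'b :: ab_group_add \<Rightarrow> 'b" (infixr "*s" 75)
begin

text \<open>The spaces of vectors \<open>q(f) u\<close> with \<open>q\<close> of degree below \<open>j\<close> stop growing, so some non-zero
  polynomial in \<open>f\<close> kills \<open>u\<close>.  If \<open>s = (x - \<mu>) t\<close> is one of least degree, then \<open>t(f) u\<close> is an eigenvector.\<close>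
lemma eigenvector_exists:
  assumes f: "endo f" and U: "V.subspace U" "U \<subseteq> V.span T" "finite T" "f ` U \<subseteq> U"
    and u: "u \<in> U" "u \<noteq> 0"
  obtains \<mu> v where "v \<in> U" "v \<noteq> 0" "f v = \<mu> *s v"
proof -
  define Z where "Z j = {poly_apply f u q | q. \<forall>i\<ge>j. coeff q i = 0}" for j
  have sub: "V.subspace (Z j)" for j
    unfolding V.subspace_def
  proof (intro conjI ballI allI)
    show "0 \<in> Z j" unfolding Z_def by (rule CollectI, rule exI[of _ 0]) simp
  next
    fix x y assume "x \<in> Z j" "y \<in> Z j"
    then obtain q r where "x = poly_apply f u q" "\<forall>i\<ge>j. coeff q i = 0"
      "y = poly_apply f u r" "\<forall>i\<ge>j. coeff r i = 0" unfolding Z_def by blast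
    then have "x + y = poly_apply f u (q + r) \<and> (\<forall>i\<ge>j. coeff (q + r) i = 0)"
      by (simp add: poly_apply_add[OF f])
    then show "x + y \<in> Z j" unfolding Z_def by blast
  next
    fix c x assume "x \<in> Z j"
    then obtain q where "x = poly_apply f u q" "\<forall>i\<ge>j. coeff q i = 0" unfolding Z_def by blast
    then have "c *s x = poly_apply f u (Polynomial.smult c q) \<and> (\<forall>i\<ge>j. coeff (Polynomial.smult c q) i = 0)"
      by (simp add: poly_apply_smult[OF f])
    then show "c *s x \<in> Z j" unfolding Z_def by blast
  qed
  have inc: "Z j \<subseteq> Z (Suc j)" for j unfolding Z_def by (auto intro: Suc_leD)
  have "Z j \<subseteq> V.span T" for j
    using poly_apply_in[OF f U(1,4) u(1)] U(2) unfolding Z_def by auto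
  from increasing_stabilises[of Z, OF sub inc this U(3)]
  obtain j where j: "Z (Suc j) = Z j" by blast
  have "poly_apply f u (monom 1 j) \<in> Z (Suc j)"
    unfolding Z_def by (rule CollectI, rule exI[of _ "monom 1 j"]) simp
  then obtain q where q: "poly_apply f u (monom 1 j) = poly_apply f u q" "\<forall>i\<ge>j. coeff q i = 0"
    unfolding j unfolding Z_def by blast
  define r where "r = monom 1 j + Polynomial.smult (-1) q"
  have r0: "poly_apply f u r = 0"
    unfolding r_def poly_apply_add[OF f] poly_apply_smult[OF f] q(1) by simp
  have "coeff r j = 1" using q(2) by (simp add: r_def)
  then have "r \<noteq> 0" by auto
  define s where "s = (ARG_MIN degree r. r \<noteq> 0 \<and> poly_apply f u r = 0)"
  have s: "s \<noteq> 0" "poly_apply f u s = 0"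
    "\<And>r. r \<noteq> 0 \<Longrightarrow> poly_apply f u r = 0 \<Longrightarrow> degree s \<le> degree r"
    using arg_min_natI[of "\<lambda>r. r \<noteq> 0 \<and> poly_apply f u r = 0" r degree] r0 \<open>r \<noteq> 0\<close>
      arg_min_nat_le[of "\<lambda>r. r \<noteq> 0 \<and> poly_apply f u r = 0" _ degree]
    unfolding s_def by simp_all
  have "degree s > 0"
  proof (rule ccontr)
    assume "\<not> degree s > 0"
    then obtain c where c: "s = [:c:]" using degree_eq_zeroE by blast
    then have "c *s u = 0" using s(2) by (simp add: f E.linear_0[OF f])
    then show False using s(1) c u(2) by simp
  qed
  then obtain \<mu> where "poly s \<mu> = 0" using alg_closed_imp_poly_has_root by blast
  then obtain t where t: "s = [:-\<mu>, 1:] * t" unfolding poly_eq_0_iff_dvd by (elim dvdE)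
  have t0: "t \<noteq> 0" using t s(1) by auto
  have "degree ([:-\<mu>, 1:] * t) = degree [:-\<mu>, 1:] + degree t"
    by (rule degree_mult_eq) (use t0 in auto)
  then have dt: "degree t < degree s" 
    unfolding t by (simp only: degree_pCons_eq_if) simp
  have nz: "poly_apply f u t \<noteq> 0"
  proof
    assume "poly_apply f u t = 0"
    then have "degree s \<le> degree t" by (rule s(3)[OF t0])
    with dt show False by (simp only: not_le)
  qed
  have ts: "Polynomial.smult (-\<mu>) t + pCons 0 t = s" unfolding t by (simp only: mult_pCons_left) simp
  have "poly_apply f u (Polynomial.smult (-\<mu>) t + pCons 0 t) = 0"
    unfolding ts by (rule s(2))
  then have "(-\<mu>) *s poly_apply f u t + f (poly_apply f u t) = 0"
    unfolding poly_apply_add[OF f] poly_apply_smult[OF f] poly_apply_pCons[OF f] by simp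
  then have "f (poly_apply f u t) = \<mu> *s poly_apply f u t"
    by (simp only: V.scale_minus_left add_eq_0_iff minus_minus)
  then show ?thesis by (rule that[OF poly_apply_in[OF f U(1,4) u(1)] nz])
qed

end

section \<open>Chains along the relation \<open>B A\<^sup>-\<^sup>1\<close>\<close>

context lin_space
begin

text \<open>The iterated images of a subspace \<open>Z\<close> under the linear relation \<open>B A\<^sup>-\<^sup>1\<close>, where only preimages
  under \<open>A\<close> that lie in \<open>U\<close> count.\<close>
fun rel_iter :: "('b \<Rightarrow> 'b) \<Rightarrow> ('b \<Rightarrow> 'b) \<Rightarrow> 'b set \<Rightarrow> 'b set \<Rightarrow> nat \<Rightarrow> 'b set" where
  "rel_iter A B U Z 0 = Z"
| "rel_iter A B U Z (Suc j) = B ` {x \<in> U. A x \<in> rel_iter A B U Z j}"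

lemma subspace_preimage:
  assumes "endo A" "V.subspace U" "V.subspace Z"
  shows "V.subspace {x \<in> U. A x \<in> Z}"
proof -
  have "{x \<in> U. A x \<in> Z} = U \<inter> A -` Z" by blast
  then show ?thesis
    using V.subspace_inter[OF assms(2) E.linear_subspace_vimage[OF assms(1,3)]] by simp
qed

lemma subspace_rel_iter:
  assumes "endo A" "endo B" "V.subspace U" "V.subspace Z"
  shows "V.subspace (rel_iter A B U Z j)"
proof (induction j)
  case (Suc j)
  then show ?case
    unfolding rel_iter.simps
    by (rule E.linear_subspace_image[OF assms(2) subspace_preimage[OF assms(1,3)]])
qed (simp add: assms(4))

lemma rel_iter_subset:
  assumes "B ` U \<subseteq> W" "Z \<subseteq> W"
  shows "rel_iter A B U Z j \<subseteq> W"
  using assms by (cases j) auto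

lemma rel_iter_increasing:
  assumes "Z \<subseteq> rel_iter A B U Z 1"
  shows "rel_iter A B U Z j \<subseteq> rel_iter A B U Z (Suc j)"
proof (induction j)
  case (Suc j)
  then show ?case by auto
qed (use assms in simp)

lemma rel_iter_decreasing:
  assumes "rel_iter A B U Z 1 \<subseteq> Z"
  shows "rel_iter A B U Z (Suc j) \<subseteq> rel_iter A B U Z j"
proof (induction j)
  case (Suc j)
  then show ?case by auto
qed (use assms in simp)

lemma rel_iter_mono_index:
  assumes "Z \<subseteq> rel_iter A B U Z 1" "i \<le> j"
  shows "rel_iter A B U Z i \<subseteq> rel_iter A B U Z j"
  using lift_Suc_mono_le[of "rel_iter A B U Z"] rel_iter_increasing[OF assms(1)] assms(2) by simp

lemma zero_in_rel_iter:
  assumes "endo A" "endo B" "V.subspace U" "V.subspace Z"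
  shows "0 \<in> rel_iter A B U Z j"
  using V.subspace_0[OF subspace_rel_iter[OF assms]] .

lemma zero_iter_increasing:
  assumes "endo A" "endo B" "V.subspace U" "i \<le> j"
  shows "rel_iter A B U {0} i \<subseteq> rel_iter A B U {0} j"
  using rel_iter_mono_index[of "{0}" A B U i j] zero_in_rel_iter[OF assms(1-3), of "{0}" 1] assms(4)
  by simp

text \<open>The choices of preimages that put \<open>A x\<close> into the \<open>j\<close>-th iterate form a zigzag
  \<open>A u\<^sub>0 \<in> Z\<close>, \<open>A u\<^sub>i\<^sub>+\<^sub>1 = B u\<^sub>i\<close>, \<open>u\<^sub>j = x\<close>.  Such zigzags become the bases of the summands.\<close>
lemma element_chain:
  assumes "x \<in> U" "A x \<in> rel_iter A B U Z j"
  shows "\<exists>u. u j = x \<and> (\<forall>i\<le>j. u i \<in> U \<and> A (u i) \<in> rel_iter A B U Z i) \<and>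
    (\<forall>i<j. A (u (Suc i)) = B (u i))"
  using assms
proof (induction j arbitrary: x)
  case 0
  then show ?case by (intro exI[of _ "\<lambda>_. x"]) simp
next
  case (Suc j)
  then obtain y where y: "y \<in> U" "A y \<in> rel_iter A B U Z j" "A x = B y" by auto
  from Suc.IH[OF y(1,2)] obtain u where u: "u j = y"
    "\<And>i. i \<le> j \<Longrightarrow> u i \<in> U \<and> A (u i) \<in> rel_iter A B U Z i"
    "\<And>i. i < j \<Longrightarrow> A (u (Suc i)) = B (u i)" by auto
  show ?case
  proof (intro exI[of _ "u(Suc j := x)"] conjI allI impI)
    fix i assume "i \<le> Suc j"
    then show "(u(Suc j := x)) i \<in> U" "A ((u(Suc j := x)) i) \<in> rel_iter A B U Z i"
      using u(2)[of i] Suc.prems by (cases "i = Suc j"; simp)+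
  next
    fix i assume "i < Suc j"
    then show "A ((u(Suc j := x)) (Suc i)) = B ((u(Suc j := x)) i)"
      using u(1,3) y(3) by (cases "i = j") auto
  qed simp
qed

text \<open>The dual of \<open>element_chain\<close>: a linear form vanishing on \<open>Y j\<close> is transported step by step with
  \<open>functional_factor\<close>, and the \<open>i\<close>-th form vanishes on \<open>Y (j - i)\<close>.  The subspaces \<open>Y\<close> are only
  required to be compatible with the relation, because Jordan blocks need larger ones than the
  iterates.\<close>
lemma functional_chain:
  assumes A: "endo A" and B: "endo B" and U: "V.subspace U"
    and Y: "\<And>i. i \<le> j \<Longrightarrow> V.subspace (Y i)"
    and step: "\<And>i x. i < j \<Longrightarrow> x \<in> U \<Longrightarrow> A x \<in> Y i \<Longrightarrow> B x \<in> Y (Suc i)"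
    and g0: "functional g0" "\<And>z. z \<in> Y j \<Longrightarrow> g0 z = 0"
  shows "\<exists>g. g 0 = g0 \<and> (\<forall>i. functional (g i)) \<and> (\<forall>i\<le>j. \<forall>z\<in>Y (j - i). g i z = 0) \<and>
    (\<forall>i<j. \<forall>x\<in>U. g (Suc i) (A x) = g i (B x))"
  using Y step g0
proof (induction j arbitrary: g0)
  case 0
  then show ?case by (intro exI[of _ "\<lambda>_. g0"]) simp
next
  case (Suc j)
  have Yj: "V.subspace (Y j)" by (rule Suc.prems(1)) simp
  have van: "g0 (B x) = 0" if "x \<in> U" "A x \<in> Y j" for x
    by (rule Suc.prems(4)[OF Suc.prems(2)[OF _ that]]) simp
  obtain h where h: "functional h" "\<And>z. z \<in> Y j \<Longrightarrow> h z = 0" "\<And>x. x \<in> U \<Longrightarrow> h (A x) = g0 (B x)"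
    by (rule functional_factor[OF A B U Yj Suc.prems(3) van]) blast+
  have "\<exists>g. g 0 = h \<and> (\<forall>i. functional (g i)) \<and> (\<forall>i\<le>j. \<forall>z\<in>Y (j - i). g i z = 0) \<and>
    (\<forall>i<j. \<forall>x\<in>U. g (Suc i) (A x) = g i (B x))"
  proof (rule Suc.IH)
    show "V.subspace (Y i)" if "i \<le> j" for i by (rule Suc.prems(1)) (use that in simp)
    show "B x \<in> Y (Suc i)" if "i < j" "x \<in> U" "A x \<in> Y i" for i x
      by (rule Suc.prems(2)[OF _ that(2,3)]) (use that(1) in simp)
  qed (fact h)+
  then obtain g where g0: "g 0 = h" and *: "\<forall>i. functional (g i)"
    "\<forall>i\<le>j. \<forall>z\<in>Y (j - i). g i z = 0" "\<forall>i<j. \<forall>x\<in>U. g (Suc i) (A x) = g i (B x)"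
    by (elim exE conjE) (rule that)
  note g = g0 *[rule_format]
  show ?case
  proof (intro exI[of _ "\<lambda>i. case i of 0 \<Rightarrow> g0 | Suc i \<Rightarrow> g i"] conjI allI impI ballI)
    fix i show "functional (case i of 0 \<Rightarrow> g0 | Suc i \<Rightarrow> g i)"
      using Suc.prems(3) g(2) by (cases i) simp_all
  next
    fix i z assume "i \<le> Suc j" "z \<in> Y (Suc j - i)"
    then show "(case i of 0 \<Rightarrow> g0 | Suc i \<Rightarrow> g i) z = 0"
      using Suc.prems(4)[of z] g(3)[of "i - 1" z] by (cases i) simp_all
  next
    fix i x assume "i < Suc j" "x \<in> U"
    then show "(case Suc i of 0 \<Rightarrow> g0 | Suc i \<Rightarrow> g i) (A x) = (case i of 0 \<Rightarrow> g0 | Suc i \<Rightarrow> g i) (B x)"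
      using h(3)[of x] g(1) g(4)[of "i - 1" x] by (cases i) simp_all
  qed simp
qed

section \<open>Splitting off a summand\<close>

definition internal_sum :: "'b set \<Rightarrow> 'b set \<Rightarrow> 'b set \<Rightarrow> bool" where
  "internal_sum S S1 S2 \<longleftrightarrow> V.subspace S1 \<and> V.subspace S2 \<and> S1 \<subseteq> S \<and> S2 \<subseteq> S \<and>
     S1 \<inter> S2 = {0} \<and> (\<forall>x\<in>S. \<exists>y\<in>S1. \<exists>z\<in>S2. x = y + z)"

lemma internal_sumE:
  assumes "internal_sum S S1 S2" "x \<in> S"
  obtains y z where "y \<in> S1" "z \<in> S2" "x = y + z"
proof -
  have "\<exists>y\<in>S1. \<exists>z\<in>S2. x = y + z" using assms by (simp add: internal_sum_def)
  then show thesis by (elim bexE) (rule that)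
qed

definition indecomposable_pencil :: "('b \<Rightarrow> 'b) \<Rightarrow> ('b \<Rightarrow> 'b) \<Rightarrow> 'b set \<Rightarrow> 'b set \<Rightarrow> bool" where
  "indecomposable_pencil a b U W \<longleftrightarrow>
     (\<forall>U1 U2 W1 W2. internal_sum U U1 U2 \<longrightarrow> internal_sum W W1 W2 \<longrightarrow>
        a ` U1 \<subseteq> W1 \<longrightarrow> b ` U1 \<subseteq> W1 \<longrightarrow> a ` U2 \<subseteq> W2 \<longrightarrow> b ` U2 \<subseteq> W2 \<longrightarrow>
        U1 = {0} \<and> W1 = {0} \<or> U2 = {0} \<and> W2 = {0})"

definition dual_family :: "nat \<Rightarrow> 'b set \<Rightarrow> (nat \<Rightarrow> 'b) \<Rightarrow> (nat \<Rightarrow> 'b \<Rightarrow> 'k) \<Rightarrow> bool" where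
  "dual_family m U e \<phi> \<longleftrightarrow> (\<forall>i<m. e i \<in> U \<and> functional (\<phi> i)) \<and>
     (\<forall>i<m. \<forall>j<m. \<phi> i (e j) = (if i = j then 1 else 0))"

text \<open>The first half says that \<open>a\<close> has the matrix \<open>M\<close> on the span of \<open>e\<close>.  The second half is the
  same for the forms; it makes \<open>a\<close> map the common kernel of \<open>\<phi>\<close> into that of \<open>\<psi>\<close>.\<close>
definition matrix_of :: "nat \<Rightarrow> nat \<Rightarrow> ('b \<Rightarrow> 'b) \<Rightarrow> 'b set \<Rightarrow> (nat \<Rightarrow> 'b) \<Rightarrow> (nat \<Rightarrow> 'b \<Rightarrow> 'k) \<Rightarrow>
    (nat \<Rightarrow> 'b) \<Rightarrow> (nat \<Rightarrow> 'b \<Rightarrow> 'k) \<Rightarrow> 'k mat \<Rightarrow> bool" where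
  "matrix_of m n a U e \<phi> e' \<psi> M \<longleftrightarrow>
     (\<forall>j<m. a (e j) = (\<Sum>i<n. M $$ (i, j) *s e' i)) \<and>
     (\<forall>x\<in>U. \<forall>i<n. \<psi> i (a x) = (\<Sum>j<m. M $$ (i, j) * \<phi> j x))"

definition coordinates :: "nat \<Rightarrow> 'b set \<Rightarrow> (nat \<Rightarrow> 'b) \<Rightarrow> (nat \<Rightarrow> 'b \<Rightarrow> 'k) \<Rightarrow> bool" where
  "coordinates m U e \<phi> \<longleftrightarrow> dual_family m U e \<phi> \<and> (\<forall>x\<in>U. (\<forall>i<m. \<phi> i x = 0) \<longrightarrow> x = 0)"

lemma coordinates_zero:
  assumes "coordinates m U e \<phi>" "x \<in> U" "\<And>i. i < m \<Longrightarrow> \<phi> i x = 0"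
  shows "x = 0"
  using assms by (simp add: coordinates_def)

lemma dual_family_sum:
  assumes "dual_family m U e \<phi>" "i < m"
  shows "\<phi> i (\<Sum>j<m. c j *s e j) = c i"
proof -
  have l: "functional (\<phi> i)" using assms by (simp add: dual_family_def)
  have "\<phi> i (\<Sum>j<m. c j *s e j) = (\<Sum>j<m. c j * \<phi> i (e j))"
    by (simp add: F.linear_sum[OF l] F.linear_scale[OF l])
  also have "\<dots> = (\<Sum>j<m. if j = i then c j else 0)"
    by (intro sum.cong) (use assms in \<open>auto simp: dual_family_def\<close>)
  also have "\<dots> = c i" using assms(2) by simp
  finally show ?thesis .
qed

text \<open>The map \<open>x \<mapsto> \<Sum>j<m. \<phi> j x *s e j\<close> is a projection onto the span with the common kernel as its kernel.\<close>
lemma dual_family_split: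
  assumes U: "V.subspace U" and d: "dual_family m U e \<phi>"
  shows "internal_sum U (range (\<lambda>c. \<Sum>j<m. c j *s e j)) {x \<in> U. \<forall>i<m. \<phi> i x = 0}"
    (is "internal_sum U ?S ?K")
  unfolding internal_sum_def
proof (intro conjI)
  have lin: "functional (\<phi> i)" if "i < m" for i using that d by (simp add: dual_family_def)
  show "V.subspace ?S"
  proof (rule V.subspaceI)
    show "0 \<in> ?S" by (rule range_eqI[of _ _ "\<lambda>_. 0"]) simp
  next
    fix x y assume "x \<in> ?S" "y \<in> ?S"
    then obtain c d where "x = (\<Sum>j<m. c j *s e j)" "y = (\<Sum>j<m. d j *s e j)" by blast
    then show "x + y \<in> ?S"
      by (intro range_eqI[of _ _ "\<lambda>j. c j + d j"]) (simp add: V.scale_left_distrib sum.distrib)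
  next
    fix a x assume "x \<in> ?S"
    then obtain c where "x = (\<Sum>j<m. c j *s e j)" by blast
    then show "a *s x \<in> ?S"
      by (intro range_eqI[of _ _ "\<lambda>j. a * c j"]) (simp add: V.scale_sum_right)
  qed
  show "V.subspace ?K"
    by (rule V.subspaceI)
      (simp_all add: V.subspace_0[OF U] V.subspace_add[OF U] V.subspace_scale[OF U]
        F.linear_0[OF lin] F.linear_add[OF lin] F.linear_scale[OF lin])
  show "?S \<subseteq> U"
    using d by (auto intro!: V.subspace_sum[OF U] V.subspace_scale[OF U] simp: dual_family_def)
  show "?K \<subseteq> U" by blast
  show "?S \<inter> ?K = {0}"
  proof (intro equalityI subsetI)
    fix x assume "x \<in> ?S \<inter> ?K"
    then obtain c where c: "x = (\<Sum>j<m. c j *s e j)" "\<And>i. i < m \<Longrightarrow> \<phi> i x = 0" by blast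
    then have "c i = 0" if "i < m" for i using dual_family_sum[OF d that, of c] that by simp
    then show "x \<in> {0}" using c(1) by simp
  next
    fix x assume "x \<in> {0 :: 'b}"
    then show "x \<in> ?S \<inter> ?K"
      using range_eqI[of 0 "\<lambda>c. \<Sum>j<m. c j *s e j" "\<lambda>_. 0"]
      by (simp add: V.subspace_0[OF U] F.linear_0[OF lin])
  qed
  show "\<forall>x\<in>U. \<exists>y\<in>?S. \<exists>z\<in>?K. x = y + z"
  proof
    fix x assume x: "x \<in> U"
    define y where "y = (\<Sum>j<m. \<phi> j x *s e j)"
    have y: "y \<in> ?S" unfolding y_def by (rule range_eqI[of _ _ "\<lambda>j. \<phi> j x"]) simp
    have "x - y \<in> U" using \<open>?S \<subseteq> U\<close> y x by (intro V.subspace_diff[OF U]) auto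
    moreover have "\<phi> i (x - y) = 0" if "i < m" for i
      using dual_family_sum[OF d that, of "\<lambda>j. \<phi> j x"] by (simp add: F.linear_diff[OF lin[OF that]] y_def)
    ultimately have "x - y \<in> ?K" by simp
    then show "\<exists>y\<in>?S. \<exists>z\<in>?K. x = y + z" using y by (intro bexI[of _ y] bexI[of _ "x - y"]) simp_all
  qed
qed

lemma matrix_of_image:
  assumes a: "endo a" and M: "matrix_of m n a U e \<phi> e' \<psi> M" and inc: "a ` U \<subseteq> W"
  shows "a ` range (\<lambda>c. \<Sum>j<m. c j *s e j) \<subseteq> range (\<lambda>c. \<Sum>i<n. c i *s e' i)"
    and "a ` {x \<in> U. \<forall>i<m. \<phi> i x = 0} \<subseteq> {y \<in> W. \<forall>i<n. \<psi> i y = 0}"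
proof -
  show "a ` range (\<lambda>c. \<Sum>j<m. c j *s e j) \<subseteq> range (\<lambda>c. \<Sum>i<n. c i *s e' i)"
  proof clarsimp
    fix c :: "nat \<Rightarrow> 'k"
    have "a (\<Sum>j<m. c j *s e j) = (\<Sum>j<m. \<Sum>i<n. (c j * M $$ (i, j)) *s e' i)"
      using M by (simp add: matrix_of_def E.linear_sum[OF a] E.linear_scale[OF a] V.scale_sum_right)
    also have "\<dots> = (\<Sum>i<n. (\<Sum>j<m. c j * M $$ (i, j)) *s e' i)"
      by (subst sum.swap) (simp add: V.scale_sum_left)
    finally show "a (\<Sum>j<m. c j *s e j) \<in> range (\<lambda>c. \<Sum>i<n. c i *s e' i)" by simp
  qed
  show "a ` {x \<in> U. \<forall>i<m. \<phi> i x = 0} \<subseteq> {y \<in> W. \<forall>i<n. \<psi> i y = 0}"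
    using M inc by (auto simp: matrix_of_def)
qed

text \<open>The spans and the common kernels decompose the pair of maps.  The spans are not both zero, so
  the common kernels are.\<close>
lemma indecomposable_eq_summand:
  assumes ind: "indecomposable_pencil a b U W"
    and a: "endo a" and b: "endo b" and U: "V.subspace U" and W: "V.subspace W"
    and aU: "a ` U \<subseteq> W" and bU: "b ` U \<subseteq> W"
    and d: "dual_family m U e \<phi>" and d': "dual_family n W e' \<psi>"
    and A: "matrix_of m n a U e \<phi> e' \<psi> A" and B: "matrix_of m n b U e \<phi> e' \<psi> B"
    and nontriv: "m > 0 \<or> n > 0"
  shows "coordinates m U e \<phi>" "coordinates n W e' \<psi>"
proof -
  let ?S = "range (\<lambda>c. \<Sum>j<m. c j *s e j)" and ?S' = "range (\<lambda>c. \<Sum>j<n. c j *s e' j)"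
  let ?K = "{x \<in> U. \<forall>i<m. \<phi> i x = 0}" and ?K' = "{x \<in> W. \<forall>i<n. \<psi> i x = 0}"
  have alt: "?S = {0} \<and> ?S' = {0} \<or> ?K = {0} \<and> ?K' = {0}"
    by (rule ind[unfolded indecomposable_pencil_def, rule_format,
      OF dual_family_split[OF U d] dual_family_split[OF W d']
        matrix_of_image(1)[OF a A aU] matrix_of_image(1)[OF b B bU]
        matrix_of_image(2)[OF a A aU] matrix_of_image(2)[OF b B bU]])
  have nz: "range (\<lambda>c. \<Sum>j<p. c j *s f j) \<noteq> {0}"
    if df: "dual_family p X f \<chi>" and p: "p > 0" for p X f \<chi>
  proof
    assume *: "range (\<lambda>c. \<Sum>j<p. c j *s f j) = {0}"
    have "(\<Sum>j<p. (1::'k) *s f j) \<in> range (\<lambda>c. \<Sum>j<p. c j *s f j)"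
      by (rule range_eqI[of _ _ "\<lambda>_. 1"]) simp
    then have "(\<Sum>j<p. (1::'k) *s f j) = 0" unfolding * by simp
    moreover have "functional (\<chi> 0)" using df p by (simp add: dual_family_def)
    ultimately show False
      using dual_family_sum[OF df p, of "\<lambda>_. 1"] F.linear_0[of "\<chi> 0"] by simp
  qed
  have "\<not> (?S = {0} \<and> ?S' = {0})"
    using nontriv nz[OF d] nz[OF d'] by (elim disjE) simp_all
  with alt have K: "?K = {0}" "?K' = {0}" by simp_all
  show "coordinates m U e \<phi>"
    unfolding coordinates_def
  proof (intro conjI d ballI impI)
    fix x assume "x \<in> U" "\<forall>i<m. \<phi> i x = 0"
    then have "x \<in> ?K" by simp
    then show "x = 0" unfolding K by simp
  qed
  show "coordinates n W e' \<psi>"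
    unfolding coordinates_def
  proof (intro conjI d' ballI impI)
    fix x assume "x \<in> W" "\<forall>i<n. \<psi> i x = 0"
    then have "x \<in> ?K'" by simp
    then show "x = 0" unfolding K by simp
  qed
qed

end

section \<open>Kronecker's classification of indecomposable pencils\<close>

definition P_mat1 :: "nat \<Rightarrow> 'k :: field mat" where "P_mat1 r = 1\<^sub>m r @\<^sub>r 0\<^sub>m 1 r"
definition P_mat2 :: "nat \<Rightarrow> 'k :: field mat" where "P_mat2 r = 0\<^sub>m 1 r @\<^sub>r 1\<^sub>m r"
definition I_mat1 :: "nat \<Rightarrow> 'k :: field mat" where
  "I_mat1 r = four_block_mat (1\<^sub>m r) (0\<^sub>m r 1) (0\<^sub>m 0 r) (0\<^sub>m 0 1)"
definition I_mat2 :: "nat \<Rightarrow> 'k :: field mat" where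
  "I_mat2 r = four_block_mat (0\<^sub>m r 1) (1\<^sub>m r) (0\<^sub>m 0 1) (0\<^sub>m 0 r)"

lemma P_mat_index:
  assumes "i < Suc r" "j < r"
  shows "P_mat1 r $$ (i, j) = (if i = j then 1 else 0)"
    "P_mat2 r $$ (i, j) = (if i = Suc j then 1 else 0)"
  using assms by (auto simp: append_rows_def P_mat1_def P_mat2_def)

lemma I_mat_index:
  assumes "i < r" "j < Suc r"
  shows "I_mat1 r $$ (i, j) = (if i = j then 1 else 0)"
    "I_mat2 r $$ (i, j) = (if j = Suc i then 1 else 0)"
  using assms by (auto simp: I_mat1_def I_mat2_def)

lemma sum_delta_Suc:
  fixes f :: "nat \<Rightarrow> 'a :: comm_monoid_add"
  shows "(\<Sum>i<n. if j = Suc i then f i else 0) = (case j of 0 \<Rightarrow> 0 | Suc k \<Rightarrow> if k < n then f k else 0)"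
  by (cases j) simp_all

lemma sum_delta_less:
  fixes f :: "nat \<Rightarrow> 'a :: comm_monoid_add"
  shows "(\<Sum>i<n. if i = j then f i else 0) = (if j < n then f j else 0)"
    "(\<Sum>i<n. if j = i then f i else 0) = (if j < n then f j else 0)"
    "(\<Sum>i<n. if i = Suc j then f i else 0) = (if Suc j < n then f (Suc j) else 0)"
    "(\<Sum>i<n. if Suc j = i then f i else 0) = (if Suc j < n then f (Suc j) else 0)"
  by simp_all

locale pencil = lin_space scale
  for scale :: "'k :: field \<Rightarrow> 'b :: ab_group_add \<Rightarrow> 'b" (infixr "*s" 75) +
  fixes a b :: "'b \<Rightarrow> 'b" and U W :: "'b set"
  assumes a: "endo a" and b: "endo b" and U: "V.subspace U" and W: "V.subspace W"
    and aU: "a ` U \<subseteq> W" and bU: "b ` U \<subseteq> W"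
begin

definition has_summand :: "nat \<Rightarrow> nat \<Rightarrow> 'k mat \<Rightarrow> 'k mat \<Rightarrow> bool" where
  "has_summand m n A B \<longleftrightarrow> (\<exists>e \<phi> e' \<psi>. dual_family m U e \<phi> \<and> dual_family n W e' \<psi> \<and>
     matrix_of m n a U e \<phi> e' \<psi> A \<and> matrix_of m n b U e \<phi> e' \<psi> B)"

lemma has_summandI:
  assumes "\<And>i. i < m \<Longrightarrow> e i \<in> U" "\<And>i. i < m \<Longrightarrow> functional (\<phi> i)"
    "\<And>i j. i < m \<Longrightarrow> j < m \<Longrightarrow> \<phi> i (e j) = (if i = j then 1 else 0)"
    "\<And>i. i < n \<Longrightarrow> e' i \<in> W" "\<And>i. i < n \<Longrightarrow> functional (\<psi> i)"
    "\<And>i j. i < n \<Longrightarrow> j < n \<Longrightarrow> \<psi> i (e' j) = (if i = j then 1 else 0)"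
    "\<And>j. j < m \<Longrightarrow> a (e j) = (\<Sum>i<n. A $$ (i, j) *s e' i)"
    "\<And>j. j < m \<Longrightarrow> b (e j) = (\<Sum>i<n. B $$ (i, j) *s e' i)"
    "\<And>x i. x \<in> U \<Longrightarrow> i < n \<Longrightarrow> \<psi> i (a x) = (\<Sum>j<m. A $$ (i, j) * \<phi> j x)"
    "\<And>x i. x \<in> U \<Longrightarrow> i < n \<Longrightarrow> \<psi> i (b x) = (\<Sum>j<m. B $$ (i, j) * \<phi> j x)"
  shows "has_summand m n A B"
  unfolding has_summand_def dual_family_def matrix_of_def
  by (rule exI[of _ e], rule exI[of _ \<phi>], rule exI[of _ e'], rule exI[of _ \<psi>])
    (intro conjI allI impI ballI assms; assumption)

text \<open>By \<open>element_chain\<close> there are \<open>u\<^sub>0, \<dots>, u\<^sub>j = x\<close> with \<open>a u\<^sub>0 = 0\<close>, \<open>a u\<^sub>i\<^sub>+\<^sub>1 = b u\<^sub>i\<close>, \<open>b u\<^sub>j = 0\<close>, that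
  is, \<open>\<Sum>i. t\<^sup>i u\<^sub>i\<close> is killed by \<open>a - t b\<close>.  The least such \<open>j\<close> is
  Kronecker's smallest minimal index.\<close>
definition kernel_chain :: "nat \<Rightarrow> bool" where
  "kernel_chain j \<longleftrightarrow> (\<exists>x\<in>U. x \<noteq> 0 \<and> b x = 0 \<and> a x \<in> rel_iter a b U {0} j)"

lemma delta_scale:
  "(if P then (1::'k) else 0) *s x = (if P then x else 0)"
  by simp

text \<open>In a shortest chain \<open>u\<^sub>0, \<dots>, u\<^sub>r\<close> the vector \<open>a u\<^sub>r\<close> is outside the iterate number \<open>r - 1\<close>, so some
  linear form is \<open>1\<close> at it and \<open>0\<close> on the iterate.  Transporting this form yields forms dual to
  \<open>a u\<^sub>r, \<dots>, a u\<^sub>1\<close>.\<close>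
lemma I_summand:
  assumes ch: "kernel_chain r" and min: "\<And>j. j < r \<Longrightarrow> \<not> kernel_chain j"
  shows "has_summand (r + 1) r (I_mat1 r) (I_mat2 r)"
proof -
  obtain x where x: "x \<in> U" "x \<noteq> 0" "b x = 0" "a x \<in> rel_iter a b U {0} r"
    using ch by (auto simp: kernel_chain_def)
  obtain u where ur: "u r = x"
    and u: "\<forall>i\<le>r. u i \<in> U \<and> a (u i) \<in> rel_iter a b U {0} i"
    and ab: "\<forall>i<r. a (u (Suc i)) = b (u i)"
    using element_chain[OF x(1,4)] by (elim exE conjE) (rule that)
  note uU = u[rule_format, THEN conjunct1] and uZ = u[rule_format, THEN conjunct2]
    and ab = ab[rule_format]
  have u0: "a (u 0) = 0" using uZ[of 0] by simp
  show ?thesis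
  proof (cases r)
    case 0
    obtain f where f: "functional f" "f x = 1"
      by (rule functional_exists[of "{0}" x]) (use x(2) in simp_all)
    show ?thesis
      by (rule has_summandI[where e = "\<lambda>_. x" and \<phi> = "\<lambda>_. f" and e' = "\<lambda>_. 0" and \<psi> = "\<lambda>_ _. 0"])
        (use 0 x ur u0 f in simp_all)
  next
    case (Suc s)
    have "a x \<notin> rel_iter a b U {0} s"
      using min[of s] x(1-3) Suc by (auto simp: kernel_chain_def)
    then obtain g0 where g0: "functional g0" "\<And>z. z \<in> rel_iter a b U {0} s \<Longrightarrow> g0 z = 0" "g0 (a x) = 1"
      by (rule functional_exists[OF subspace_rel_iter[OF a b U V.subspace_single_0]]) blast
    have "\<exists>g. g 0 = g0 \<and> (\<forall>i. functional (g i)) \<and>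
        (\<forall>i\<le>s. \<forall>z\<in>rel_iter a b U {0} (s - i). g i z = 0) \<and>
        (\<forall>i<s. \<forall>x\<in>U. g (Suc i) (a x) = g i (b x))"
      by (rule functional_chain[OF a b U subspace_rel_iter[OF a b U V.subspace_single_0] _ g0(1,2)])
        simp_all
    then obtain g where gg0: "g 0 = g0" and *: "\<forall>i. functional (g i)"
      "\<forall>i<s. \<forall>x\<in>U. g (Suc i) (a x) = g i (b x)" by (elim exE conjE) (rule that)
    note g = *[rule_format]
    have pair: "g j (a (u i)) = (if i + j = r then 1 else 0)" if "j \<le> s" "i \<le> r" for i j
      using that
    proof (induction j arbitrary: i)
      case 0
      show ?case
      proof (cases "i = r")
        case True
        then show ?thesis using g0(3) ur gg0 by simp
      next
        case False
        then have "i \<le> s" using 0 Suc by simp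
        then have "a (u i) \<in> rel_iter a b U {0} s"
          using zero_iter_increasing[OF a b U, of i s] uZ[of i] 0 by auto
        then show ?thesis using g0(2) gg0 False by simp
      qed
    next
      case (Suc j)
      have eq: "g (Suc j) (a (u i)) = g j (b (u i))"
        using g(2)[of j "u i"] uU[of i] Suc.prems by simp
      show ?case
      proof (cases "i = r")
        case True
        then show ?thesis using eq ur x(3) F.linear_0[OF g(1)] by simp
      next
        case False
        then show ?thesis using eq ab[of i] Suc.IH[of "Suc i"] Suc.prems by simp
      qed
    qed
    have pairb: "g s (b (u (r - j))) = (if j = r then 1 else 0)" if "j \<le> r" for j
    proof (cases j)
      case 0
      then show ?thesis using ur x(3) F.linear_0[OF g(1)] Suc by simp
    next
      case (Suc k)
      then show ?thesis
        using ab[of "r - j"] pair[of s "Suc (r - j)"] \<open>r = Suc s\<close> that by auto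
    qed
    \<comment> \<open>In the order of the matrices of \<open>I\<^sub>r\<close>, the map \<open>a\<close> kills the last basis vector and \<open>b\<close> the first,
      so the chain is listed backwards.\<close>
    let ?e = "\<lambda>j. u (r - j)" and ?e' = "\<lambda>j. a (u (r - j))"
    let ?\<phi> = "\<lambda>i. if i < r then (\<lambda>y. g i (a y)) else (\<lambda>y. g s (b y))"
    show ?thesis
    proof (rule has_summandI[where e = ?e and \<phi> = ?\<phi> and e' = ?e' and \<psi> = g])
      show "functional (?\<phi> i)" for i
        using functional_comp[OF a g(1)] functional_comp[OF b g(1)] by simp
      show "?e i \<in> U" for i using uU by simp
      then show "?e' i \<in> W" for i using aU by blast
      show "functional (g i)" for i by (rule g(1))
      show "?\<phi> i (?e j) = (if i = j then 1 else 0)" if "i < r + 1" "j < r + 1" for i j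
      proof (cases "i < r")
        case True
        then show ?thesis using pair[of i "r - j"] that Suc by auto
      next
        case False
        then show ?thesis using pairb[of j] that by auto
      qed
      show "g i (?e' j) = (if i = j then 1 else 0)" if "i < r" "j < r" for i j
        using pair[of i "r - j"] that Suc by auto
      show "a (?e j) = (\<Sum>i<r. I_mat1 r $$ (i, j) *s ?e' i)" if "j < r + 1" for j
      proof -
        have "(\<Sum>i<r. I_mat1 r $$ (i, j) *s ?e' i) = (\<Sum>i<r. if i = j then ?e' i else 0)"
          by (rule sum.cong) (use that in \<open>simp_all add: I_mat_index delta_scale\<close>)
        also have "\<dots> = a (?e j)"
          unfolding sum_delta_less using that u0 by (cases "j = r") auto
        finally show ?thesis by simp
      qed
      show "b (?e j) = (\<Sum>i<r. I_mat2 r $$ (i, j) *s ?e' i)" if "j < r + 1" for j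
      proof -
        have "(\<Sum>i<r. I_mat2 r $$ (i, j) *s ?e' i) = (\<Sum>i<r. if j = Suc i then ?e' i else 0)"
          by (rule sum.cong) (use that in \<open>simp_all add: I_mat_index delta_scale\<close>)
        also have "\<dots> = b (?e j)"
        proof (cases j)
          case 0 then show ?thesis using ur x(3) by simp
        next
          case (Suc k)
          then have "Suc (r - j) = r - k" using that by simp
          then show ?thesis unfolding sum_delta_Suc using ab[of "r - j"] that Suc by simp
        qed
        finally show ?thesis by simp
      qed
      show "g i (a y) = (\<Sum>j<r + 1. I_mat1 r $$ (i, j) * ?\<phi> j y)" if "y \<in> U" "i < r" for y i
      proof -
        have "(\<Sum>j<r + 1. I_mat1 r $$ (i, j) * ?\<phi> j y) = (\<Sum>j<r + 1. if i = j then ?\<phi> j y else 0)"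
          by (rule sum.cong) (use that in \<open>simp_all add: I_mat_index\<close>)
        then show ?thesis unfolding sum_delta_less using that by simp
      qed
      show "g i (b y) = (\<Sum>j<r + 1. I_mat2 r $$ (i, j) * ?\<phi> j y)" if "y \<in> U" "i < r" for y i
      proof -
        have "(\<Sum>j<r + 1. I_mat2 r $$ (i, j) * ?\<phi> j y) = (\<Sum>j<r + 1. if j = Suc i then ?\<phi> j y else 0)"
          by (rule sum.cong) (use that in \<open>simp_all add: I_mat_index\<close>)
        also have "\<dots> = ?\<phi> (Suc i) y" unfolding sum_delta_less using that by simp
        also have "\<dots> = g i (b y)" using g(2)[of i y] that Suc by (cases "i = s") simp_all
        finally show ?thesis by simp
      qed
    qed
  qed
qed

text \<open>The dual of \<open>kernel_chain\<close>: a non-zero form vanishing on \<open>a ` U\<close> and on the iterate number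
  \<open>j + 1\<close> of \<open>W\<close> starts, by \<open>functional_chain\<close>, a chain of forms with \<open>g\<^sub>0 a = 0\<close>,
  \<open>g\<^sub>i\<^sub>+\<^sub>1 a = g\<^sub>i b\<close>, \<open>g\<^sub>j b = 0\<close>.\<close>
definition cokernel_chain :: "nat \<Rightarrow> bool" where
  "cokernel_chain j \<longleftrightarrow> (\<exists>y\<in>W. y \<notin> {x + z | x z. x \<in> a ` U \<and> z \<in> rel_iter a b U W (Suc j)})"

text \<open>Dually to \<open>I_summand\<close>, the shortest chain of linear forms \<open>g\<^sub>0, \<dots>, g\<^sub>r\<close> is primary.  By minimality
  \<open>W\<close> is the sum of \<open>a ` U\<close> and the \<open>r\<close>-th iterate of \<open>W\<close>, so \<open>g\<^sub>0\<close> is \<open>1\<close> at a vector \<open>y\<close> of this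
  iterate; the chain of vectors that leads to \<open>y\<close> is dual to the chain of forms.\<close>
lemma P_summand:
  assumes ch: "cokernel_chain r" and min: "\<And>j. j < r \<Longrightarrow> \<not> cokernel_chain j"
  shows "has_summand r (r + 1) (P_mat1 r) (P_mat2 r)"
proof -
  let ?S = "rel_iter a b U W"
  have S: "V.subspace (?S j)" for j by (rule subspace_rel_iter[OF a b U W])
  have aUs: "V.subspace (a ` U)" by (rule E.linear_subspace_image[OF a U])
  let ?T = "{x + z | x z. x \<in> a ` U \<and> z \<in> ?S (Suc r)}"
  obtain y0 where y0: "y0 \<in> W" "y0 \<notin> ?T" using ch by (auto simp: cokernel_chain_def)
  obtain g0 where g0: "functional g0" "\<And>z. z \<in> ?T \<Longrightarrow> g0 z = 0" "g0 y0 = 1"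
    by (rule functional_exists[OF V.subspace_sums[OF aUs S] y0(2)]) blast
  have g0a: "g0 (a x) = 0" if "x \<in> U" for x
  proof (rule g0(2), intro CollectI exI conjI)
    show "a x = a x + 0" by simp
    show "a x \<in> a ` U" using that by simp
    show "0 \<in> ?S (Suc r)" by (rule V.subspace_0[OF S])
  qed
  have g0S: "g0 z = 0" if "z \<in> ?S (Suc r)" for z
  proof (rule g0(2), intro CollectI exI conjI)
    show "z = 0 + z" by simp
    show "0 \<in> a ` U" by (rule V.subspace_0[OF aUs])
  qed (rule that)
  have "\<exists>x z. y0 = x + z \<and> x \<in> a ` U \<and> z \<in> ?S r"
  proof (cases r)
    case 0
    then show ?thesis
      using y0(1) V.subspace_0[OF aUs] by (intro exI[of _ 0] exI[of _ y0]) simp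
  next
    case (Suc s)
    then have "\<not> cokernel_chain s" using min by simp
    then show ?thesis using y0(1) Suc unfolding cokernel_chain_def by blast
  qed
  then obtain x' y where y: "y0 = a x' + y" "x' \<in> U" "y \<in> ?S r" by auto
  have gy: "g0 y = 1"
    using g0(3) g0a[OF y(2)] unfolding y(1) F.linear_add[OF g0(1)] by simp
  have yW: "y \<in> W" using rel_iter_subset[OF bU order_refl] y(3) by blast
  show ?thesis
  proof (cases r)
    case 0
    have gb: "g0 (b x) = 0" if "x \<in> U" for x
      by (rule g0S) (use that aU 0 in auto)
    show ?thesis
      by (rule has_summandI[where e = "\<lambda>_. 0" and \<phi> = "\<lambda>_ _. 0" and e' = "\<lambda>_. y" and \<psi> = "\<lambda>_. g0"])
        (use 0 g0(1) gy yW g0a gb in simp_all)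
  next
    case (Suc s)
    then obtain x where x: "x \<in> U" "a x \<in> ?S s" "y = b x" using y(3) by auto
    obtain u where us: "u s = x"
      and u: "\<forall>i\<le>s. u i \<in> U \<and> a (u i) \<in> ?S i"
      and ab: "\<forall>i<s. a (u (Suc i)) = b (u i)"
      using element_chain[OF x(1,2)] by (elim exE conjE) (rule that)
    note uU = u[rule_format, THEN conjunct1] and ab = ab[rule_format]
    have "\<exists>g. g 0 = g0 \<and> (\<forall>i. functional (g i)) \<and>
        (\<forall>i\<le>Suc r. \<forall>z\<in>?S (Suc r - i). g i z = 0) \<and>
        (\<forall>i<Suc r. \<forall>x\<in>U. g (Suc i) (a x) = g i (b x))"
      by (rule functional_chain[OF a b U S _ g0(1) g0S]) simp_all
    then obtain g where gg0: "g 0 = g0" and *: "\<forall>i. functional (g i)"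
      "\<forall>i\<le>Suc r. \<forall>z\<in>?S (Suc r - i). g i z = 0"
      "\<forall>i<Suc r. \<forall>x\<in>U. g (Suc i) (a x) = g i (b x)" by (elim exE conjE) (rule that)
    note g = *[rule_format]
    have grb: "g r (b z) = 0" if "z \<in> U" for z
      using g(3)[of r z] g(2)[of "Suc r" "a z"] that aU by auto
    have low: "g (r - k) (b (u i)) = 0" if "k \<le> i" "i \<le> s" for i k
      using that
    proof (induction k arbitrary: i)
      case 0
      then show ?case using grb uU by simp
    next
      case (Suc k)
      then have "Suc (r - Suc k) = r - k" "r - Suc k < Suc r" using \<open>r = Suc s\<close> by simp_all
      then have "g (r - Suc k) (b (u i)) = g (r - k) (a (u i))"
        using g(3)[of "r - Suc k" "u i"] uU[of i] Suc.prems by simp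
      also have "\<dots> = g (r - k) (b (u (i - 1)))"
        using ab[of "i - 1"] Suc.prems by simp
      also have "\<dots> = 0" using Suc.IH[of "i - 1"] Suc.prems by simp
      finally show ?case .
    qed
    have pair: "g j (a (u i)) = (if i + j = r then 1 else 0)" if "j \<le> r" "i \<le> s" for i j
      using that
    proof (induction j arbitrary: i)
      case 0
      then show ?case using g0a uU gg0 Suc by simp
    next
      case (Suc j)
      have eq: "g (Suc j) (a (u i)) = g j (b (u i))"
        using g(3)[of j "u i"] uU[of i] Suc.prems by simp
      show ?case
      proof (cases "i = s")
        case False
        then show ?thesis using eq ab[of i] Suc.IH[of "Suc i"] Suc.prems by simp
      next
        case True
        show ?thesis
        proof (cases j)
          case 0
          then show ?thesis using True eq us x(3) gy gg0 \<open>r = Suc s\<close> by simp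
        next
          case (Suc j')
          then show ?thesis
            using eq low[of "r - j" s] True Suc.prems \<open>r = Suc s\<close> by simp
        qed
      qed
    qed
    let ?e' = "\<lambda>i. if i < r then a (u i) else b (u s)"
    let ?\<phi> = "\<lambda>i x. g (r - i) (a x)"
    let ?\<psi> = "\<lambda>i. g (r - i)"
    have uU': "u i \<in> U" if "i < r" for i using uU[of i] that Suc by simp
    show ?thesis
    proof (rule has_summandI[where e = u and \<phi> = ?\<phi> and e' = ?e' and \<psi> = ?\<psi>])
      show "functional (?\<phi> i)" for i by (rule functional_comp[OF a g(1)])
      show "u i \<in> U" if "i < r" for i by (rule uU'[OF that])
      show "?e' i \<in> W" for i using aU bU uU'[of i] uU[of s] by auto
      show "functional (?\<psi> i)" for i by (rule g(1))
      show "?\<phi> i (u j) = (if i = j then 1 else 0)" if "i < r" "j < r" for i j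
        using pair[of "r - i" j] that Suc by auto
      show "?\<psi> i (?e' j) = (if i = j then 1 else 0)" if "i < r + 1" "j < r + 1" for i j
      proof (cases "j < r")
        case True
        then show ?thesis using pair[of "r - i" j] that Suc by auto
      next
        case False
        then have j: "j = r" using that by simp
        show ?thesis
        proof (cases "i = r")
          case True
          then show ?thesis using j us x(3) gy gg0 by simp
        next
          case False
          then show ?thesis using j low[of i s] that Suc by simp
        qed
      qed
      show "a (u j) = (\<Sum>i<r + 1. P_mat1 r $$ (i, j) *s ?e' i)" if "j < r" for j
      proof -
        have "(\<Sum>i<r + 1. P_mat1 r $$ (i, j) *s ?e' i) = (\<Sum>i<r + 1. if i = j then ?e' i else 0)"
          by (rule sum.cong) (use that in \<open>simp_all add: P_mat_index delta_scale\<close>)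
        then show ?thesis unfolding sum_delta_less using that by simp
      qed
      show "b (u j) = (\<Sum>i<r + 1. P_mat2 r $$ (i, j) *s ?e' i)" if "j < r" for j
      proof -
        have "(\<Sum>i<r + 1. P_mat2 r $$ (i, j) *s ?e' i) = (\<Sum>i<r + 1. if i = Suc j then ?e' i else 0)"
          by (rule sum.cong) (use that in \<open>simp_all add: P_mat_index delta_scale\<close>)
        also have "\<dots> = ?e' (Suc j)" unfolding sum_delta_less using that by simp
        also have "\<dots> = b (u j)" using ab[of j] that Suc by (cases "j = s") simp_all
        finally show ?thesis by simp
      qed
      show "?\<psi> i (a z) = (\<Sum>j<r. P_mat1 r $$ (i, j) * ?\<phi> j z)" if "z \<in> U" "i < r + 1" for z i
      proof -
        have "(\<Sum>j<r. P_mat1 r $$ (i, j) * ?\<phi> j z) = (\<Sum>j<r. if i = j then ?\<phi> j z else 0)"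
          by (rule sum.cong) (use that in \<open>simp_all add: P_mat_index\<close>)
        then show ?thesis unfolding sum_delta_less using that g0a[of z] gg0 by (cases "i = r") simp_all
      qed
      show "?\<psi> i (b z) = (\<Sum>j<r. P_mat2 r $$ (i, j) * ?\<phi> j z)" if "z \<in> U" "i < r + 1" for z i
      proof -
        have "(\<Sum>j<r. P_mat2 r $$ (i, j) * ?\<phi> j z) = (\<Sum>j<r. if i = Suc j then ?\<phi> j z else 0)"
          by (rule sum.cong) (use that in \<open>simp_all add: P_mat_index\<close>)
        also have "\<dots> = ?\<psi> i (b z)"
        proof (cases i)
          case 0
          then show ?thesis using grb that by simp
        next
          case (Suc k)
          then have "Suc (r - i) = r - k" using that by simp
          then show ?thesis
            unfolding sum_delta_Suc using Suc g(3)[of "r - i" z] that by simp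
        qed
        finally show ?thesis by simp
      qed
    qed
  qed
qed

end

text \<open>The basis of a Jordan block of \<open>N\<close> against \<open>M\<close> with eigenvalue \<open>0\<close>, together with dual forms.  The
  iterates \<open>Z\<^sub>j\<close> of \<open>0\<close> under \<open>M N\<^sup>-\<^sup>1\<close> cannot all stay inside \<open>N ` U\<close>: otherwise they become stationary, and
  on the space \<open>S\<close> of all \<open>x\<close> with \<open>N x\<close> in the largest one \<open>M\<close> and \<open>N\<close> have the same image; \<open>M\<close> is injective
  on \<open>S\<close> because chains ending in its kernel are excluded, hence so is \<open>N\<close>, contrary to \<open>N v = 0\<close>.  The
  first iterate to leave \<open>N ` U\<close> contains the end \<open>w\<close> of a maximal chain, and a form vanishing on
  \<open>N ` U\<close> but not at \<open>w\<close> starts the dual chain.\<close>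
lemma (in lin_space) jordan_chain:
  assumes N: "endo N" and M: "endo M" and U: "V.subspace U" "U \<subseteq> V.span T" "finite T"
    and W: "M ` U \<subseteq> W" "V.subspace W" "W \<subseteq> V.span T'" "finite T'"
    and v: "v \<in> U" "v \<noteq> 0" "N v = 0"
    and no_chain: "\<And>x j. x \<in> U \<Longrightarrow> M x = 0 \<Longrightarrow> N x \<in> rel_iter N M U {0} j \<Longrightarrow> x = 0"
  shows "\<exists>q e \<psi>. (\<forall>i\<le>q. e i \<in> U) \<and> (\<forall>i. functional (\<psi> i)) \<and>
    (\<forall>i\<le>q. \<forall>j\<le>q. \<psi> i (M (e j)) = (if i = j then 1 else 0)) \<and>
    N (e 0) = 0 \<and> (\<forall>j<q. N (e (Suc j)) = M (e j)) \<and>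
    (\<forall>x\<in>U. \<psi> q (N x) = 0 \<and> (\<forall>i<q. \<psi> i (N x) = \<psi> (Suc i) (M x)))"
proof -
  let ?Z = "rel_iter N M U {0}"
  have Z: "V.subspace (?Z j)" for j by (rule subspace_rel_iter[OF N M U(1) V.subspace_single_0])
  have NU: "V.subspace (N ` U)" by (rule E.linear_subspace_image[OF N U(1)])
  have ZW: "?Z j \<subseteq> W" for j
    by (rule rel_iter_subset[OF W(1)]) (simp add: V.subspace_0[OF W(2)])
  have "\<exists>j. \<not> ?Z j \<subseteq> N ` U"
  proof (rule ccontr)
    assume "\<not> (\<exists>j. \<not> ?Z j \<subseteq> N ` U)"
    then have sub: "?Z j \<subseteq> N ` U" for j by simp
    have inc: "?Z j \<subseteq> ?Z (Suc j)" for j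
      by (rule zero_iter_increasing[OF N M U(1)]) simp
    have span: "?Z j \<subseteq> V.span T'" for j using ZW W(3) by (rule subset_trans)
    from increasing_stabilises[of ?Z, OF Z inc span W(4)]
    obtain j where j: "?Z (Suc j) = ?Z j" by blast
    define S where "S = {x \<in> U. N x \<in> ?Z j}"
    have S: "V.subspace S" "S \<subseteq> V.span T"
      unfolding S_def using subspace_preimage[OF N U(1) Z] U(2) by auto
    have "N ` S = ?Z j" unfolding S_def using sub[of j] by auto
    moreover have "M ` S = ?Z (Suc j)" unfolding S_def by simp
    ultimately have eq: "M ` S = N ` S" using j by simp
    have "\<forall>x\<in>S. M x = 0 \<longrightarrow> x = 0"
    proof (intro ballI impI)
      fix x assume "x \<in> S" "M x = 0"
      then show "x = 0" by (intro no_chain[of x j]) (simp_all add: S_def)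
    qed
    then have "inj_on M S" unfolding E.linear_inj_on_iff_eq_0[OF M S(1)] .
    then have "inj_on N S" by (rule surjective_imp_injective[OF M N S U(3) _ eq])
    moreover have "v \<in> S" unfolding S_def using v V.subspace_0[OF Z] by simp
    ultimately show False
      using v(2,3) unfolding E.linear_inj_on_iff_eq_0[OF N S(1)] by simp
  qed
  then obtain p where p: "\<not> ?Z p \<subseteq> N ` U" "\<And>j. j < p \<Longrightarrow> ?Z j \<subseteq> N ` U"
    using exists_least_iff[of "\<lambda>j. \<not> ?Z j \<subseteq> N ` U"] by auto
  have "p \<noteq> 0"
  proof
    assume "p = 0"
    then show False using p(1) V.subspace_0[OF NU] by simp
  qed
  then obtain q where q: "p = Suc q" using not0_implies_Suc by blast
  obtain w where "w \<in> ?Z (Suc q)" and wN: "w \<notin> N ` U" using p(1) q by auto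
  then obtain x where x: "x \<in> U" "N x \<in> ?Z q" "w = M x" by auto
  obtain u where uq: "u q = x" and u: "\<forall>i\<le>q. u i \<in> U \<and> N (u i) \<in> ?Z i"
    and NM: "\<forall>i<q. N (u (Suc i)) = M (u i)"
    using element_chain[OF x(1,2)] by (elim exE conjE) (rule that)
  note uU = u[rule_format, THEN conjunct1] and uZ = u[rule_format, THEN conjunct2]
    and NM = NM[rule_format]
  have u0: "N (u 0) = 0" using uZ[of 0] by simp
  obtain g0 where g0: "functional g0" "\<And>z. z \<in> N ` U \<Longrightarrow> g0 z = 0" "g0 w = 1"
    by (rule functional_exists[OF NU wN]) blast
  \<comment> \<open>Adding \<open>w\<close> to the iterates forces all forms after the first to vanish at \<open>w\<close>; this is compatible
    with the relation as long as the iterate lies in \<open>N ` U\<close>, which does not contain \<open>w\<close>.\<close>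
  define Y where "Y i = (if i < q then {z + y | z y. z \<in> ?Z i \<and> y \<in> V.span {w}} else ?Z i)" for i
  have Y: "V.subspace (Y i)" for i
    unfolding Y_def using V.subspace_sums[OF Z V.subspace_span] Z by simp
  have step: "M x \<in> Y (Suc i)" if i: "i < q" and xU: "x \<in> U" and xY: "N x \<in> Y i" for i x
  proof -
    obtain z y where zy: "N x = z + y" "z \<in> ?Z i" "y \<in> V.span {w}" using xY i by (auto simp: Y_def)
    obtain c where c: "y = c *s w" using zy(3) unfolding V.span_singleton by blast
    have "z \<in> N ` U" using p(2)[of i] i q zy(2) by auto
    then have "N x - z \<in> N ` U" using xU by (intro V.subspace_diff[OF NU]) simp_all
    then have cw: "c *s w \<in> N ` U" using zy(1) c by simp
    have "c = 0"
    proof (rule ccontr)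
      assume c0: "c \<noteq> 0"
      have "(1 / c) *s (c *s w) \<in> N ` U" by (rule V.subspace_scale[OF NU cw])
      then show False using wN c0 by simp
    qed
    then have "N x \<in> ?Z i" using zy c by simp
    then have "M x \<in> ?Z (Suc i)" using xU by auto
    then have "M x + 0 \<in> {z + y | z y. z \<in> ?Z (Suc i) \<and> y \<in> V.span {w}}"
      using V.span_zero[of "{w}"] by blast
    then show ?thesis using \<open>M x \<in> ?Z (Suc i)\<close> unfolding Y_def by simp
  qed
  have vanish: "g0 z = 0" if "z \<in> Y q" for z
    using that p(2)[of q] q g0(2) by (auto simp: Y_def)
  have "\<exists>g. g 0 = g0 \<and> (\<forall>i. functional (g i)) \<and> (\<forall>i\<le>q. \<forall>z\<in>Y (q - i). g i z = 0) \<and>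
      (\<forall>i<q. \<forall>x\<in>U. g (Suc i) (N x) = g i (M x))"
    by (rule functional_chain[where Y = Y and j = q, OF N M U(1) Y step g0(1) vanish])
  then obtain g where gg0: "g 0 = g0" and *: "\<forall>i. functional (g i)"
    "\<forall>i\<le>q. \<forall>z\<in>Y (q - i). g i z = 0" "\<forall>i<q. \<forall>x\<in>U. g (Suc i) (N x) = g i (M x)"
    by (elim exE conjE) (rule that)
  note g = *[rule_format]
  have gw: "g i w = 0" if "0 < i" "i \<le> q" for i
  proof (rule g(2)[OF that(2)])
    have "0 + w \<in> {z + y | z y. z \<in> ?Z (q - i) \<and> y \<in> V.span {w}}"
      using V.subspace_0[OF Z] V.span_base[of w "{w}"] by blast
    then show "w \<in> Y (q - i)" unfolding Y_def using that by simp
  qed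
  have pair: "g i (M (u j)) = (if i + j = q then 1 else 0)" if "i \<le> q" "j \<le> q" for i j
    using that
  proof (induction i arbitrary: j)
    case 0
    show ?case
    proof (cases "j = q")
      case True
      then show ?thesis using uq x(3) g0(3) gg0 by simp
    next
      case False
      then have "M (u j) = N (u (Suc j))" "u (Suc j) \<in> U" using NM[of j] uU[of "Suc j"] 0 by simp_all
      then show ?thesis using False g0(2)[of "M (u j)"] gg0 by simp
    qed
  next
    case (Suc i)
    show ?case
    proof (cases "j = q")
      case True
      then show ?thesis using uq x(3) gw[of "Suc i"] Suc.prems by simp
    next
      case False
      then have "M (u j) = N (u (Suc j))" "u (Suc j) \<in> U" using NM[of j] uU[of "Suc j"] Suc.prems by simp_all
      then show ?thesis using False g(3)[of i "u (Suc j)"] Suc.IH[of "Suc j"] Suc.prems by simp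
    qed
  qed
  show ?thesis
  proof (intro exI[of _ q] exI[of _ u] exI[of _ "\<lambda>i. g (q - i)"] conjI allI impI ballI)
    show "u i \<in> U" if "i \<le> q" for i by (rule uU[OF that])
    show "functional (g (q - i))" for i by (rule g(1))
    show "g (q - i) (M (u j)) = (if i = j then 1 else 0)" if "i \<le> q" "j \<le> q" for i j
      using pair[of "q - i" j] that by auto
    show "N (u 0) = 0" by (rule u0)
    show "N (u (Suc j)) = M (u j)" if "j < q" for j by (rule NM[OF that])
    show "g (q - q) (N x) = 0" if "x \<in> U" for x using g0(2)[of "N x"] gg0 that by simp
    show "g (q - i) (N x) = g (q - Suc i) (M x)" if "x \<in> U" "i < q" for x i
      using g(3)[of "q - Suc i" x] that by (simp add: Suc_diff_Suc)
  qed
qed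

context pencil
begin

lemma jordan_sum_vec:
  assumes "j < p"
  shows "(\<Sum>i<p. jordan_block p \<mu> $$ (i, j) *s f i) = \<mu> *s f j + (case j of 0 \<Rightarrow> 0 | Suc k \<Rightarrow> f k)"
proof -
  have "(\<Sum>i<p. jordan_block p \<mu> $$ (i, j) *s f i) =
      (\<Sum>i<p. (if i = j then \<mu> *s f i else 0) + (if j = Suc i then f i else 0))"
    by (rule sum.cong) (use assms in auto)
  then show ?thesis
    unfolding sum.distrib sum_delta_less sum_delta_Suc using assms by (auto split: nat.split)
qed

lemma jordan_sum_scalar:
  assumes "i < p"
  shows "(\<Sum>j<p. jordan_block p \<mu> $$ (i, j) * f j) = \<mu> * f i + (if Suc i < p then f (Suc i) else (0 :: 'k))"
proof -
  have "(\<Sum>j<p. jordan_block p \<mu> $$ (i, j) * f j) =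
      (\<Sum>j<p. (if i = j then \<mu> * f j else 0) + (if Suc i = j then f j else 0))"
    by (rule sum.cong) (use assms in auto)
  then show ?thesis
    unfolding sum.distrib sum_delta_less using assms by simp
qed

lemma one_sum_vec:
  assumes "j < p"
  shows "(\<Sum>i<p. 1\<^sub>m p $$ (i, j) *s f i) = f j"
proof -
  have "(\<Sum>i<p. 1\<^sub>m p $$ (i, j) *s f i) = (\<Sum>i<p. if i = j then f i else 0)"
    by (rule sum.cong) (use assms in simp_all)
  then show ?thesis unfolding sum_delta_less using assms by simp
qed

lemma one_sum_scalar:
  assumes "i < p"
  shows "(\<Sum>j<p. 1\<^sub>m p $$ (i, j) * f j) = (f i :: 'k)"
proof -
  have "(\<Sum>j<p. 1\<^sub>m p $$ (i, j) * f j) = (\<Sum>j<p. if i = j then f j else 0)"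
    by (rule sum.cong) (use assms in simp_all)
  then show ?thesis unfolding sum_delta_less using assms by simp
qed

end

text \<open>The Kronecker representations \<open>P\<^sub>r\<close>, \<open>I\<^sub>r\<close>, \<open>R\<^sub>p\<^sub>,\<^sub>\<lambda>\<close> as pairs of matrices, including \<open>P\<^sub>0\<close>, the simple
  representation at the second vertex.\<close>
definition kronecker_model :: "nat \<Rightarrow> nat \<Rightarrow> 'k :: field mat \<Rightarrow> 'k mat \<Rightarrow> bool" where
  "kronecker_model m n A B \<longleftrightarrow>
     n = m + 1 \<and> A = P_mat1 m \<and> B = P_mat2 m \<or>
     m = n + 1 \<and> A = I_mat1 n \<and> B = I_mat2 n \<or>
     m \<ge> 1 \<and> n = m \<and> (\<exists>\<mu>. A = jordan_block m \<mu> \<and> B = 1\<^sub>m m \<or> A = 1\<^sub>m m \<and> B = jordan_block m \<mu>)"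

locale alg_closed_pencil = pencil scale a b U W + lin_space_alg_closed scale
  for scale :: "'k :: alg_closed_field \<Rightarrow> 'b :: ab_group_add \<Rightarrow> 'b" (infixr "*s" 75)
    and a b :: "'b \<Rightarrow> 'b" and U W :: "'b set" +
  fixes T T' :: "'b set"
  assumes U_fin: "U \<subseteq> V.span T" "finite T" and W_fin: "W \<subseteq> V.span T'" "finite T'"
begin

text \<open>The images of \<open>W\<close> under the powers of \<open>b a\<^sup>-\<^sup>1\<close> shrink to a stable one, which lies in \<open>a ` U\<close> by a
  dimension count.  Without dual chains \<open>W\<close> is the sum of it and \<open>a ` U\<close>, so \<open>a\<close> is bijective.  An
  eigenvector of \<open>a\<^sup>-\<^sup>1 b\<close> with eigenvalue \<open>\<mu>\<close> then starts a Jordan chain of \<open>b - \<mu> a\<close> against \<open>a\<close>.\<close>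
lemma injective_summand:
  assumes inj: "inj_on a U" and U0: "U \<noteq> {0}" and no_chain: "\<And>j. \<not> cokernel_chain j"
  shows "\<exists>p\<ge>1. \<exists>\<mu>. has_summand p p (1\<^sub>m p) (jordan_block p \<mu>)"
proof -
  let ?S = "rel_iter a b U W"
  have S: "V.subspace (?S j)" for j by (rule subspace_rel_iter[OF a b U W])
  have SW: "?S j \<subseteq> W" for j by (rule rel_iter_subset[OF bU order_refl])
  have dec: "?S (Suc j) \<subseteq> ?S j" for j
    by (rule rel_iter_decreasing) (use bU in auto)
  have span: "?S j \<subseteq> V.span T'" for j using SW W_fin(1) by (rule subset_trans)
  from decreasing_stabilises[of ?S, OF S dec span W_fin(2)]
  obtain j where j: "?S (Suc j) = ?S j" by blast
  define X where "X = {x \<in> U. a x \<in> ?S j}"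
  have X: "V.subspace X" "X \<subseteq> V.span T"
    unfolding X_def using subspace_preimage[OF a U S] U_fin(1) by auto
  have bX: "b ` X = ?S j" using j unfolding X_def by simp
  have "inj_on a X" by (rule inj_on_subset[OF inj]) (auto simp: X_def)
  then have "a ` X = b ` X"
    by (rule injective_into_image_onto[OF a b X U_fin(2)]) (unfold bX, auto simp: X_def)
  then have SaU: "?S (Suc j) \<subseteq> a ` U" using bX j by (auto simp: X_def)
  have aUs: "V.subspace (a ` U)" by (rule E.linear_subspace_image[OF a U])
  have aW: "a ` U = W"
  proof (rule equalityI[OF aU], rule subsetI)
    fix y assume "y \<in> W"
    then obtain x z where "y = x + z" "x \<in> a ` U" "z \<in> ?S (Suc j)"
      using no_chain[of j] unfolding cokernel_chain_def by blast
    moreover from this SaU have "z \<in> a ` U" by (elim subsetD)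
    ultimately show "y \<in> a ` U" using V.subspace_add[OF aUs] by simp
  qed
  obtain g where g: "endo g" "range g \<subseteq> U" "\<And>x. x \<in> U \<Longrightarrow> a (g (a x)) = a x"
    by (rule section_exists[OF a U]) blast
  define f where "f x = g (b x)" for x
  have f: "endo f" unfolding f_def[abs_def] by (rule endo_comp[OF b g(1)])
  have fU: "f ` U \<subseteq> U" using g(2) by (auto simp: f_def)
  have af: "a (f x) = b x" if "x \<in> U" for x
  proof -
    have "b x \<in> a ` U" using bU that aW by auto
    then obtain y where "y \<in> U" "b x = a y" by auto
    then show ?thesis unfolding f_def using g(3) by simp
  qed
  obtain u where "u \<in> U" "u \<noteq> 0" using U0 V.subspace_0[OF U] by blast
  then obtain \<mu> v where v: "v \<in> U" "v \<noteq> 0" "f v = \<mu> *s v"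
    by (rule eigenvector_exists[OF f U U_fin fU])
  define N where "N x = b x - \<mu> *s a x" for x
  have N: "endo N"
    unfolding N_def[abs_def]
    by (rule E.linear_compose_sub[OF b E.linear_compose_scale_right[OF a]])
  have Nv: "N v = 0" unfolding N_def af[OF v(1), symmetric] v(3) E.linear_scale[OF a] by simp
  have "\<exists>q e \<psi>. (\<forall>i\<le>q. e i \<in> U) \<and> (\<forall>i. functional (\<psi> i)) \<and>
      (\<forall>i\<le>q. \<forall>j\<le>q. \<psi> i (a (e j)) = (if i = j then 1 else 0)) \<and>
      N (e 0) = 0 \<and> (\<forall>j<q. N (e (Suc j)) = a (e j)) \<and>
      (\<forall>x\<in>U. \<psi> q (N x) = 0 \<and> (\<forall>i<q. \<psi> i (N x) = \<psi> (Suc i) (a x)))"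
  proof (rule jordan_chain[OF N a U U_fin aU W W_fin v(1,2) Nv])
    fix x assume "x \<in> U" "a x = 0"
    then show "x = 0" using inj unfolding E.linear_inj_on_iff_eq_0[OF a U] by simp
  qed
  then obtain q e \<psi> where *: "\<forall>i\<le>q. e i \<in> U" "\<forall>i. functional (\<psi> i)"
    "\<forall>i\<le>q. \<forall>j\<le>q. \<psi> i (a (e j)) = (if i = j then 1 else 0)"
    and e0: "N (e 0) = 0" and **: "\<forall>j<q. N (e (Suc j)) = a (e j)"
    "\<forall>x\<in>U. \<psi> q (N x) = 0 \<and> (\<forall>i<q. \<psi> i (N x) = \<psi> (Suc i) (a x))"
    by (elim exE conjE) (rule that)
  note e = *[rule_format] and NN = **(1)[rule_format]
  have \<psi>q: "\<psi> q (N x) = 0" and \<psi>N: "i < q \<Longrightarrow> \<psi> i (N x) = \<psi> (Suc i) (a x)" if "x \<in> U" for x i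
    using **(2) that by simp_all
  have bN: "b x = \<mu> *s a x + N x" for x by (simp add: N_def)
  let ?p = "Suc q"
  have "has_summand ?p ?p (1\<^sub>m ?p) (jordan_block ?p \<mu>)"
  proof (rule has_summandI[where e = e and \<phi> = "\<lambda>i x. \<psi> i (a x)" and e' = "\<lambda>i. a (e i)" and \<psi> = \<psi>])
    show "e i \<in> U" if "i < ?p" for i using e(1) that by simp
    then show "a (e i) \<in> W" if "i < ?p" for i using aU that by blast
    show "functional (\<lambda>x. \<psi> i (a x))" "functional (\<psi> i)" for i
      using functional_comp[OF a e(2)] e(2) by simp_all
    show "\<psi> i (a (e j)) = (if i = j then 1 else 0)" "\<psi> i (a (e j)) = (if i = j then 1 else 0)"
      if "i < ?p" "j < ?p" for i j using e(3) that by simp_all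
    show "a (e j) = (\<Sum>i<?p. 1\<^sub>m ?p $$ (i, j) *s a (e i))" if "j < ?p" for j
      unfolding one_sum_vec[OF that] ..
    show "b (e j) = (\<Sum>i<?p. jordan_block ?p \<mu> $$ (i, j) *s a (e i))" if "j < ?p" for j
      unfolding jordan_sum_vec[OF that] bN using e0 NN that by (cases j) simp_all
    show "\<psi> i (a x) = (\<Sum>j<?p. 1\<^sub>m ?p $$ (i, j) * \<psi> j (a x))" if "x \<in> U" "i < ?p" for x i
      unfolding one_sum_scalar[OF that(2)] ..
    show "\<psi> i (b x) = (\<Sum>j<?p. jordan_block ?p \<mu> $$ (i, j) * \<psi> j (a x))" if "x \<in> U" "i < ?p" for x i
      unfolding jordan_sum_scalar[OF that(2)] bN F.linear_add[OF e(2)] F.linear_scale[OF e(2)]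
      using \<psi>q \<psi>N that by (cases "i = q") simp_all
  qed
  then show ?thesis by (intro exI[of _ ?p] exI[of _ \<mu>] conjI) simp_all
qed

text \<open>The excluded chains are exactly those that \<open>jordan_chain\<close> has to avoid, so any non-zero vector in
  the kernel of \<open>a\<close> starts a Jordan chain of \<open>a\<close> against \<open>b\<close>.\<close>
lemma noninjective_summand:
  assumes not_inj: "\<not> inj_on a U" and no_chain: "\<And>j. \<not> kernel_chain j"
  shows "\<exists>p\<ge>1. has_summand p p (jordan_block p 0) (1\<^sub>m p)"
proof -
  obtain v where v: "v \<in> U" "v \<noteq> 0" "a v = 0"
    using not_inj unfolding E.linear_inj_on_iff_eq_0[OF a U] by auto
  have "\<exists>q e \<psi>. (\<forall>i\<le>q. e i \<in> U) \<and> (\<forall>i. functional (\<psi> i)) \<and>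
      (\<forall>i\<le>q. \<forall>j\<le>q. \<psi> i (b (e j)) = (if i = j then 1 else 0)) \<and>
      a (e 0) = 0 \<and> (\<forall>j<q. a (e (Suc j)) = b (e j)) \<and>
      (\<forall>x\<in>U. \<psi> q (a x) = 0 \<and> (\<forall>i<q. \<psi> i (a x) = \<psi> (Suc i) (b x)))"
  proof (rule jordan_chain[OF a b U U_fin bU W W_fin v])
    fix x j assume "x \<in> U" "b x = 0" "a x \<in> rel_iter a b U {0} j"
    then show "x = 0" using no_chain[of j] unfolding kernel_chain_def by auto
  qed
  then obtain q e \<psi> where *: "\<forall>i\<le>q. e i \<in> U" "\<forall>i. functional (\<psi> i)"
    "\<forall>i\<le>q. \<forall>j\<le>q. \<psi> i (b (e j)) = (if i = j then 1 else 0)"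
    and e0: "a (e 0) = 0" and **: "\<forall>j<q. a (e (Suc j)) = b (e j)"
    "\<forall>x\<in>U. \<psi> q (a x) = 0 \<and> (\<forall>i<q. \<psi> i (a x) = \<psi> (Suc i) (b x))"
    by (elim exE conjE) (rule that)
  note e = *[rule_format] and NN = **(1)[rule_format]
  have \<psi>q: "\<psi> q (a x) = 0" and \<psi>N: "i < q \<Longrightarrow> \<psi> i (a x) = \<psi> (Suc i) (b x)" if "x \<in> U" for x i
    using **(2) that by simp_all
  let ?p = "Suc q"
  have "has_summand ?p ?p (jordan_block ?p 0) (1\<^sub>m ?p)"
  proof (rule has_summandI[where e = e and \<phi> = "\<lambda>i x. \<psi> i (b x)" and e' = "\<lambda>i. b (e i)" and \<psi> = \<psi>])
    show "e i \<in> U" if "i < ?p" for i using e(1) that by simp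
    then show "b (e i) \<in> W" if "i < ?p" for i using bU that by blast
    show "functional (\<lambda>x. \<psi> i (b x))" "functional (\<psi> i)" for i
      using functional_comp[OF b e(2)] e(2) by simp_all
    show "\<psi> i (b (e j)) = (if i = j then 1 else 0)" "\<psi> i (b (e j)) = (if i = j then 1 else 0)"
      if "i < ?p" "j < ?p" for i j using e(3) that by simp_all
    show "b (e j) = (\<Sum>i<?p. 1\<^sub>m ?p $$ (i, j) *s b (e i))" if "j < ?p" for j
      unfolding one_sum_vec[OF that] ..
    show "a (e j) = (\<Sum>i<?p. jordan_block ?p 0 $$ (i, j) *s b (e i))" if "j < ?p" for j
      unfolding jordan_sum_vec[OF that] using e0 NN that by (cases j) simp_all
    show "\<psi> i (b x) = (\<Sum>j<?p. 1\<^sub>m ?p $$ (i, j) * \<psi> j (b x))" if "x \<in> U" "i < ?p" for x i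
      unfolding one_sum_scalar[OF that(2)] ..
    show "\<psi> i (a x) = (\<Sum>j<?p. jordan_block ?p 0 $$ (i, j) * \<psi> j (b x))" if "x \<in> U" "i < ?p" for x i
      unfolding jordan_sum_scalar[OF that(2)]
      using \<psi>q \<psi>N that by (cases "i = q") simp_all
  qed
  then show ?thesis by (intro exI[of _ ?p] conjI) simp_all
qed

text \<open>The four ways to find a summand exhaust all pencils with \<open>U \<noteq> 0\<close>, and an indecomposable pencil
  equals the summand found.\<close>
theorem kronecker_classification:
  assumes ind: "indecomposable_pencil a b U W" and U0: "U \<noteq> {0}"
  obtains m n A B e \<phi> e' \<psi> where "kronecker_model m n A B"
    "coordinates m U e \<phi>" "coordinates n W e' \<psi>"
    "matrix_of m n a U e \<phi> e' \<psi> A" "matrix_of m n b U e \<phi> e' \<psi> B"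
proof -
  have "\<exists>m n A B. kronecker_model m n A B \<and> has_summand m n A B"
  proof (cases "\<exists>j. kernel_chain j")
    case True
    then obtain r where "kernel_chain r" "\<And>j. j < r \<Longrightarrow> \<not> kernel_chain j"
      using exists_least_iff[of kernel_chain] by auto
    then have "has_summand (r + 1) r (I_mat1 r) (I_mat2 r)" by (rule I_summand)
    moreover have "kronecker_model (r + 1) r (I_mat1 r :: 'k mat) (I_mat2 r)"
      by (simp add: kronecker_model_def)
    ultimately show ?thesis by (intro exI conjI)
  next
    case no_kernel: False
    show ?thesis
    proof (cases "\<exists>j. cokernel_chain j")
      case True
      then obtain r where "cokernel_chain r" "\<And>j. j < r \<Longrightarrow> \<not> cokernel_chain j"
        using exists_least_iff[of cokernel_chain] by auto
      then have "has_summand r (r + 1) (P_mat1 r) (P_mat2 r)" by (rule P_summand)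
      moreover have "kronecker_model r (r + 1) (P_mat1 r :: 'k mat) (P_mat2 r)"
        by (simp add: kronecker_model_def)
      ultimately show ?thesis by (intro exI conjI)
    next
      case False
      show ?thesis
      proof (cases "inj_on a U")
        case True
        then obtain p \<mu> where p: "p \<ge> 1" "has_summand p p (1\<^sub>m p) (jordan_block p \<mu>)"
          using injective_summand[OF True U0] False by auto
        have "kronecker_model p p (1\<^sub>m p) (jordan_block p \<mu>)"
          using p(1) by (auto simp: kronecker_model_def)
        with p(2) show ?thesis by (intro exI conjI)
      next
        case ninj: False
        then obtain p where p: "p \<ge> 1" "has_summand p p (jordan_block p 0) (1\<^sub>m p)"
          using noninjective_summand[OF ninj] no_kernel by auto
        have "kronecker_model p p (jordan_block p 0 :: 'k mat) (1\<^sub>m p)"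
          using p(1) by (auto simp: kronecker_model_def)
        with p(2) show ?thesis by (intro exI conjI)
      qed
    qed
  qed
  then obtain m n A B where model: "kronecker_model m n A B" and summand: "has_summand m n A B"
    by (elim exE conjE)
  obtain e \<phi> e' \<psi> where s: "dual_family m U e \<phi>" "dual_family n W e' \<psi>"
    "matrix_of m n a U e \<phi> e' \<psi> A" "matrix_of m n b U e \<phi> e' \<psi> B"
    using summand unfolding has_summand_def by (elim exE conjE) (rule that)
  have "m > 0 \<or> n > 0" using model by (auto simp: kronecker_model_def)
  from indecomposable_eq_summand[OF ind a b U W aU bU s this] model s(3,4)
  show thesis by (intro that)
qed

end

lemma kronecker_model_carrier:
  assumes "kronecker_model m n A B"
  shows "A \<in> carrier_mat n m" "B \<in> carrier_mat n m"
  using assms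
  by (auto simp: kronecker_model_def P_mat1_def P_mat2_def I_mat1_def I_mat2_def append_rows_def)

section \<open>Two commuting operators of square zero\<close>

text \<open>An indecomposable representation of the Klein four group in characteristic 2, given by
  \<open>a = g\<^sub>1 - 1\<close> and \<open>b = g\<^sub>2 - 1\<close>.\<close>
locale klein_module = lin_space_alg_closed scale
  for scale :: "'k :: alg_closed_field \<Rightarrow> 'b :: ab_group_add \<Rightarrow> 'b" (infixr "*s" 75) +
  fixes a b :: "'b \<Rightarrow> 'b" and X T :: "'b set"
  assumes a: "endo a" and b: "endo b" and X: "V.subspace X"
    and X_fin: "X \<subseteq> V.span T" "finite T"
    and aX: "x \<in> X \<Longrightarrow> a x \<in> X" and bX: "x \<in> X \<Longrightarrow> b x \<in> X"
    and aa: "x \<in> X \<Longrightarrow> a (a x) = 0" and bb: "x \<in> X \<Longrightarrow> b (b x) = 0"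
    and ba: "x \<in> X \<Longrightarrow> b (a x) = a (b x)"
    and X0: "X \<noteq> {0}"
    and indecomposable: "internal_sum X M M' \<Longrightarrow> a ` M \<subseteq> M \<Longrightarrow> b ` M \<subseteq> M \<Longrightarrow>
      a ` M' \<subseteq> M' \<Longrightarrow> b ` M' \<subseteq> M' \<Longrightarrow> M = {0} \<or> M' = {0}"
begin

text \<open>The form \<open>\<phi>\<close> is \<open>1\<close> at \<open>a (b v)\<close> and \<open>0\<close> at \<open>v\<close>, \<open>a v\<close>, \<open>b v\<close>; it exists because \<open>a (b v)\<close> is not a
  combination of the others, as applying \<open>a b\<close>, \<open>a\<close> and \<open>b\<close> to such a combination shows.  The conclusion
  says that \<open>x \<mapsto> (\<phi> x, \<phi> (a x), \<phi> (b x), \<phi> (a (b x)))\<close> is a bijection from \<open>X\<close> to \<open>k\<^sup>4\<close>.\<close>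
lemma free_case:
  assumes v: "v \<in> X" "a (b v) \<noteq> 0"
  obtains \<phi> where "functional \<phi>"
    "\<And>x. x \<in> X \<Longrightarrow> \<phi> x = 0 \<Longrightarrow> \<phi> (a x) = 0 \<Longrightarrow> \<phi> (b x) = 0 \<Longrightarrow> \<phi> (a (b x)) = 0 \<Longrightarrow> x = 0"
    "\<And>\<alpha> \<beta> \<gamma> \<delta>. \<exists>x\<in>X. \<phi> x = \<alpha> \<and> \<phi> (a x) = \<beta> \<and> \<phi> (b x) = \<gamma> \<and> \<phi> (a (b x)) = \<delta>"
proof -
  note lin = E.linear_add[OF a] E.linear_add[OF b] E.linear_scale[OF a] E.linear_scale[OF b]
    E.linear_0[OF a] E.linear_0[OF b]
  have mem: "a v \<in> X" "b v \<in> X" "a (b v) \<in> X" using v aX bX by simp_all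
  have rel: "a (a v) = 0" "b (b v) = 0" "b (a v) = a (b v)" "a (a (b v)) = 0" "b (a (b v)) = 0"
    using aa[of v] bb[of v] ba[of v] aa[of "b v"] ba[of "b v"] bb[of v] mem v by (simp_all add: lin)
  have "a (b v) \<notin> V.span {v, a v, b v}"
  proof
    assume "a (b v) \<in> V.span {v, a v, b v}"
    then obtain c d e where "a (b v) - c *s v - d *s a v = e *s b v"
      unfolding V.span_insert V.span_singleton V.span_empty by auto
    then have eq: "a (b v) = c *s v + d *s a v + e *s b v" by (simp add: algebra_simps)
    have "a (b (a (b v))) = a (b (c *s v + d *s a v + e *s b v))" by (rule arg_cong[OF eq])
    then have c: "c = 0" using v(2) by (simp add: lin rel)
    have "a (a (b v)) = a (c *s v + d *s a v + e *s b v)" by (rule arg_cong[OF eq])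
    then have e: "e = 0" using v(2) by (simp add: lin rel c)
    have "b (a (b v)) = b (c *s v + d *s a v + e *s b v)" by (rule arg_cong[OF eq])
    then have d: "d = 0" using v(2) by (simp add: lin rel c)
    from eq have "a (b v) = 0" unfolding c d e by simp
    with v(2) show False ..
  qed
  then obtain \<phi> where \<phi>: "functional \<phi>" "\<And>z. z \<in> V.span {v, a v, b v} \<Longrightarrow> \<phi> z = 0" "\<phi> (a (b v)) = 1"
    by (rule functional_exists[OF V.subspace_span]) blast
  have \<phi>0: "\<phi> v = 0" "\<phi> (a v) = 0" "\<phi> (b v) = 0" "\<phi> 0 = 0"
    using \<phi>(2) V.span_base[of _ "{v, a v, b v}"] F.linear_0[OF \<phi>(1)] by simp_all
  let ?e = "\<lambda>i. [a (b v), b v, a v, v] ! i"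
  let ?f = "\<lambda>i. [\<phi>, \<lambda>x. \<phi> (a x), \<lambda>x. \<phi> (b x), \<lambda>x. \<phi> (a (b x))] ! i"
  have less4: "i < 4 \<longleftrightarrow> i = 0 \<or> i = 1 \<or> i = 2 \<or> i = 3" for i :: nat by auto
  have dual: "dual_family 4 X ?e ?f"
    unfolding dual_family_def less4
    using v mem rel \<phi>(1,3) \<phi>0 functional_comp[OF a \<phi>(1)] functional_comp[OF b \<phi>(1)]
      functional_comp[OF b functional_comp[OF a \<phi>(1)]]
    by (elim disjE | intro conjI allI impI | simp add: lin)+
  have sum4: "(\<Sum>j<4. c j *s ?e j) = c 0 *s a (b v) + c 1 *s b v + c 2 *s a v + c 3 *s v" for c
    by (simp add: numeral_eq_Suc add.assoc)
  let ?M = "range (\<lambda>c. \<Sum>j<4. c j *s ?e j)" and ?M' = "{x \<in> X. \<forall>i<4. ?f i x = 0}"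
  have split: "internal_sum X ?M ?M'" by (rule dual_family_split[OF X dual])
  have aM: "a ` ?M \<subseteq> ?M"
  proof clarify
    fix c :: "nat \<Rightarrow> 'k"
    show "a (\<Sum>j<4. c j *s ?e j) \<in> ?M"
      by (rule range_eqI[of _ _ "\<lambda>i. [c 1, 0, c 3, 0] ! i"]) (simp only: sum4, simp add: lin rel)
  qed
  have bM: "b ` ?M \<subseteq> ?M"
  proof clarify
    fix c :: "nat \<Rightarrow> 'k"
    show "b (\<Sum>j<4. c j *s ?e j) \<in> ?M"
      by (rule range_eqI[of _ _ "\<lambda>i. [c 2, c 3, 0, 0] ! i"]) (simp only: sum4, simp add: lin rel)
  qed
  have K: "?M' = {x \<in> X. \<phi> x = 0 \<and> \<phi> (a x) = 0 \<and> \<phi> (b x) = 0 \<and> \<phi> (a (b x)) = 0}"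
    unfolding less4 by auto
  have aM': "a ` ?M' \<subseteq> ?M'" and bM': "b ` ?M' \<subseteq> ?M'"
    unfolding K using aX bX aa bb ba \<phi>0(4) by (auto simp: lin)
  have "a (b v) \<in> ?M"
    by (rule range_eqI[of _ _ "\<lambda>i. [1, 0, 0, 0] ! i"]) (simp only: sum4, simp)
  then have "?M \<noteq> {0}" using v(2) by (metis singletonD)
  then have "?M' = {0}" using indecomposable[OF split aM bM aM' bM'] by blast
  then have ker: "x = 0"
    if "x \<in> X" "\<phi> x = 0" "\<phi> (a x) = 0" "\<phi> (b x) = 0" "\<phi> (a (b x)) = 0" for x
    using that unfolding K by blast
  have surj: "\<exists>x\<in>X. \<phi> x = \<alpha> \<and> \<phi> (a x) = \<beta> \<and> \<phi> (b x) = \<gamma> \<and> \<phi> (a (b x)) = \<delta>" for \<alpha> \<beta> \<gamma> \<delta>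
  proof (intro bexI conjI)
    let ?x = "\<alpha> *s a (b v) + \<beta> *s b v + \<gamma> *s a v + \<delta> *s v"
    show "?x \<in> X" using v mem by (intro V.subspace_add[OF X] V.subspace_scale[OF X])
    show "\<phi> ?x = \<alpha>" "\<phi> (a ?x) = \<beta>" "\<phi> (b ?x) = \<gamma>" "\<phi> (a (b ?x)) = \<delta>"
      by (simp_all add: lin rel F.linear_add[OF \<phi>(1)] F.linear_scale[OF \<phi>(1)] \<phi>0 \<phi>(3))
  qed
  show thesis by (rule that[OF \<phi>(1) ker surj])
qed

text \<open>Here \<open>a\<close> and \<open>b\<close> vanish on \<open>W = a X + b X\<close>.  With \<open>p\<close> a projection onto \<open>W\<close>, the kernel \<open>U\<close> of \<open>p\<close> in \<open>X\<close>
  is a complement, and summands \<open>(U\<^sub>1, W\<^sub>1)\<close> of the pencil \<open>a, b : U \<rightarrow> W\<close> give stable summands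
  \<open>U\<^sub>1 + W\<^sub>1\<close> of \<open>X\<close>, so the pencil is indecomposable.  The coordinates on \<open>U\<close> and \<open>W\<close> that
  \<open>kronecker_classification\<close> provides combine to the isomorphism \<open>F\<close>.\<close>
lemma square_zero_case:
  assumes ab: "\<And>x. x \<in> X \<Longrightarrow> a (b x) = 0"
  obtains m n A B F where "kronecker_model m n A B" "m \<ge> 1"
    "bij_betw F X (carrier_vec m \<times> carrier_vec n)"
    "\<And>x y. F (x + y) = (fst (F x) + fst (F y), snd (F x) + snd (F y))"
    "\<And>c x. F (c *s x) = (c \<cdot>\<^sub>v fst (F x), c \<cdot>\<^sub>v snd (F x))"
    "\<And>x. x \<in> X \<Longrightarrow> F (a x) = (0\<^sub>v m, A *\<^sub>v fst (F x))"
    "\<And>x. x \<in> X \<Longrightarrow> F (b x) = (0\<^sub>v m, B *\<^sub>v fst (F x))"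
proof -
  note lin = E.linear_add[OF a] E.linear_add[OF b] E.linear_scale[OF a] E.linear_scale[OF b]
    E.linear_0[OF a] E.linear_0[OF b] E.linear_diff[OF a] E.linear_diff[OF b]
  define W where "W = {x + y | x y. x \<in> a ` X \<and> y \<in> b ` X}"
  have W: "V.subspace W"
    unfolding W_def by (rule V.subspace_sums[OF E.linear_subspace_image[OF a X] E.linear_subspace_image[OF b X]])
  have WX: "W \<subseteq> X"
    unfolding W_def
  proof clarify
    fix x y assume "x \<in> X" "y \<in> X"
    then show "a x + b y \<in> X" by (intro V.subspace_add[OF X] aX bX)
  qed
  have WE: "\<exists>x\<in>X. \<exists>y\<in>X. w = a x + b y" if "w \<in> W" for w
    using that unfolding W_def by blast
  have aXW: "a x \<in> W" if "x \<in> X" for x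
    unfolding W_def using that V.subspace_0[OF X] lin(6)
    by (intro CollectI exI[of _ "a x"] exI[of _ "b 0"]) simp
  have bXW: "b x \<in> W" if "x \<in> X" for x
    unfolding W_def using that V.subspace_0[OF X] lin(5)
    by (intro CollectI exI[of _ "a 0"] exI[of _ "b x"]) simp
  have aW: "a w = 0" and bW: "b w = 0" if w: "w \<in> W" for w
  proof -
    obtain x y where xy: "w = a x + b y" "x \<in> X" "y \<in> X" using WE[OF w] by auto
    show "a w = 0" "b w = 0" unfolding xy(1) lin using aa bb ba ab xy(2,3) by simp_all
  qed
  obtain p where p: "endo p" "range p \<subseteq> W" "\<And>z. z \<in> W \<Longrightarrow> p z = z"
    by (rule projection_exists[OF W]) blast
  have pW: "p x \<in> W" for x using p(2) by blast
  define U where "U = {x \<in> X. p x \<in> {0}}"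
  have U: "V.subspace U" unfolding U_def by (rule subspace_preimage[OF p(1) X V.subspace_single_0])
  have UX: "U \<subseteq> X" by (auto simp: U_def)
  have UW: "x = 0" if "x \<in> U" "x \<in> W" for x using that p(3)[of x] by (simp add: U_def)
  have xU: "x - p x \<in> U" if "x \<in> X" for x
  proof -
    have "x - p x \<in> X" using that pW WX by (intro V.subspace_diff[OF X]) auto
    moreover have "p (x - p x) = 0" unfolding E.linear_diff[OF p(1)] p(3)[OF pW] by simp
    ultimately show ?thesis by (simp add: U_def)
  qed
  have aU: "a ` U \<subseteq> W" and bU: "b ` U \<subseteq> W" using UX by (auto intro: aXW bXW)
  interpret pencil: alg_closed_pencil scale a b U W T T
    by (intro alg_closed_pencil.intro pencil.intro pencil_axioms.intro alg_closed_pencil_axioms.intro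
        lin_space_axioms lin_space_alg_closed_axioms a b U W aU bU X_fin(2)
        subset_trans[OF UX X_fin(1)] subset_trans[OF WX X_fin(1)])
  have U0: "U \<noteq> {0}"
  proof
    assume "U = {0}"
    then have XW: "x \<in> W" if "x \<in> X" for x using xU[OF that] pW[of x] by simp
    have ab0: "a x = 0" "b x = 0" if "x \<in> X" for x using aW bW XW[OF that] by simp_all
    have "x = 0" if x: "x \<in> X" for x
    proof -
      obtain y z where "x = a y + b z" "y \<in> X" "z \<in> X" using WE[OF XW[OF x]] by auto
      then show ?thesis using ab0 by simp
    qed
    then show False using X0 V.subspace_0[OF X] by auto
  qed
  have ind: "indecomposable_pencil a b U W"
    unfolding indecomposable_pencil_def
  proof (intro allI impI)
    fix U1 U2 W1 W2
    assume sU: "internal_sum U U1 U2" and sW: "internal_sum W W1 W2"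
      and inv: "a ` U1 \<subseteq> W1" "b ` U1 \<subseteq> W1" "a ` U2 \<subseteq> W2" "b ` U2 \<subseteq> W2"
    let ?M1 = "{x + y | x y. x \<in> U1 \<and> y \<in> W1}" and ?M2 = "{x + y | x y. x \<in> U2 \<and> y \<in> W2}"
    have sub: "V.subspace U1" "V.subspace U2" "V.subspace W1" "V.subspace W2"
      "U1 \<subseteq> U" "U2 \<subseteq> U" "W1 \<subseteq> W" "W2 \<subseteq> W"
      and zero: "U1 \<inter> U2 = {0}" "W1 \<inter> W2 = {0}"
      using sU sW by (simp_all add: internal_sum_def)
    have subM: "V.subspace ?M1" "V.subspace ?M2"
      by (intro V.subspace_sums sub)+
    have inX: "{x + y | x y. x \<in> U' \<and> y \<in> W'} \<subseteq> X" if "U' \<subseteq> U" "W' \<subseteq> W" for U' W'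
    proof clarify
      fix x y assume "x \<in> U'" "y \<in> W'"
      then have "x \<in> X" "y \<in> X" using that UX WX by auto
      then show "x + y \<in> X" by (rule V.subspace_add[OF X])
    qed
    have "internal_sum X ?M1 ?M2"
      unfolding internal_sum_def
    proof (intro conjI subM)
      show "?M1 \<subseteq> X" "?M2 \<subseteq> X" by (rule inX, fact, fact)+
      show "?M1 \<inter> ?M2 = {0}"
      proof (intro equalityI subsetI)
        fix x assume "x \<in> ?M1 \<inter> ?M2"
        then have "x \<in> ?M1" "x \<in> ?M2" by (rule IntD1, rule IntD2)
        then obtain u1 w1 u2 w2 where x: "x = u1 + w1" "x = u2 + w2"
          and m: "u1 \<in> U1" "w1 \<in> W1" "u2 \<in> U2" "w2 \<in> W2" by blast
        have eq: "u1 - u2 = w2 - w1" using x by (simp add: algebra_simps)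
        have "u1 - u2 \<in> U" using m sub by (intro V.subspace_diff[OF U]) auto
        moreover have "u1 - u2 \<in> W" unfolding eq using m sub by (intro V.subspace_diff[OF W]) auto
        ultimately have "u1 - u2 = 0" by (rule UW)
        then have "u1 = u2" "w1 = w2" using eq by simp_all
        then have "u1 \<in> U1 \<inter> U2" "w1 \<in> W1 \<inter> W2" using m by simp_all
        then show "x \<in> {0}" using x(1) unfolding zero by simp
      next
        fix x assume "x \<in> {0 :: 'b}"
        then show "x \<in> ?M1 \<inter> ?M2" using V.subspace_0[OF subM(1)] V.subspace_0[OF subM(2)] by simp
      qed
      show "\<forall>x\<in>X. \<exists>y\<in>?M1. \<exists>z\<in>?M2. x = y + z"
      proof
        fix x assume "x \<in> X"
        then obtain u1 u2 where u: "u1 \<in> U1" "u2 \<in> U2" "x - p x = u1 + u2"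
          by (rule internal_sumE[OF sU xU])
        obtain w1 w2 where w: "w1 \<in> W1" "w2 \<in> W2" "p x = w1 + w2"
          by (rule internal_sumE[OF sW pW])
        have "x = (u1 + w1) + (u2 + w2)" using u(3) w(3) by (simp add: algebra_simps)
        then show "\<exists>y\<in>?M1. \<exists>z\<in>?M2. x = y + z"
          by (intro bexI[of _ "u1 + w1"] bexI[of _ "u2 + w2"]) (use u w in auto)
      qed
    qed
    moreover have inM: "f ` {x + y | x y. x \<in> U' \<and> y \<in> W'} \<subseteq> {x + y | x y. x \<in> U' \<and> y \<in> W'}"
      if f: "endo f" "\<And>w. w \<in> W \<Longrightarrow> f w = 0" and "f ` U' \<subseteq> W'" "V.subspace U'" "W' \<subseteq> W" for f U' W'
    proof clarify
      fix x y assume "x \<in> U'" "y \<in> W'"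
      then have "y \<in> W" "f x \<in> W'" using that(3,5) by auto
      moreover have "f (x + y) = 0 + f x" using f(2)[OF \<open>y \<in> W\<close>] by (simp add: E.linear_add[OF f(1)])
      ultimately show "\<exists>x' y'. f (x + y) = x' + y' \<and> x' \<in> U' \<and> y' \<in> W'"
        using V.subspace_0[OF that(4)] by (intro exI conjI)
    qed
    ultimately have "?M1 = {0} \<or> ?M2 = {0}"
      using indecomposable inM[OF a aW inv(1) sub(1,7)] inM[OF b bW inv(2) sub(1,7)]
        inM[OF a aW inv(3) sub(2,8)] inM[OF b bW inv(4) sub(2,8)] by simp
    moreover have zero_sum: "U' = {0} \<and> W' = {0}"
      if M: "{x + y | x y. x \<in> U' \<and> y \<in> W'} = {0}" and s: "V.subspace U'" "V.subspace W'" for U' W'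
    proof -
      have "x = 0" if "x \<in> U'" for x
      proof -
        have "x + 0 \<in> {x + y | x y. x \<in> U' \<and> y \<in> W'}" using that V.subspace_0[OF s(2)] by blast
        then show ?thesis unfolding M by simp
      qed
      moreover have "y = 0" if "y \<in> W'" for y
      proof -
        have "0 + y \<in> {x + y | x y. x \<in> U' \<and> y \<in> W'}" using that V.subspace_0[OF s(1)] by blast
        then show ?thesis unfolding M by simp
      qed
      ultimately show ?thesis using V.subspace_0[OF s(1)] V.subspace_0[OF s(2)] by blast
    qed
    ultimately show "U1 = {0} \<and> W1 = {0} \<or> U2 = {0} \<and> W2 = {0}"
    proof (elim disjE)
      assume "?M1 = {0}"
      then have "U1 = {0} \<and> W1 = {0}" by (rule zero_sum[OF _ sub(1,3)])
      then show ?thesis ..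
    next
      assume "?M2 = {0}"
      then have "U2 = {0} \<and> W2 = {0}" by (rule zero_sum[OF _ sub(2,4)])
      then show ?thesis ..
    qed
  qed
  obtain m n A B e \<phi> e' \<psi> where model: "kronecker_model m n A B"
    and c: "coordinates m U e \<phi>" and c': "coordinates n W e' \<psi>"
    and A: "matrix_of m n a U e \<phi> e' \<psi> A" and B: "matrix_of m n b U e \<phi> e' \<psi> B"
    by (rule pencil.kronecker_classification[OF ind U0])
  have d: "dual_family m U e \<phi>" and d': "dual_family n W e' \<psi>"
    using c c' by (simp_all add: coordinates_def)
  have \<phi>: "functional (\<phi> i)" "e i \<in> U" if "i < m" for i using d that by (simp_all add: dual_family_def)
  have \<psi>: "functional (\<psi> i)" "e' i \<in> W" if "i < n" for i using d' that by (simp_all add: dual_family_def)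
  have "m \<noteq> 0"
  proof
    assume "m = 0"
    then have "x = 0" if "x \<in> U" for x using c that by (simp add: coordinates_def)
    then show False using U0 V.subspace_0[OF U] by blast
  qed
  define q where "q x = x - p x" for x
  have q: "endo q" unfolding q_def[abs_def] by (rule E.linear_compose_sub[OF V.linear_ident p(1)])
  note qU = xU[folded q_def]
  define F where "F x = (vec m (\<lambda>i. \<phi> i (q x)), vec n (\<lambda>i. \<psi> i (p x)))" for x
  have mult: "F (f x) = (0\<^sub>v m, M *\<^sub>v fst (F x))"
    if x: "x \<in> X" and f: "endo f" "\<And>x. x \<in> X \<Longrightarrow> f x \<in> W" "\<And>w. w \<in> W \<Longrightarrow> f w = 0"
      and M: "matrix_of m n f U e \<phi> e' \<psi> M" "M \<in> carrier_mat n m" for x f M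
  proof -
    have "p (f x) = f x" by (rule p(3)[OF f(2)[OF x]])
    moreover from this have "q (f x) = 0" by (simp add: q_def)
    ultimately have 1: "fst (F (f x)) = 0\<^sub>v m" and 2: "snd (F (f x)) = vec n (\<lambda>i. \<psi> i (f x))"
      using F.linear_0[OF \<phi>(1)] by (auto simp: F_def intro!: eq_vecI)
    have "f (q x) = f x" using f(3)[OF pW] by (simp add: q_def E.linear_diff[OF f(1)])
    then have eq: "\<psi> i (f x) = \<psi> i (f (q x))" for i by simp
    have "\<psi> i (f x) = (\<Sum>j<m. M $$ (i, j) * \<phi> j (q x))" if "i < n" for i
      unfolding eq using M(1) qU[OF x] that by (simp add: matrix_of_def)
    then have "snd (F (f x)) = M *\<^sub>v fst (F x)"
      unfolding 2 using M(2)
      by (intro eq_vecI) (auto simp: F_def scalar_prod_def lessThan_atLeast0)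
    with 1 show ?thesis by (simp add: prod_eq_iff)
  qed
  have Fadd: "F (x + y) = (fst (F x) + fst (F y), snd (F x) + snd (F y))" for x y
    using F.linear_add[OF \<phi>(1)] F.linear_add[OF \<psi>(1)]
    by (auto simp: F_def E.linear_add[OF p(1)] E.linear_add[OF q] intro!: eq_vecI)
  have Fscale: "F (r *s x) = (r \<cdot>\<^sub>v fst (F x), r \<cdot>\<^sub>v snd (F x))" for r x
    using F.linear_scale[OF \<phi>(1)] F.linear_scale[OF \<psi>(1)]
    by (auto simp: F_def E.linear_scale[OF p(1)] E.linear_scale[OF q] intro!: eq_vecI)
  have Fker: "x = 0" if x: "x \<in> X" and F0: "F x = (0\<^sub>v m, 0\<^sub>v n)" for x
  proof -
    have "vec m (\<lambda>i. \<phi> i (q x)) = 0\<^sub>v m" "vec n (\<lambda>i. \<psi> i (p x)) = 0\<^sub>v n"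
      using F0 by (simp_all add: F_def)
    then have "vec m (\<lambda>i. \<phi> i (q x)) $ i = 0" if "i < m" for i using that by simp
    then have "\<phi> i (q x) = 0" if "i < m" for i using that by simp
    then have 1: "q x = 0" by (rule coordinates_zero[OF c qU[OF x]])
    have "vec n (\<lambda>i. \<psi> i (p x)) $ i = 0" if "i < n" for i
      using \<open>vec n (\<lambda>i. \<psi> i (p x)) = 0\<^sub>v n\<close> that by simp
    then have "\<psi> i (p x) = 0" if "i < n" for i using that by simp
    then have "p x = 0" by (rule coordinates_zero[OF c' pW])
    with 1 show ?thesis by (simp add: q_def)
  qed
  have "bij_betw F X (carrier_vec m \<times> carrier_vec n)"
  proof (rule bij_betw_imageI)
    show "inj_on F X"
    proof (rule inj_onI)
      fix x y assume xy: "x \<in> X" "y \<in> X" "F x = F y"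
      have "F (x + (-1) *s y) = (0\<^sub>v m, 0\<^sub>v n)"
        unfolding Fadd Fscale xy(3) by (auto simp: F_def intro!: eq_vecI)
      moreover have "x + (-1) *s y \<in> X"
        using xy by (intro V.subspace_add[OF X] V.subspace_scale[OF X])
      ultimately have "x + (-1) *s y = 0" by (rule Fker[rotated])
      then show "x = y" by simp
    qed
    show "F ` X = carrier_vec m \<times> carrier_vec n"
    proof (intro equalityI subsetI)
      fix z assume "z \<in> F ` X"
      then show "z \<in> carrier_vec m \<times> carrier_vec n" by (auto simp: F_def)
    next
      fix z assume z: "z \<in> (carrier_vec m :: 'k vec set) \<times> (carrier_vec n :: 'k vec set)"
      obtain v w where vw: "z = (v, w)" "v \<in> carrier_vec m" "w \<in> carrier_vec n" using z by auto
      let ?u = "\<Sum>j<m. v $ j *s e j" and ?w = "\<Sum>j<n. w $ j *s e' j"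
      have u: "?u \<in> U" using \<phi>(2) by (intro V.subspace_sum[OF U] V.subspace_scale[OF U]) simp
      have w: "?w \<in> W" using \<psi>(2) by (intro V.subspace_sum[OF W] V.subspace_scale[OF W]) simp
      have "p (?u + ?w) = ?w" using u p(3)[OF w] by (simp add: E.linear_add[OF p(1)] U_def)
      then have "q (?u + ?w) = ?u" by (simp add: q_def)
      note pq = this \<open>p (?u + ?w) = ?w\<close>
      have "F (?u + ?w) = z"
        unfolding vw(1) F_def pq using vw(2,3) dual_family_sum[OF d] dual_family_sum[OF d']
        by (auto intro!: eq_vecI)
      moreover have "?u + ?w \<in> X" using u w UX WX by (intro V.subspace_add[OF X]) auto
      ultimately show "z \<in> F ` X" by blast
    qed
  qed
  moreover have "1 \<le> m" using \<open>m \<noteq> 0\<close> by (cases m) simp_all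
  ultimately show thesis
    by (intro that[OF model _ _ Fadd Fscale mult[OF _ a aXW aW A kronecker_model_carrier(1)[OF model]]
        mult[OF _ b bXW bW B kronecker_model_carrier(2)[OF model]]])
qed

end

section \<open>Indecomposability of the Kronecker models\<close>

definition fscale :: "'k :: field \<Rightarrow> ('i \<Rightarrow> 'k) \<Rightarrow> 'i \<Rightarrow> 'k" where
  "fscale c f = (\<lambda>i. c * f i)"

lemma fscale_apply [simp]: "fscale c f i = c * f i" by (simp add: fscale_def)

lemma lin_space_fscale: "lin_space (fscale :: 'k :: field \<Rightarrow> ('i \<Rightarrow> 'k) \<Rightarrow> 'i \<Rightarrow> 'k)"
  by unfold_locales (simp_all add: fun_eq_iff algebra_simps)

interpretation fn: lin_space fscale by (rule lin_space_fscale)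

text \<open>The space \<open>k\<^sup>m\<close>, inside a type that does not depend on \<open>m\<close>.\<close>
definition first_funs :: "nat \<Rightarrow> (nat \<Rightarrow> 'k :: field) set" where
  "first_funs m = {f. \<forall>i\<ge>m. f i = 0}"

text \<open>Multiplication by a matrix, truncated so as to be linear on all sequences and to end in \<open>k\<^sup>n\<close>.\<close>
definition mat_op :: "'k :: field mat \<Rightarrow> (nat \<Rightarrow> 'k) \<Rightarrow> nat \<Rightarrow> 'k" where
  "mat_op A f = (\<lambda>i. if i < dim_row A then \<Sum>j<dim_col A. A $$ (i, j) * f j else 0)"

lemma mat_op_P:
  assumes "f \<in> first_funs r"
  shows "mat_op (P_mat1 r) f = f" "mat_op (P_mat2 r) f = (\<lambda>i. case i of 0 \<Rightarrow> 0 | Suc k \<Rightarrow> f k)"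
proof -
  have dim: "dim_row (P_mat1 r :: 'a mat) = Suc r" "dim_col (P_mat1 r :: 'a mat) = r"
    "dim_row (P_mat2 r :: 'a mat) = Suc r" "dim_col (P_mat2 r :: 'a mat) = r"
    by (simp_all add: P_mat1_def P_mat2_def append_rows_def)
  show "mat_op (P_mat1 r) f = f"
  proof
    fix i
    have "(\<Sum>j<r. P_mat1 r $$ (i, j) * f j) = (\<Sum>j<r. if i = j then f j else 0)" if "i < Suc r"
      by (rule sum.cong) (use that in \<open>simp_all add: P_mat_index\<close>)
    then show "mat_op (P_mat1 r) f i = f i"
      using assms unfolding mat_op_def dim sum_delta_less by (auto simp: first_funs_def)
  qed
  show "mat_op (P_mat2 r) f = (\<lambda>i. case i of 0 \<Rightarrow> 0 | Suc k \<Rightarrow> f k)"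
  proof
    fix i
    have "(\<Sum>j<r. P_mat2 r $$ (i, j) * f j) = (\<Sum>j<r. if i = Suc j then f j else 0)" if "i < Suc r"
      by (rule sum.cong) (use that in \<open>simp_all add: P_mat_index\<close>)
    then show "mat_op (P_mat2 r) f i = (case i of 0 \<Rightarrow> 0 | Suc k \<Rightarrow> f k)"
      using assms unfolding mat_op_def dim sum_delta_Suc by (auto simp: first_funs_def split: nat.split)
  qed
qed

lemma mat_op_I:
  assumes "f \<in> first_funs (Suc r)"
  shows "mat_op (I_mat1 r) f = (\<lambda>i. if i < r then f i else 0)" "mat_op (I_mat2 r) f = (\<lambda>i. f (Suc i))"
proof -
  have dim: "dim_row (I_mat1 r :: 'a mat) = r" "dim_col (I_mat1 r :: 'a mat) = Suc r"
    "dim_row (I_mat2 r :: 'a mat) = r" "dim_col (I_mat2 r :: 'a mat) = Suc r"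
    by (simp_all add: I_mat1_def I_mat2_def)
  show "mat_op (I_mat1 r) f = (\<lambda>i. if i < r then f i else 0)"
  proof
    fix i
    have "(\<Sum>j<Suc r. I_mat1 r $$ (i, j) * f j) = (\<Sum>j<Suc r. if i = j then f j else 0)" if "i < r"
      by (rule sum.cong) (use that in \<open>simp_all add: I_mat_index\<close>)
    then show "mat_op (I_mat1 r) f i = (if i < r then f i else 0)"
      unfolding mat_op_def dim sum_delta_less by simp
  qed
  show "mat_op (I_mat2 r) f = (\<lambda>i. f (Suc i))"
  proof
    fix i
    have "(\<Sum>j<Suc r. I_mat2 r $$ (i, j) * f j) = (\<Sum>j<Suc r. if Suc i = j then f j else 0)" if "i < r"
      by (rule sum.cong) (use that in \<open>auto simp: I_mat_index\<close>)
    then show "mat_op (I_mat2 r) f i = f (Suc i)"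
      using assms unfolding mat_op_def dim sum_delta_less by (simp add: first_funs_def)
  qed
qed

lemma mat_op_one:
  assumes "f \<in> first_funs p"
  shows "mat_op (1\<^sub>m p) f = f"
proof
  fix i
  have "(\<Sum>j<p. 1\<^sub>m p $$ (i, j) * f j) = (\<Sum>j<p. if i = j then f j else 0)" if "i < p"
    by (rule sum.cong) (use that in simp_all)
  then show "mat_op (1\<^sub>m p) f i = f i"
    using assms unfolding mat_op_def index_one_mat sum_delta_less by (auto simp: first_funs_def)
qed

lemma mat_op_jordan:
  assumes "f \<in> first_funs p"
  shows "mat_op (jordan_block p \<mu>) f = (\<lambda>i. \<mu> * f i + f (Suc i))"
proof
  fix i
  have "(\<Sum>j<p. jordan_block p \<mu> $$ (i, j) * f j) =
      (\<Sum>j<p. (if i = j then \<mu> * f j else 0) + (if Suc i = j then f j else 0))" if "i < p"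
    by (rule sum.cong) (use that in auto)
  then show "mat_op (jordan_block p \<mu>) f i = \<mu> * f i + f (Suc i)"
    using assms unfolding mat_op_def jordan_block_carrier sum.distrib sum_delta_less
    by (auto simp: first_funs_def)
qed

lemma (in lin_space) internal_sum_commute: "internal_sum S S1 S2 \<Longrightarrow> internal_sum S S2 S1"
  unfolding internal_sum_def
proof (elim conjE, intro conjI ballI)
  assume *: "\<forall>x\<in>S. \<exists>y\<in>S1. \<exists>z\<in>S2. x = y + z"
  fix x assume "x \<in> S"
  then obtain y z where "y \<in> S1" "z \<in> S2" "x = y + z" using * by auto
  then show "\<exists>y\<in>S2. \<exists>z\<in>S1. x = y + z"
    by (intro bexI[of _ z] bexI[of _ y]) (simp_all add: add.commute)
qed (simp_all add: Int_commute)

lemma (in lin_space) indecomposable_pencil_swap: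
  assumes "indecomposable_pencil a b U W"
  shows "indecomposable_pencil b a U W"
  unfolding indecomposable_pencil_def
proof (intro allI impI)
  fix U1 U2 W1 W2
  assume "internal_sum U U1 U2" "internal_sum W W1 W2" "b ` U1 \<subseteq> W1" "a ` U1 \<subseteq> W1"
    "b ` U2 \<subseteq> W2" "a ` U2 \<subseteq> W2"
  then show "U1 = {0} \<and> W1 = {0} \<or> U2 = {0} \<and> W2 = {0}"
    by (intro assms[unfolded indecomposable_pencil_def, rule_format])
qed

lemma (in lin_space) internal_sum_disjoint:
  assumes "internal_sum S S1 S2" "x \<in> S1" "x \<in> S2"
  shows "x = 0"
  using assms by (auto simp: internal_sum_def)

lemma (in lin_space) internal_sum_subspaces:
  assumes "internal_sum S S1 S2"
  shows "V.subspace S1" "V.subspace S2" "S1 \<subseteq> S" "S2 \<subseteq> S"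
  using assms by (simp_all add: internal_sum_def)

definition ind_fun :: "nat \<Rightarrow> nat \<Rightarrow> 'k :: field" where
  "ind_fun i = (\<lambda>j. if j = i then 1 else 0)"

text \<open>The two maps are the inclusion and the shift \<open>k\<^sup>r \<rightarrow> k\<^sup>r\<^sup>+\<^sup>1\<close>.  In one of \<open>W1\<close>, \<open>W2\<close> all vectors have
  last coordinate \<open>0\<close>: otherwise a combination of a vector of each lies in \<open>U1 + U2\<close>, which makes
  a vector with non-zero last coordinate equal to one from \<open>U1\<close> or \<open>U2\<close>.  If this holds for \<open>W2\<close>, then
  \<open>W2 = U2\<close> is stable under the shift, which moves any non-zero entry to the last coordinate; so
  it is zero.\<close>
lemma P_indecomposable:
  "fn.indecomposable_pencil (mat_op (P_mat1 r)) (mat_op (P_mat2 r))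
     (first_funs r) (first_funs (Suc r) :: (nat \<Rightarrow> 'k :: field) set)"
proof -
  let ?U = "first_funs r :: (nat \<Rightarrow> 'k) set" and ?W = "first_funs (Suc r) :: (nat \<Rightarrow> 'k) set"
  let ?sh = "\<lambda>f :: nat \<Rightarrow> 'k. \<lambda>i. case i of 0 \<Rightarrow> 0 | Suc k \<Rightarrow> f k"
  have UW: "f \<in> ?U" if "f \<in> ?W" "f r = 0" for f
    using that by (auto simp: first_funs_def le_Suc_eq dest: le_neq_implies_less)
  have half: "U2 = {0} \<and> W2 = {0}"
    if sU: "fn.internal_sum ?U U1 U2" and sW: "fn.internal_sum ?W W1 W2"
      and aU: "\<And>f. f \<in> U1 \<Longrightarrow> f \<in> W1" "\<And>f. f \<in> U2 \<Longrightarrow> f \<in> W2"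
      and bU: "\<And>f. f \<in> U2 \<Longrightarrow> ?sh f \<in> W2"
      and z: "\<And>y. y \<in> W2 \<Longrightarrow> y r = 0" for U1 U2 W1 W2
  proof -
    note U12 = fn.internal_sum_subspaces[OF sU] and W12 = fn.internal_sum_subspaces[OF sW]
    have W2U2: "y \<in> U2" if y: "y \<in> W2" for y
    proof -
      have "y \<in> ?U" using UW[of y] z[OF y] y W12(4) by auto
      then obtain p p' where p: "p \<in> U1" "p' \<in> U2" "y = p + p'" by (rule fn.internal_sumE[OF sU])
      have "p = y - p'" using p(3) by simp
      also have "\<dots> \<in> W2" by (rule fn.V.subspace_diff[OF W12(2) y aU(2)[OF p(2)]])
      finally have "p = 0" using fn.internal_sum_disjoint[OF sW aU(1)[OF p(1)]] by simp
      then show ?thesis using p by simp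
    qed
    have pow: "(?sh ^^ k) f \<in> U2" if "f \<in> U2" for k f
      by (induction k) (use that bU W2U2 in auto)
    have powi: "(?sh ^^ k) f (k + i) = f i" for k i f
      by (induction k) simp_all
    have U2: "f = 0" if f: "f \<in> U2" for f
    proof
      fix j
      show "f j = 0 j"
      proof (cases "j < r")
        case True
        have "(?sh ^^ (r - j)) f \<in> ?U" using pow[OF f] U12(4) by blast
        then have "(?sh ^^ (r - j)) f (r - j + j) = 0" using True by (simp add: first_funs_def)
        then show ?thesis unfolding powi by simp
      next
        case False
        then show ?thesis using f U12(4) by (auto simp: first_funs_def)
      qed
    qed
    moreover have "y = 0" if "y \<in> W2" for y by (rule U2[OF W2U2[OF that]])
    ultimately show ?thesis
      using fn.V.subspace_0[OF U12(2)] fn.V.subspace_0[OF W12(2)] by auto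
  qed
  show ?thesis
    unfolding fn.indecomposable_pencil_def
  proof (intro allI impI)
    fix U1 U2 W1 W2
    assume sU: "fn.internal_sum ?U U1 U2" and sW: "fn.internal_sum ?W W1 W2"
      and "mat_op (P_mat1 r) ` U1 \<subseteq> W1" "mat_op (P_mat2 r) ` U1 \<subseteq> W1"
      and "mat_op (P_mat1 r) ` U2 \<subseteq> W2" "mat_op (P_mat2 r) ` U2 \<subseteq> W2"
    note U12 = fn.internal_sum_subspaces[OF sU] and W12 = fn.internal_sum_subspaces[OF sW]
    have inv1: "f \<in> W1" "?sh f \<in> W1" if "f \<in> U1" for f
    proof -
      have "f \<in> ?U" using that U12(3) by blast
      moreover have "mat_op (P_mat1 r) f \<in> W1" "mat_op (P_mat2 r) f \<in> W1"
        using \<open>mat_op (P_mat1 r) ` U1 \<subseteq> W1\<close> \<open>mat_op (P_mat2 r) ` U1 \<subseteq> W1\<close> that by auto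
      ultimately show "f \<in> W1" "?sh f \<in> W1" by (simp_all add: mat_op_P)
    qed
    have inv2: "f \<in> W2" "?sh f \<in> W2" if "f \<in> U2" for f
    proof -
      have "f \<in> ?U" using that U12(4) by blast
      moreover have "mat_op (P_mat1 r) f \<in> W2" "mat_op (P_mat2 r) f \<in> W2"
        using \<open>mat_op (P_mat1 r) ` U2 \<subseteq> W2\<close> \<open>mat_op (P_mat2 r) ` U2 \<subseteq> W2\<close> that by auto
      ultimately show "f \<in> W2" "?sh f \<in> W2" by (simp_all add: mat_op_P)
    qed
    show "U1 = {0} \<and> W1 = {0} \<or> U2 = {0} \<and> W2 = {0}"
    proof (cases "\<forall>y\<in>W2. y r = 0")
      case True
      then show ?thesis using half[OF sU sW inv1(1) inv2] by simp
    next
      case False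
      then obtain y2 where y2: "y2 \<in> W2" "y2 r \<noteq> 0" by blast
      have "y1 r = 0" if y1: "y1 \<in> W1" for y1
      proof (rule ccontr)
        assume y1r: "y1 r \<noteq> 0"
        let ?z = "fscale (y2 r) y1 - fscale (y1 r) y2"
        have m1: "fscale (y2 r) y1 \<in> W1" and m2: "fscale (y1 r) y2 \<in> W2"
          by (rule fn.V.subspace_scale[OF W12(1) y1], rule fn.V.subspace_scale[OF W12(2) y2(1)])
        have "fscale (y2 r) y1 \<in> ?W" "fscale (y1 r) y2 \<in> ?W" using m1 m2 W12(3,4) by auto
        then have "?z \<in> ?W" by (auto simp: first_funs_def)
        then have "?z \<in> ?U" by (rule UW) simp
        then obtain p p' where p: "p \<in> U1" "p' \<in> U2" "?z = p + p'" by (rule fn.internal_sumE[OF sU])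
        have "fscale (y2 r) y1 - p = fscale (y1 r) y2 + p'" using p(3) by (simp add: algebra_simps)
        also have "\<dots> \<in> W2" by (rule fn.V.subspace_add[OF W12(2) m2 inv2(1)[OF p(2)]])
        finally have "fscale (y2 r) y1 - p = 0"
          by (rule fn.internal_sum_disjoint[OF sW fn.V.subspace_diff[OF W12(1) m1 inv1(1)[OF p(1)]]])
        then have "fscale (y2 r) y1 r = p r" by simp
        moreover have "p r = 0" using p(1) U12(3) by (auto simp: first_funs_def)
        ultimately show False using y1r y2(2) by simp
      qed
      then show ?thesis
        using half[OF fn.internal_sum_commute[OF sU] fn.internal_sum_commute[OF sW] inv2(1) inv1] by simp
    qed
  qed
qed

text \<open>The two maps forget the last and the first coordinate.  The last unit vector \<open>\<delta>\<close> spans the kernel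
  of the first map, so it lies in one of the summands, say \<open>U1\<close>.  Then all unit vectors do, by
  descending induction: the first map sends a unit vector to the image of the next one under the
  second map, so its component in \<open>U2\<close> is in the kernel of the first map.\<close>
lemma I_indecomposable:
  "fn.indecomposable_pencil (mat_op (I_mat1 r)) (mat_op (I_mat2 r))
     (first_funs (Suc r)) (first_funs r :: (nat \<Rightarrow> 'k :: field) set)"
proof -
  let ?U = "first_funs (Suc r) :: (nat \<Rightarrow> 'k) set" and ?W = "first_funs r :: (nat \<Rightarrow> 'k) set"
  let ?cut = "\<lambda>f :: nat \<Rightarrow> 'k. \<lambda>i. if i < r then f i else 0"
  let ?sh = "\<lambda>f :: nat \<Rightarrow> 'k. \<lambda>i. f (Suc i)"
  let ?\<delta> = "ind_fun r :: nat \<Rightarrow> 'k"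
  have cut_0: "f = fscale (f r) ?\<delta>" if f: "f \<in> ?U" "?cut f = 0" for f
  proof
    fix i
    have "f i = 0" if "i < r" using fun_cong[OF f(2), of i] that by simp
    moreover have "f i = 0" if "r < i" using f(1) that by (simp add: first_funs_def)
    ultimately show "f i = fscale (f r) ?\<delta> i"
      by (cases i r rule: linorder_cases) (simp_all add: ind_fun_def)
  qed
  have cut_add: "?cut (f + g) = ?cut f + ?cut g" for f g by (simp add: fun_eq_iff)
  have \<delta>U: "?\<delta> \<in> ?U" by (simp add: first_funs_def ind_fun_def)
  have half: "U2 = {0} \<and> W2 = {0}"
    if sU: "fn.internal_sum ?U U1 U2" and sW: "fn.internal_sum ?W W1 W2"
      and a1: "\<And>f. f \<in> U1 \<Longrightarrow> ?cut f \<in> W1" and a2: "\<And>f. f \<in> U2 \<Longrightarrow> ?cut f \<in> W2"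
      and b1: "\<And>f. f \<in> U1 \<Longrightarrow> ?sh f \<in> W1" and \<delta>: "?\<delta> \<in> U1" for U1 U2 W1 W2
  proof -
    note U12 = fn.internal_sum_subspaces[OF sU] and W12 = fn.internal_sum_subspaces[OF sW]
    have inds: "ind_fun (r - k) \<in> U1" if "k \<le> r" for k
      using that
    proof (induction k)
      case 0
      then show ?case using \<delta> by simp
    next
      case (Suc k)
      let ?f = "ind_fun (r - Suc k) :: nat \<Rightarrow> 'k"
      have "?f \<in> ?U" using Suc.prems by (simp add: first_funs_def ind_fun_def)
      then obtain p p' where p: "p \<in> U1" "p' \<in> U2" "?f = p + p'" by (rule fn.internal_sumE[OF sU])
      have "?cut ?f = ?sh (ind_fun (r - k))" using Suc.prems by (auto simp: fun_eq_iff ind_fun_def)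
      also have "\<dots> \<in> W1" by (rule b1[OF Suc.IH]) (use Suc.prems in simp)
      finally have "?cut ?f \<in> W1" .
      moreover have "?cut p' = ?cut ?f - ?cut p" unfolding p(3) cut_add by simp
      ultimately have "?cut p' \<in> W1" using fn.V.subspace_diff[OF W12(1) _ a1[OF p(1)]] by simp
      then have "?cut p' = 0" by (rule fn.internal_sum_disjoint[OF sW _ a2[OF p(2)]])
      then have "p' = fscale (p' r) ?\<delta>" using cut_0[of p'] p(2) U12(4) by blast
      moreover have "fscale (p' r) ?\<delta> \<in> U1" by (rule fn.V.subspace_scale[OF U12(1) \<delta>])
      ultimately have "p' \<in> U1" by simp
      then have "p' = 0" by (rule fn.internal_sum_disjoint[OF sU _ p(2)])
      then show ?case using p by simp
    qed
    have all: "f \<in> U1" if f: "f \<in> ?U" for f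
    proof -
      have "f = (\<Sum>i<Suc r. fscale (f i) (ind_fun i))"
      proof
        fix j
        have "(\<Sum>i<Suc r. fscale (f i) (ind_fun i)) j = (\<Sum>i<Suc r. fscale (f i) (ind_fun i) j)"
          by (induction r) simp_all
        also have "\<dots> = (\<Sum>i<Suc r. if j = i then f i else 0)"
          by (rule sum.cong) (simp_all add: ind_fun_def)
        also have "\<dots> = f j" unfolding sum_delta_less using f by (simp add: first_funs_def)
        finally show "f j = (\<Sum>i<Suc r. fscale (f i) (ind_fun i)) j" by simp
      qed
      moreover have "(\<Sum>i<Suc r. fscale (f i) (ind_fun i)) \<in> U1"
      proof (rule fn.V.subspace_sum[OF U12(1)])
        fix i assume "i \<in> {..<Suc r}"
        then have "ind_fun i \<in> U1" using inds[of "r - i"] by simp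
        then show "fscale (f i) (ind_fun i) \<in> U1" by (rule fn.V.subspace_scale[OF U12(1)])
      qed
      ultimately show ?thesis by simp
    qed
    have "f = 0" if "f \<in> U2" for f
      by (rule fn.internal_sum_disjoint[OF sU all that]) (use that U12(4) in blast)
    moreover have "y = 0" if y: "y \<in> W2" for y
    proof -
      have yW: "y \<in> ?W" using y W12(4) by blast
      then have "y \<in> U1" by (intro all) (simp add: first_funs_def)
      moreover have "?cut y = y" using yW by (auto simp: first_funs_def fun_eq_iff)
      ultimately have "y \<in> W1" using a1[of y] by simp
      then show ?thesis by (rule fn.internal_sum_disjoint[OF sW _ y])
    qed
    ultimately show ?thesis
      using fn.V.subspace_0[OF U12(2)] fn.V.subspace_0[OF W12(2)] by auto
  qed
  show ?thesis
    unfolding fn.indecomposable_pencil_def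
  proof (intro allI impI)
    fix U1 U2 W1 W2
    assume sU: "fn.internal_sum ?U U1 U2" and sW: "fn.internal_sum ?W W1 W2"
      and "mat_op (I_mat1 r) ` U1 \<subseteq> W1" "mat_op (I_mat2 r) ` U1 \<subseteq> W1"
      and "mat_op (I_mat1 r) ` U2 \<subseteq> W2" "mat_op (I_mat2 r) ` U2 \<subseteq> W2"
    note U12 = fn.internal_sum_subspaces[OF sU] and W12 = fn.internal_sum_subspaces[OF sW]
    have inv1: "?cut f \<in> W1" "?sh f \<in> W1" if "f \<in> U1" for f
    proof -
      have "f \<in> ?U" using that U12(3) by blast
      moreover have "mat_op (I_mat1 r) f \<in> W1" "mat_op (I_mat2 r) f \<in> W1"
        using \<open>mat_op (I_mat1 r) ` U1 \<subseteq> W1\<close> \<open>mat_op (I_mat2 r) ` U1 \<subseteq> W1\<close> that by auto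
      ultimately show "?cut f \<in> W1" "?sh f \<in> W1" by (simp_all add: mat_op_I)
    qed
    have inv2: "?cut f \<in> W2" "?sh f \<in> W2" if "f \<in> U2" for f
    proof -
      have "f \<in> ?U" using that U12(4) by blast
      moreover have "mat_op (I_mat1 r) f \<in> W2" "mat_op (I_mat2 r) f \<in> W2"
        using \<open>mat_op (I_mat1 r) ` U2 \<subseteq> W2\<close> \<open>mat_op (I_mat2 r) ` U2 \<subseteq> W2\<close> that by auto
      ultimately show "?cut f \<in> W2" "?sh f \<in> W2" by (simp_all add: mat_op_I)
    qed
    obtain p p' where p: "p \<in> U1" "p' \<in> U2" "?\<delta> = p + p'" by (rule fn.internal_sumE[OF sU \<delta>U])
    have "?cut ?\<delta> = 0" by (auto simp: fun_eq_iff ind_fun_def)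
    then have "?cut p + ?cut p' = 0" unfolding p(3) cut_add .
    then have eq: "?cut p = - ?cut p'" by (rule eq_neg_iff_add_eq_0[THEN iffD2])
    have "?cut p = 0"
      by (rule fn.internal_sum_disjoint[OF sW inv1(1)[OF p(1)]])
        (unfold eq, rule fn.V.subspace_neg[OF W12(2) inv2(1)[OF p(2)]])
    then have c: "p = fscale (p r) ?\<delta>" using cut_0[of p] p(1) U12(3) by blast
    have "?cut p' = 0" using eq \<open>?cut p = 0\<close> by simp
    then have c': "p' = fscale (p' r) ?\<delta>" using cut_0[of p'] p(2) U12(4) by blast
    have "?\<delta> r = p r + p' r" unfolding p(3) by simp
    then have sum1: "p r + p' r = 1" by (simp add: ind_fun_def)
    have \<delta>_in: "?\<delta> \<in> S" if "q \<in> S" "q = fscale (q r) ?\<delta>" "q r \<noteq> 0" "fn.V.subspace S" for q S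
    proof -
      have "fscale (1 / q r) q \<in> S" by (rule fn.V.subspace_scale[OF that(4,1)])
      moreover have "fscale (1 / q r) (fscale (q r) ?\<delta>) = ?\<delta>" using that(3) by (simp add: fun_eq_iff)
      ultimately show ?thesis using that(2) by simp
    qed
    show "U1 = {0} \<and> W1 = {0} \<or> U2 = {0} \<and> W2 = {0}"
    proof (cases "p r = 0")
      case False
      then have "?\<delta> \<in> U1" by (rule \<delta>_in[OF p(1) c _ U12(1)])
      then show ?thesis using half[OF sU sW inv1(1) inv2(1) inv1(2)] by simp
    next
      case True
      then have "p' r \<noteq> 0" using sum1 by simp
      then have "?\<delta> \<in> U2" by (rule \<delta>_in[OF p(2) c' _ U12(2)])
      then show ?thesis
        using half[OF fn.internal_sum_commute[OF sU] fn.internal_sum_commute[OF sW] inv2(1) inv1(1) inv2(2)]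
        by simp
    qed
  qed
qed

text \<open>As one map is the identity, \<open>W1 = U1\<close> and \<open>W2 = U2\<close>, and both are stable under the shift, the
  nilpotent part of the Jordan block.  Shifting a non-zero vector until only its last non-zero entry
  survives shows that every non-zero stable subspace contains the first unit vector.\<close>
lemma R_indecomposable:
  "fn.indecomposable_pencil (mat_op (1\<^sub>m p)) (mat_op (jordan_block p \<mu>))
     (first_funs p) (first_funs p :: (nat \<Rightarrow> 'k :: field) set)"
  unfolding fn.indecomposable_pencil_def
proof (intro allI impI)
  let ?U = "first_funs p :: (nat \<Rightarrow> 'k) set"
  let ?sh = "\<lambda>f :: nat \<Rightarrow> 'k. \<lambda>i. f (Suc i)"
  fix U1 U2 W1 W2
  assume sU: "fn.internal_sum ?U U1 U2" and sW: "fn.internal_sum ?U W1 W2"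
    and "mat_op (1\<^sub>m p) ` U1 \<subseteq> W1" "mat_op (jordan_block p \<mu>) ` U1 \<subseteq> W1"
    and "mat_op (1\<^sub>m p) ` U2 \<subseteq> W2" "mat_op (jordan_block p \<mu>) ` U2 \<subseteq> W2"
  note U12 = fn.internal_sum_subspaces[OF sU] and W12 = fn.internal_sum_subspaces[OF sW]
  have inv: "f \<in> W'" "(\<lambda>i. \<mu> * f i + f (Suc i)) \<in> W'"
    if "f \<in> U'" "U' \<subseteq> ?U" "mat_op (1\<^sub>m p) ` U' \<subseteq> W'" "mat_op (jordan_block p \<mu>) ` U' \<subseteq> W'" for f U' W'
  proof -
    have "f \<in> ?U" using that by blast
    moreover have "mat_op (1\<^sub>m p) f \<in> W'" "mat_op (jordan_block p \<mu>) f \<in> W'" using that by auto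
    ultimately show "f \<in> W'" "(\<lambda>i. \<mu> * f i + f (Suc i)) \<in> W'"
      by (simp_all add: mat_op_one mat_op_jordan)
  qed
  note inv1 = inv[OF _ U12(3) \<open>mat_op (1\<^sub>m p) ` U1 \<subseteq> W1\<close> \<open>mat_op (jordan_block p \<mu>) ` U1 \<subseteq> W1\<close>]
  note inv2 = inv[OF _ U12(4) \<open>mat_op (1\<^sub>m p) ` U2 \<subseteq> W2\<close> \<open>mat_op (jordan_block p \<mu>) ` U2 \<subseteq> W2\<close>]
  have desc: "y \<in> U'"
    if y: "y \<in> W'" and sums: "fn.internal_sum ?U U' Uc" "fn.internal_sum ?U W' Wc"
    and incl: "\<And>f. f \<in> U' \<Longrightarrow> f \<in> W'" "\<And>f. f \<in> Uc \<Longrightarrow> f \<in> Wc" for y U' Uc W' Wc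
  proof -
    note W' = fn.internal_sum_subspaces[OF sums(2)]
    have "y \<in> ?U" using y W'(3) by blast
    then obtain q q' where q: "q \<in> U'" "q' \<in> Uc" "y = q + q'" by (rule fn.internal_sumE[OF sums(1)])
    have "q' = y - q" using q(3) by simp
    also have "\<dots> \<in> W'" by (rule fn.V.subspace_diff[OF W'(1) y incl(1)[OF q(1)]])
    finally have "q' = 0" using fn.internal_sum_disjoint[OF sums(2) _ incl(2)[OF q(2)]] by simp
    then show ?thesis using q by simp
  qed
  note desc1 = desc[OF _ sU sW inv1(1) inv2(1)]
  note desc2 = desc[OF _ fn.internal_sum_commute[OF sU] fn.internal_sum_commute[OF sW] inv2(1) inv1(1)]
  have sh: "?sh f \<in> U'"
    if "f \<in> U'" "fn.V.subspace U'" "\<And>y. y \<in> W' \<Longrightarrow> y \<in> U'"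
      "\<And>f. f \<in> U' \<Longrightarrow> (\<lambda>i. \<mu> * f i + f (Suc i)) \<in> W'" for f U' W'
  proof -
    have "(\<lambda>i. \<mu> * f i + f (Suc i)) - fscale \<mu> f \<in> U'"
      by (intro fn.V.subspace_diff[OF that(2)] fn.V.subspace_scale[OF that(2)] that(1,3,4))
    moreover have "(\<lambda>i. \<mu> * f i + f (Suc i)) - fscale \<mu> f = ?sh f" by (simp add: fun_eq_iff)
    ultimately show ?thesis by simp
  qed
  have first: "ind_fun 0 \<in> U'"
    if f: "f \<in> U'" "f \<noteq> 0" and U': "fn.V.subspace U'" "U' \<subseteq> ?U" and s: "\<And>f. f \<in> U' \<Longrightarrow> ?sh f \<in> U'" for f U'
  proof -
    have ex: "\<exists>j. f j \<noteq> 0" using f(2) by (auto simp: fun_eq_iff)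
    have lt: "j < p" if "f j \<noteq> 0" for j
    proof (rule ccontr)
      assume "\<not> j < p"
      then show False using f(1) U'(2) that by (auto simp: first_funs_def)
    qed
    have bound: "j \<le> p" if "f j \<noteq> 0" for j by (rule less_imp_le[OF lt[OF that]])
    define j where "j = (GREATEST j. f j \<noteq> 0)"
    have j: "f j \<noteq> 0" "\<And>i. f i \<noteq> 0 \<Longrightarrow> i \<le> j"
      unfolding j_def
      by (rule GreatestI_ex_nat[OF ex bound], assumption, rule Greatest_le_nat[OF _ bound])
    have pow: "(?sh ^^ k) f \<in> U'" for k by (induction k) (use f(1) s in auto)
    have powi: "(?sh ^^ k) f i = f (k + i)" for k i
      by (induction k arbitrary: i) simp_all
    have "fscale (1 / f j) ((?sh ^^ j) f) = ind_fun 0"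
    proof
      fix i
      have "f (j + i) = 0" if "0 < i" using j(2)[of "j + i"] that by (cases "f (j + i) = 0") simp_all
      then show "fscale (1 / f j) ((?sh ^^ j) f) i = ind_fun 0 i"
        using j(1) by (cases "i = 0") (simp_all add: powi ind_fun_def)
    qed
    moreover have "fscale (1 / f j) ((?sh ^^ j) f) \<in> U'" by (rule fn.V.subspace_scale[OF U'(1) pow])
    ultimately show ?thesis by simp
  qed
  have zero: "W' = {0}"
    if "U' = {0}" "\<And>y. y \<in> W' \<Longrightarrow> y \<in> U'" "fn.V.subspace W'" for U' W' :: "(nat \<Rightarrow> 'k) set"
    using that fn.V.subspace_0[OF that(3)] by auto
  have "U1 = {0} \<or> U2 = {0}"
  proof (rule ccontr)
    assume "\<not> (U1 = {0} \<or> U2 = {0})"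
    then obtain f1 f2 where f: "f1 \<in> U1" "f1 \<noteq> 0" "f2 \<in> U2" "f2 \<noteq> 0"
      using fn.V.subspace_0[OF U12(1)] fn.V.subspace_0[OF U12(2)] by auto
    have "ind_fun 0 \<in> U1"
      by (rule first[OF f(1,2) U12(1,3)]) (rule sh[OF _ U12(1) desc1 inv1(2)])
    moreover have "ind_fun 0 \<in> U2"
      by (rule first[OF f(3,4) U12(2,4)]) (rule sh[OF _ U12(2) desc2 inv2(2)])
    ultimately have "ind_fun 0 = (0 :: nat \<Rightarrow> 'k)" by (rule fn.internal_sum_disjoint[OF sU])
    then have "ind_fun 0 0 = (0 :: 'k)" by simp
    then show False by (simp add: ind_fun_def)
  qed
  then show "U1 = {0} \<and> W1 = {0} \<or> U2 = {0} \<and> W2 = {0}"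
    using zero[OF _ desc1 W12(1)] zero[OF _ desc2 W12(2)] by (elim disjE) simp_all
qed

lemma kronecker_model_indecomposable:
  assumes "kronecker_model m n A B"
  shows "fn.indecomposable_pencil (mat_op A) (mat_op B) (first_funs m) (first_funs n)"
  using assms P_indecomposable[of m] I_indecomposable[of n] R_indecomposable[of m]
    fn.indecomposable_pencil_swap[OF R_indecomposable[of m]]
  unfolding kronecker_model_def by (elim disjE conjE exE) simp_all

section \<open>Representations of a group\<close>

text \<open>Homomorphisms into the group of linear automorphisms, read elementwise.\<close>
lemma representation_facts:
  assumes "representation G (class_ring :: 'k :: field ring) X"
  shows "group G" "vectorspace class_ring (rep_space X)"
    "\<And>g x. g \<in> carrier G \<Longrightarrow> x \<in> carrier (rep_space X) \<Longrightarrow> rep_act X g x \<in> carrier (rep_space X)"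
    "\<And>g x y. g \<in> carrier G \<Longrightarrow> x \<in> carrier (rep_space X) \<Longrightarrow> y \<in> carrier (rep_space X) \<Longrightarrow>
       rep_act X g (x \<oplus>\<^bsub>rep_space X\<^esub> y) = rep_act X g x \<oplus>\<^bsub>rep_space X\<^esub> rep_act X g y"
    "\<And>g c x. g \<in> carrier G \<Longrightarrow> x \<in> carrier (rep_space X) \<Longrightarrow>
       rep_act X g (c \<odot>\<^bsub>rep_space X\<^esub> x) = c \<odot>\<^bsub>rep_space X\<^esub> rep_act X g x"
    "\<And>g h x. g \<in> carrier G \<Longrightarrow> h \<in> carrier G \<Longrightarrow> x \<in> carrier (rep_space X) \<Longrightarrow>
       rep_act X (g \<otimes>\<^bsub>G\<^esub> h) x = rep_act X g (rep_act X h x)"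
    "\<And>x. x \<in> carrier (rep_space X) \<Longrightarrow> rep_act X \<one>\<^bsub>G\<^esub> x = x"
proof -
  let ?V = "rep_space X"
  show G: "group G" and "vectorspace class_ring ?V"
    using assms by (simp_all add: representation_def)
  interpret G: group G by (rule G)
  have hom: "rep_act X \<in> hom G (linear_auto_group class_ring ?V)"
    using assms by (simp add: representation_def)
  have mem: "rep_act X g \<in> Bij (carrier ?V)" "rep_act X g \<in> LinearCombinations.module_hom class_ring ?V ?V"
    if "g \<in> carrier G" for g
    using hom_in_carrier[OF hom that] by (simp_all add: linear_auto_group_def)
  show closed: "rep_act X g x \<in> carrier ?V" if "g \<in> carrier G" "x \<in> carrier ?V" for g x
    using Bij_imp_funcset[OF mem(1)[OF that(1)]] that(2) by auto
  show "rep_act X g (x \<oplus>\<^bsub>?V\<^esub> y) = rep_act X g x \<oplus>\<^bsub>?V\<^esub> rep_act X g y"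
    if "g \<in> carrier G" "x \<in> carrier ?V" "y \<in> carrier ?V" for g x y
    by (rule LinearCombinations.module_hom_add[OF mem(2)[OF that(1)] that(2,3)])
  show "rep_act X g (c \<odot>\<^bsub>?V\<^esub> x) = c \<odot>\<^bsub>?V\<^esub> rep_act X g x"
    if "g \<in> carrier G" "x \<in> carrier ?V" for g c x
    by (rule LinearCombinations.module_hom_smult[OF mem(2)[OF that(1)] _ that(2)]) simp
  show mult: "rep_act X (g \<otimes>\<^bsub>G\<^esub> h) x = rep_act X g (rep_act X h x)"
    if "g \<in> carrier G" "h \<in> carrier G" "x \<in> carrier ?V" for g h x
    using hom_mult[OF hom that(1,2)] mem(1)[OF that(1)] mem(1)[OF that(2)] that(3)
    by (simp add: linear_auto_group_def BijGroup_def compose_eq)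
  show "rep_act X \<one>\<^bsub>G\<^esub> x = x" if x: "x \<in> carrier ?V" for x
  proof -
    have "rep_act X \<one>\<^bsub>G\<^esub> (rep_act X \<one>\<^bsub>G\<^esub> x) = rep_act X \<one>\<^bsub>G\<^esub> x"
      using mult[of "\<one>\<^bsub>G\<^esub>" "\<one>\<^bsub>G\<^esub>" x] x by simp
    moreover have "inj_on (rep_act X \<one>\<^bsub>G\<^esub>) (carrier ?V)"
      using mem(1)[OF G.one_closed] by (simp add: Bij_def bij_betw_def)
    ultimately show ?thesis using closed[OF G.one_closed x] x by (simp add: inj_on_eq_iff)
  qed
qed

lemma representationI:
  assumes G: "group G" and V: "vectorspace class_ring (rep_space X)"
    and ext: "\<And>g. g \<in> carrier G \<Longrightarrow> rep_act X g \<in> extensional (carrier (rep_space X))"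
    and hom: "\<And>g. g \<in> carrier G \<Longrightarrow>
      rep_act X g \<in> LinearCombinations.module_hom (class_ring :: 'k :: field ring) (rep_space X) (rep_space X)"
    and mult: "\<And>g h x. g \<in> carrier G \<Longrightarrow> h \<in> carrier G \<Longrightarrow> x \<in> carrier (rep_space X) \<Longrightarrow>
       rep_act X (g \<otimes>\<^bsub>G\<^esub> h) x = rep_act X g (rep_act X h x)"
    and one: "\<And>x. x \<in> carrier (rep_space X) \<Longrightarrow> rep_act X \<one>\<^bsub>G\<^esub> x = x"
  shows "representation G class_ring X"
proof -
  let ?V = "rep_space X"
  interpret G: group G by (rule G)
  have closed: "rep_act X g x \<in> carrier ?V" if "g \<in> carrier G" "x \<in> carrier ?V" for g x
    using LinearCombinations.module_hom_closed[OF hom[OF that(1)]] that(2) by auto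
  have Bij: "rep_act X g \<in> Bij (carrier ?V)" if g: "g \<in> carrier G" for g
  proof -
    have inv: "rep_act X (inv\<^bsub>G\<^esub> g) (rep_act X g x) = x" "rep_act X g (rep_act X (inv\<^bsub>G\<^esub> g) x) = x"
      if "x \<in> carrier ?V" for x
      using mult[of "inv\<^bsub>G\<^esub> g" g x] mult[of g "inv\<^bsub>G\<^esub> g" x] g that one by simp_all
    have "bij_betw (rep_act X g) (carrier ?V) (carrier ?V)"
      by (rule bij_betw_byWitness[where f' = "rep_act X (inv\<^bsub>G\<^esub> g)"]) (use inv closed g in auto)
    then show ?thesis using ext[OF g] by (simp add: Bij_def)
  qed
  have "rep_act X \<in> hom G (linear_auto_group class_ring ?V)"
  proof (rule homI)
    fix g h assume g: "g \<in> carrier G" and h: "h \<in> carrier G"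
    have "rep_act X (g \<otimes>\<^bsub>G\<^esub> h) = compose (carrier ?V) (rep_act X g) (rep_act X h)"
    proof (rule extensionalityI[OF ext])
      show "g \<otimes>\<^bsub>G\<^esub> h \<in> carrier G" using g h by simp
      show "compose (carrier ?V) (rep_act X g) (rep_act X h) \<in> extensional (carrier ?V)"
        by (rule compose_extensional)
      show "rep_act X (g \<otimes>\<^bsub>G\<^esub> h) x = compose (carrier ?V) (rep_act X g) (rep_act X h) x"
        if "x \<in> carrier ?V" for x using mult[OF g h that] that by (simp add: compose_eq)
    qed
    then show "rep_act X (g \<otimes>\<^bsub>G\<^esub> h) = rep_act X g \<otimes>\<^bsub>linear_auto_group class_ring ?V\<^esub> rep_act X h"
      using Bij g h by (simp add: linear_auto_group_def BijGroup_def)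
  qed (use Bij hom in \<open>simp add: linear_auto_group_def\<close>)
  then show ?thesis using G V by (simp add: representation_def)
qed

lemma subrepresentation_facts:
  assumes "subrepresentation G (class_ring :: 'k :: field ring) X M"
  shows "M \<subseteq> carrier (rep_space X)" "\<zero>\<^bsub>rep_space X\<^esub> \<in> M"
    "\<And>x y. x \<in> M \<Longrightarrow> y \<in> M \<Longrightarrow> x \<oplus>\<^bsub>rep_space X\<^esub> y \<in> M"
    "\<And>c x. x \<in> M \<Longrightarrow> c \<odot>\<^bsub>rep_space X\<^esub> x \<in> M"
    "\<And>g x. g \<in> carrier G \<Longrightarrow> x \<in> M \<Longrightarrow> rep_act X g x \<in> M"
proof -
  have s: "LinearCombinations.submodule class_ring M (rep_space X)"
    using assms by (simp add: subrepresentation_def VectorSpace.subspace_def)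
  interpret submodule class_ring M "rep_space X" by (rule s)
  show "M \<subseteq> carrier (rep_space X)" "\<zero>\<^bsub>rep_space X\<^esub> \<in> M" by (rule subset, rule zero_closed)
  show "x \<oplus>\<^bsub>rep_space X\<^esub> y \<in> M" if "x \<in> M" "y \<in> M" for x y by (rule m_closed[OF that])
  show "c \<odot>\<^bsub>rep_space X\<^esub> x \<in> M" if "x \<in> M" for c x by (rule smult_closed[OF _ that]) simp
  show "rep_act X g x \<in> M" if "g \<in> carrier G" "x \<in> M" for g x
    using assms that by (simp add: subrepresentation_def)
qed

lemma subrepresentationI:
  assumes "vectorspace (class_ring :: 'k :: field ring) (rep_space X)"
    and "M \<subseteq> carrier (rep_space X)" "\<zero>\<^bsub>rep_space X\<^esub> \<in> M"
    "\<And>x y. x \<in> M \<Longrightarrow> y \<in> M \<Longrightarrow> x \<oplus>\<^bsub>rep_space X\<^esub> y \<in> M"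
    "\<And>c x. x \<in> M \<Longrightarrow> c \<odot>\<^bsub>rep_space X\<^esub> x \<in> M"
    "\<And>g x. g \<in> carrier G \<Longrightarrow> x \<in> M \<Longrightarrow> rep_act X g x \<in> M"
  shows "subrepresentation G class_ring X M"
  unfolding subrepresentation_def VectorSpace.subspace_def
  using assms by (auto intro!: submodule.intro simp: vectorspace_def)

lemma set_add_iff:
  "x \<in> set_add V M M' \<longleftrightarrow> (\<exists>y\<in>M. \<exists>z\<in>M'. x = y \<oplus>\<^bsub>V\<^esub> z)"
  by (auto simp: set_add_def set_mult_def)

section \<open>The Klein four group\<close>

lemma klein_four_simps:
  "carrier klein_four = {(0, 0), (0, 1), (1, 0), (1, 1)}"
  "\<one>\<^bsub>klein_four\<^esub> = (0, 0)"
  "(a, b) \<otimes>\<^bsub>klein_four\<^esub> (c, d) = ((a + c) mod 2, (b + d) mod 2)"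
proof -
  have "{0..<int 2} = {0, 1}" by auto
  then show "carrier klein_four = {(0, 0), (0, 1), (1, 0), (1, 1)}"
    by (auto simp: carrier_integer_mod_group)
qed simp_all

lemma group_klein_four: "group klein_four"
  by (rule DirProd_group) simp_all

locale klein_generators =
  fixes g1 g2 :: "int \<times> int"
  assumes gens: "g1 \<in> carrier klein_four" "g2 \<in> carrier klein_four"
    "generate klein_four {g1, g2} = carrier klein_four"
begin

text \<open>A set of generators is not contained in a subgroup \<open>{1, h}\<close>.\<close>
lemma generators_cases:
  "(g1, g2) \<in> {((0,1),(1,0)), ((0,1),(1,1)), ((1,0),(0,1)), ((1,0),(1,1)), ((1,1),(0,1)), ((1,1),(1,0))}"
proof -
  have no: "\<not> {g1, g2} \<subseteq> {(0, 0), h}" if "h \<in> carrier klein_four" for h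
  proof
    assume sub: "{g1, g2} \<subseteq> {(0, 0), h}"
    have "subgroup {(0, 0), h} klein_four"
    proof (rule group.subgroupI[OF group_klein_four])
      show "{(0, 0), h} \<subseteq> carrier klein_four" using that by (auto simp: klein_four_simps(1))
      show "x \<otimes>\<^bsub>klein_four\<^esub> y \<in> {(0, 0), h}" if "x \<in> {(0, 0), h}" "y \<in> {(0, 0), h}" for x y
        using that \<open>h \<in> carrier klein_four\<close> unfolding klein_four_simps(1)
        by (elim insertE emptyE) (simp_all add: klein_four_simps)
      show "inv\<^bsub>klein_four\<^esub> x \<in> {(0, 0), h}" if "x \<in> {(0, 0), h}" for x
      proof -
        have "x \<in> carrier klein_four" using that \<open>h \<in> carrier klein_four\<close> by (auto simp: klein_four_simps)
        then have "x \<otimes>\<^bsub>klein_four\<^esub> x = \<one>\<^bsub>klein_four\<^esub>"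
          unfolding klein_four_simps(1) by (elim insertE emptyE) (simp_all add: klein_four_simps)
        then have "inv\<^bsub>klein_four\<^esub> x = x"
          using \<open>x \<in> carrier klein_four\<close> \<open>x \<in> carrier klein_four\<close>
          by (rule group.inv_equality[OF group_klein_four])
        then show ?thesis using that by simp
      qed
    qed simp
    then have "generate klein_four {g1, g2} \<subseteq> {(0, 0), h}"
      by (rule group.generate_subgroup_incl[OF group_klein_four sub])
    then have "carrier klein_four \<subseteq> {(0, 0), h}" unfolding gens(3) .
    then have "(0, 1) \<in> {(0, 0), h}" "(1, 0) \<in> {(0, 0), h}"
      unfolding klein_four_simps(1) by simp_all
    then have "(0, 1) = h" "(1, 0) = h" by simp_all
    then have "(0 :: int, 1 :: int) = (1, 0)" by (rule trans[OF _ sym])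
    then show False by simp
  qed
  show ?thesis
    using no[OF gens(1)] no[OF gens(2)] gens(1,2) unfolding klein_four_simps(1)
    by (elim insertE emptyE) simp_all
qed

lemma generator_facts:
  "carrier klein_four = {\<one>\<^bsub>klein_four\<^esub>, g1, g2, g1 \<otimes>\<^bsub>klein_four\<^esub> g2}"
  "g1 \<noteq> \<one>\<^bsub>klein_four\<^esub>" "g2 \<noteq> \<one>\<^bsub>klein_four\<^esub>" "g1 \<noteq> g2"
  "g1 \<otimes>\<^bsub>klein_four\<^esub> g2 \<noteq> \<one>\<^bsub>klein_four\<^esub>" "g1 \<otimes>\<^bsub>klein_four\<^esub> g2 \<noteq> g1" "g1 \<otimes>\<^bsub>klein_four\<^esub> g2 \<noteq> g2"
proof -
  have "g1 \<noteq> \<one>\<^bsub>klein_four\<^esub> \<and> g2 \<noteq> \<one>\<^bsub>klein_four\<^esub> \<and> g1 \<noteq> g2 \<and> g1 \<otimes>\<^bsub>klein_four\<^esub> g2 \<noteq> \<one>\<^bsub>klein_four\<^esub> \<and>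
      g1 \<otimes>\<^bsub>klein_four\<^esub> g2 \<noteq> g1 \<and> g1 \<otimes>\<^bsub>klein_four\<^esub> g2 \<noteq> g2"
    using generators_cases by (elim insertE emptyE) (simp_all add: klein_four_simps)
  then show "g1 \<noteq> \<one>\<^bsub>klein_four\<^esub>" "g2 \<noteq> \<one>\<^bsub>klein_four\<^esub>" "g1 \<noteq> g2"
    "g1 \<otimes>\<^bsub>klein_four\<^esub> g2 \<noteq> \<one>\<^bsub>klein_four\<^esub>" "g1 \<otimes>\<^bsub>klein_four\<^esub> g2 \<noteq> g1" "g1 \<otimes>\<^bsub>klein_four\<^esub> g2 \<noteq> g2"
    by simp_all
  show "carrier klein_four = {\<one>\<^bsub>klein_four\<^esub>, g1, g2, g1 \<otimes>\<^bsub>klein_four\<^esub> g2}"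
    unfolding klein_four_simps(1) using generators_cases
    by (elim insertE emptyE) (simp_all add: klein_four_simps insert_commute)
qed

end

lemma klein_four_square: "g \<in> carrier klein_four \<Longrightarrow> g \<otimes>\<^bsub>klein_four\<^esub> g = \<one>\<^bsub>klein_four\<^esub>"
  unfolding klein_four_simps(1) by (elim insertE emptyE) (simp_all add: klein_four_simps)

lemma klein_four_inv: "g \<in> carrier klein_four \<Longrightarrow> inv\<^bsub>klein_four\<^esub> g = g"
  by (rule group.inv_equality[OF group_klein_four klein_four_square])

lemma klein_four_commute: "g \<otimes>\<^bsub>klein_four\<^esub> h = h \<otimes>\<^bsub>klein_four\<^esub> g"
  by (cases g; cases h) (simp add: klein_four_simps add.commute)

lemma char_2_add_self:
  assumes "CHAR('k :: field) = 2"
  shows "x + x = (0 :: 'k)"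
proof -
  have "(of_nat CHAR('k) :: 'k) = 0" by (rule of_nat_CHAR)
  then have "(2 :: 'k) = 0" unfolding assms of_nat_numeral .
  then have "2 * x = 0" by (simp only: mult_zero_left)
  then show ?thesis unfolding mult_2 .
qed

section \<open>The representations \<open>T X\<close>\<close>

lemma matrix_double_zero:
  fixes A :: "'k :: field mat"
  assumes "CHAR('k) = 2" "A \<in> carrier_mat n m"
  shows "A + A = 0\<^sub>m n m"
  using assms(2) by (intro eq_matI) (auto simp: char_2_add_self[OF assms(1)])

locale T_model = klein_generators g1 g2
  for g1 g2 :: "int \<times> int" +
  fixes m n :: nat and A B :: "'k :: field mat"
  assumes char2: "CHAR('k) = 2" and A: "A \<in> carrier_mat n m" and B: "B \<in> carrier_mat n m"
begin

abbreviation Y :: "('k, int \<times> int, 'k vec \<times> 'k vec) rep" where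
  "Y \<equiv> T_rep klein_four g1 g2 (matrix_kronecker_rep m n A B)"

abbreviation space :: "('k vec \<times> 'k vec) set" where
  "space \<equiv> carrier_vec m \<times> carrier_vec n"

text \<open>The lower left block of the action of \<open>g\<close>.\<close>
definition nilp :: "int \<times> int \<Rightarrow> 'k mat" where
  "nilp g = (if g = \<one>\<^bsub>klein_four\<^esub> then 0\<^sub>m n m else if g = g1 then A else if g = g2 then B else A + B)"

lemma space_facts:
  "carrier (rep_space Y) = space"
  "\<zero>\<^bsub>rep_space Y\<^esub> = (0\<^sub>v m, 0\<^sub>v n)"
  "x \<oplus>\<^bsub>rep_space Y\<^esub> y = (fst x + fst y, snd x + snd y)"
  "c \<odot>\<^bsub>rep_space Y\<^esub> x = (c \<cdot>\<^sub>v fst x, c \<cdot>\<^sub>v snd x)"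
  by (simp_all add: T_rep_def matrix_kronecker_rep_def Let_def direct_sum_def module_vec_simps)

lemma nilp_carrier: "nilp g \<in> carrier_mat n m"
  using A B by (simp add: nilp_def)

lemma act:
  assumes "x \<in> carrier_vec m" "y \<in> carrier_vec n"
  shows "rep_act Y g (x, y) = (x, nilp g *\<^sub>v x + y)"
proof -
  have u: "unipotent (module_vec TYPE('k) m) (module_vec TYPE('k) n) f (x, y) = (x, f x + y)"
    if "y \<in> carrier_vec n" for f y
    using assms that by (simp add: unipotent_def direct_sum_def module_vec_simps)
  have "0\<^sub>m n m *\<^sub>v x + y = y" using assms by (auto intro!: eq_vecI)
  moreover have "A *\<^sub>v x + (B *\<^sub>v x + y) = (A + B) *\<^sub>v x + y"
    using A B assms by (simp add: add_mult_distrib_mat_vec[OF A B] assoc_add_vec[of _ n])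
  ultimately show ?thesis
    using assms A B
    by (simp add: T_rep_def matrix_kronecker_rep_def Let_def nilp_def u compose_def
        direct_sum_def module_vec_simps)
qed

lemma nilp_mult:
  assumes "g \<in> carrier klein_four" "h \<in> carrier klein_four"
  shows "nilp (g \<otimes>\<^bsub>klein_four\<^esub> h) = nilp g + nilp h"
proof -
  have AA: "A + A = 0\<^sub>m n m" "B + B = 0\<^sub>m n m"
    using matrix_double_zero[OF char2] A B by simp_all
  have AB: "B + A = A + B" "A + (A + B) = B" "B + (A + B) = A" "A + B + A = B" "A + B + B = A"
    using A B char_2_add_self[OF char2]
    by (auto intro!: eq_matI simp: add.assoc add.commute add.left_commute)
  have G: "group klein_four" by (rule group_klein_four)
  have sq: "g1 \<otimes>\<^bsub>klein_four\<^esub> g1 = \<one>\<^bsub>klein_four\<^esub>" "g2 \<otimes>\<^bsub>klein_four\<^esub> g2 = \<one>\<^bsub>klein_four\<^esub>"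
    using klein_four_square gens by simp_all
  have prods: "g2 \<otimes>\<^bsub>klein_four\<^esub> g1 = g1 \<otimes>\<^bsub>klein_four\<^esub> g2"
    "g1 \<otimes>\<^bsub>klein_four\<^esub> (g1 \<otimes>\<^bsub>klein_four\<^esub> g2) = g2" "g2 \<otimes>\<^bsub>klein_four\<^esub> (g1 \<otimes>\<^bsub>klein_four\<^esub> g2) = g1"
    "g1 \<otimes>\<^bsub>klein_four\<^esub> g2 \<otimes>\<^bsub>klein_four\<^esub> g1 = g2" "g1 \<otimes>\<^bsub>klein_four\<^esub> g2 \<otimes>\<^bsub>klein_four\<^esub> g2 = g1"
    "g1 \<otimes>\<^bsub>klein_four\<^esub> g2 \<otimes>\<^bsub>klein_four\<^esub> (g1 \<otimes>\<^bsub>klein_four\<^esub> g2) = \<one>\<^bsub>klein_four\<^esub>"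
    using generators_cases by (elim insertE emptyE; simp add: klein_four_simps)+
  have one: "\<one>\<^bsub>klein_four\<^esub> \<otimes>\<^bsub>klein_four\<^esub> g = g" "g \<otimes>\<^bsub>klein_four\<^esub> \<one>\<^bsub>klein_four\<^esub> = g"
    if "g \<in> carrier klein_four" for g
    using group.is_monoid[OF G] that by (simp_all add: monoid.l_one monoid.r_one del: one_DirProd mult_DirProd)
  have prod_mem: "g1 \<otimes>\<^bsub>klein_four\<^esub> g2 \<in> carrier klein_four"
    unfolding generator_facts(1) by simp
  have z: "0\<^sub>m n m + M = M" "M + 0\<^sub>m n m = M" if "M \<in> carrier_mat n m" for M :: "'k mat"
    using that by simp_all
  have nv: "nilp \<one>\<^bsub>klein_four\<^esub> = 0\<^sub>m n m" "nilp g1 = A" "nilp g2 = B"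
    "nilp (g1 \<otimes>\<^bsub>klein_four\<^esub> g2) = A + B"
    unfolding nilp_def using generator_facts(2-7) by (simp_all del: one_DirProd mult_DirProd)
  have ABc: "A + B \<in> carrier_mat n m" using A B by simp
  have one_mem: "\<one>\<^bsub>klein_four\<^esub> \<in> carrier klein_four"
    unfolding generator_facts(1) by (rule insertI1)
  show ?thesis
    using assms(1)[unfolded generator_facts(1)] assms(2)[unfolded generator_facts(1)]
    by (elim insertE emptyE; simp only: one one_mem gens prod_mem matrix_double_zero[OF char2 ABc] sq prods nv AA AB z[OF A] z[OF B] z[OF ABc]
        z[OF zero_carrier_mat])
qed

lemma vectorspace_space: "vectorspace class_ring (rep_space Y)"
  using direct_sum_is_vs[OF vec_vs vec_vs] by (simp add: T_rep_def matrix_kronecker_rep_def Let_def)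

lemma representation_T: "representation klein_four class_ring Y"
proof (rule representationI[OF group_klein_four vectorspace_space])
  fix g assume g: "g \<in> carrier klein_four"
  show "rep_act Y g \<in> extensional (carrier (rep_space Y))"
    unfolding space_facts(1)
    by (auto simp: T_rep_def matrix_kronecker_rep_def Let_def unipotent_def direct_sum_def
        module_vec_simps compose_def)
  show "rep_act Y g \<in> LinearCombinations.module_hom class_ring (rep_space Y) (rep_space Y)"
    unfolding LinearCombinations.module_hom_def space_facts
  proof (intro CollectI conjI allI impI funcsetI)
    fix x :: "'k vec \<times> 'k vec" assume "x \<in> space"
    then show "rep_act Y g x \<in> space"
      using nilp_carrier[of g] by (cases x) (simp add: act)
  next
    fix x y :: "'k vec \<times> 'k vec" assume "x \<in> space \<and> y \<in> space"
    then obtain x1 x2 y1 y2 where xy: "x = (x1, x2)" "y = (y1, y2)" "x1 \<in> carrier_vec m" "y1 \<in> carrier_vec m"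
      "x2 \<in> carrier_vec n" "y2 \<in> carrier_vec n" by auto
    have "nilp g *\<^sub>v x1 \<in> carrier_vec n" "nilp g *\<^sub>v y1 \<in> carrier_vec n"
      by (rule mult_mat_vec_carrier[OF nilp_carrier xy(3)], rule mult_mat_vec_carrier[OF nilp_carrier xy(4)])
    then have "nilp g *\<^sub>v (x1 + y1) + (x2 + y2) = (nilp g *\<^sub>v x1 + x2) + (nilp g *\<^sub>v y1 + y2)"
      unfolding mult_add_distrib_mat_vec[OF nilp_carrier xy(3,4)]
      using xy by (intro eq_vecI) (auto simp: add_ac)
    then show "rep_act Y g (fst x + fst y, snd x + snd y) =
        (fst (rep_act Y g x) + fst (rep_act Y g y), snd (rep_act Y g x) + snd (rep_act Y g y))"
      using xy by (simp add: act)
  next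
    fix c :: 'k and x :: "'k vec \<times> 'k vec" assume "c \<in> carrier class_ring \<and> x \<in> space"
    then obtain x1 x2 where x: "x = (x1, x2)" "x1 \<in> carrier_vec m" "x2 \<in> carrier_vec n" by auto
    have "nilp g *\<^sub>v x1 \<in> carrier_vec n" by (rule mult_mat_vec_carrier[OF nilp_carrier x(2)])
    then have "nilp g *\<^sub>v (c \<cdot>\<^sub>v x1) + c \<cdot>\<^sub>v x2 = c \<cdot>\<^sub>v (nilp g *\<^sub>v x1 + x2)"
      unfolding mult_mat_vec[OF nilp_carrier x(2)] by (rule smult_add_distrib_vec[OF _ x(3), symmetric])
    then show "rep_act Y g (c \<cdot>\<^sub>v fst x, c \<cdot>\<^sub>v snd x) = (c \<cdot>\<^sub>v fst (rep_act Y g x), c \<cdot>\<^sub>v snd (rep_act Y g x))"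
      using x by (simp add: act)
  qed
next
  fix g h x assume gh: "g \<in> carrier klein_four" "h \<in> carrier klein_four" and "x \<in> carrier (rep_space Y)"
  then obtain x1 x2 where x: "x = (x1, x2)" "x1 \<in> carrier_vec m" "x2 \<in> carrier_vec n"
    unfolding space_facts by auto
  have Nh: "nilp h *\<^sub>v x1 \<in> carrier_vec n" and Ng: "nilp g *\<^sub>v x1 \<in> carrier_vec n"
    by (rule mult_mat_vec_carrier[OF nilp_carrier x(2)])+
  have "nilp (g \<otimes>\<^bsub>klein_four\<^esub> h) *\<^sub>v x1 + x2 = nilp g *\<^sub>v x1 + (nilp h *\<^sub>v x1 + x2)"
    unfolding nilp_mult[OF gh] add_mult_distrib_mat_vec[OF nilp_carrier nilp_carrier x(2)]
    by (rule assoc_add_vec[OF Ng Nh x(3)])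
  then show "rep_act Y (g \<otimes>\<^bsub>klein_four\<^esub> h) x = rep_act Y g (rep_act Y h x)"
    unfolding x(1) using x Nh by (simp only: act add_carrier_vec)
next
  fix x assume "x \<in> carrier (rep_space Y)"
  then obtain x1 x2 where x: "x = (x1, x2)" "x1 \<in> carrier_vec m" "x2 \<in> carrier_vec n"
    unfolding space_facts by auto
  have "0\<^sub>m n m *\<^sub>v x1 + x2 = x2" using x by (auto intro!: eq_vecI)
  then show "rep_act Y \<one>\<^bsub>klein_four\<^esub> x = x"
    unfolding x(1) act[OF x(2,3)] nilp_def by simp
qed

end

lemma fin_dimI:
  assumes V: "vectorspace (class_ring :: 'k :: field ring) V"
    and f: "f \<in> LinearCombinations.module_hom class_ring (module_vec TYPE('k) N) V"
    and surj: "f ` carrier_vec N = carrier V"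
  shows "vectorspace.fin_dim class_ring V"
proof -
  interpret L: linear_map "class_ring :: 'k ring" "module_vec TYPE('k) N" V f
    by (intro linear_map.intro mod_hom.intro mod_hom_axioms.intro vec_vs V f
        vectorspace.axioms(1)[OF vec_vs] vectorspace.axioms(1)[OF V])
  show ?thesis
    by (rule L.surj_fin_dim) (simp_all add: vec_space.fin_dim surj module_vec_simps)
qed

lemma mat_op_add: "mat_op A (f + g) = mat_op A f + mat_op A g"
  by (simp add: mat_op_def fun_eq_iff distrib_left sum.distrib)

lemma vec_mat_op:
  assumes "A \<in> carrier_mat n m"
  shows "vec n (mat_op A f) = A *\<^sub>v vec m f"
  using assms by (intro eq_vecI) (auto simp: mat_op_def scalar_prod_def lessThan_atLeast0)

lemma mat_op_first_funs:
  assumes "A \<in> carrier_mat n m"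
  shows "mat_op A f \<in> first_funs n"
  using assms by (auto simp: mat_op_def first_funs_def)

lemma vec_add_fun: "vec m (f + g) = vec m f + vec m g"
  by (intro eq_vecI) simp_all

lemma vec_fscale: "vec m (fscale c f) = c \<cdot>\<^sub>v vec m f"
  by (intro eq_vecI) simp_all

lemma vec_zero_fun: "vec m 0 = 0\<^sub>v m"
  by (intro eq_vecI) simp_all

lemma first_funs_vec_inj:
  assumes "f \<in> first_funs m" "g \<in> first_funs m" "vec m f = vec m g"
  shows "f = g"
proof
  fix i
  show "f i = g i"
  proof (cases "i < m")
    case True
    then show ?thesis using arg_cong[OF assms(3), of "\<lambda>v. v $ i"] by simp
  next
    case False
    then show ?thesis using assms(1,2) by (simp add: first_funs_def)
  qed
qed

lemma first_funs_vec_surj: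
  assumes "x \<in> carrier_vec m"
  obtains f where "f \<in> first_funs m" "x = vec m f"
  by (rule that[of "\<lambda>i. if i < m then x $ i else 0"]) (use assms in \<open>auto simp: first_funs_def\<close>)

lemma subspace_first_funs: "fn.V.subspace (first_funs m)"
  by (rule fn.V.subspaceI) (simp_all add: first_funs_def)

context T_model
begin

lemma fin_dim_T: "vectorspace.fin_dim class_ring (rep_space Y)"
proof (rule fin_dimI[OF vectorspace_space])
  let ?f = "\<lambda>v :: 'k vec. (vec m (\<lambda>i. v $ i), vec n (\<lambda>i. v $ (m + i)))"
  show "?f \<in> LinearCombinations.module_hom class_ring (module_vec TYPE('k) (m + n)) (rep_space Y)"
    unfolding LinearCombinations.module_hom_def space_facts module_vec_simps
    by (auto intro!: eq_vecI)
  show "?f ` carrier_vec (m + n) = carrier (rep_space Y)"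
    unfolding space_facts
  proof (intro equalityI subsetI)
    fix z assume "z \<in> space"
    then obtain x y where z: "z = (x, y)" "x \<in> carrier_vec m" "y \<in> carrier_vec n" by auto
    have "?f (x @\<^sub>v y) = z" unfolding z(1) using z(2,3) by (auto intro!: eq_vecI)
    moreover have "x @\<^sub>v y \<in> carrier_vec (m + n)" using z(2,3) by simp
    ultimately show "z \<in> ?f ` carrier_vec (m + n)" by (intro image_eqI[of _ _ "x @\<^sub>v y"]) simp_all
  qed auto
qed

text \<open>A summand \<open>N\<close> of \<open>T X\<close> gives the image \<open>U N\<close> of \<open>N\<close> in \<open>X\<^sub>1\<close> and the intersection \<open>W N\<close> of \<open>N\<close> with \<open>X\<^sub>2\<close>;
  both maps send \<open>U N\<close> to \<open>W N\<close>, since \<open>g - 1\<close> preserves \<open>N\<close>.  For complementary summands, \<open>ker\<close> makes the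
  images meet only in zero, and \<open>surj\<close> makes the intersections span \<open>X\<^sub>2\<close>.\<close>
lemma indecomposable_T:
  assumes ind: "fn.indecomposable_pencil (mat_op A) (mat_op B) (first_funs m) (first_funs n)"
    and ker: "\<And>f. f \<in> first_funs m \<Longrightarrow> mat_op A f = 0 \<Longrightarrow> mat_op B f = 0 \<Longrightarrow> f = 0"
    and surj: "\<And>y. y \<in> first_funs n \<Longrightarrow>
      \<exists>f\<in>first_funs m. \<exists>f'\<in>first_funs m. y = mat_op A f + mat_op B f'"
    and m: "m \<ge> 1"
  shows "indecomposable_rep klein_four class_ring Y"
  unfolding indecomposable_rep_def Let_def space_facts
proof (intro conjI notI)
  assume "space = {(0\<^sub>v m, 0\<^sub>v n)}"
  moreover have "(vec m (\<lambda>_. 1 :: 'k), 0\<^sub>v n) \<in> space" by simp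
  ultimately have "(vec m (\<lambda>_. 1 :: 'k), 0\<^sub>v n :: 'k vec) = (0\<^sub>v m, 0\<^sub>v n)" by (simp only: singleton_iff)
  then have "vec m (\<lambda>_. 1 :: 'k) $ 0 = 0\<^sub>v m $ 0" by simp
  then show False using m by simp
next
  assume "\<exists>M M'. subrepresentation klein_four class_ring Y M \<and> subrepresentation klein_four class_ring Y M' \<and>
    M \<noteq> {(0\<^sub>v m, 0\<^sub>v n)} \<and> M' \<noteq> {(0\<^sub>v m, 0\<^sub>v n)} \<and> M \<inter> M' = {(0\<^sub>v m, 0\<^sub>v n)} \<and>
    set_add (rep_space Y) M M' = space"
  then obtain M M' where sub: "subrepresentation klein_four class_ring Y M" "subrepresentation klein_four class_ring Y M'"
    and nz: "M \<noteq> {(0\<^sub>v m, 0\<^sub>v n)}" "M' \<noteq> {(0\<^sub>v m, 0\<^sub>v n)}"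
    and inter: "M \<inter> M' = {(0\<^sub>v m, 0\<^sub>v n)}" and add: "set_add (rep_space Y) M M' = space"
    by (elim exE conjE) (rule that)
  define U where "U N = {f \<in> first_funs m. \<exists>y\<in>carrier_vec n. (vec m f, y) \<in> N}" for N :: "('k vec \<times> 'k vec) set"
  define W where "W N = {f \<in> first_funs n. (0\<^sub>v m, vec n f) \<in> N}" for N :: "('k vec \<times> 'k vec) set"
  have Nsub: "N \<subseteq> space" and N0: "(0\<^sub>v m, 0\<^sub>v n) \<in> N"
    and Nadd: "\<And>x y x' y'. (x, y) \<in> N \<Longrightarrow> (x', y') \<in> N \<Longrightarrow> (x + x', y + y') \<in> N"
    and Nsmult: "\<And>c x y. (x, y) \<in> N \<Longrightarrow> (c \<cdot>\<^sub>v x, c \<cdot>\<^sub>v y) \<in> N"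
    and Nnilp: "\<And>g x y. g \<in> carrier klein_four \<Longrightarrow> (x, y) \<in> N \<Longrightarrow> (0\<^sub>v m, nilp g *\<^sub>v x) \<in> N"
    if N: "subrepresentation klein_four class_ring Y N" for N
  proof -
    note f = subrepresentation_facts[OF N, unfolded space_facts]
    show sp: "N \<subseteq> space" and "(0\<^sub>v m, 0\<^sub>v n) \<in> N" by (rule f(1), rule f(2))
    show ad: "(x + x', y + y') \<in> N" if "(x, y) \<in> N" "(x', y') \<in> N" for x y x' y'
      using f(3)[OF that] by simp
    show sm: "(c \<cdot>\<^sub>v x, c \<cdot>\<^sub>v y) \<in> N" if "(x, y) \<in> N" for c x y
      using f(4)[OF that, of c] by simp
    show "(0\<^sub>v m, nilp g *\<^sub>v x) \<in> N" if g: "g \<in> carrier klein_four" and xy: "(x, y) \<in> N" for g x y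
    proof -
      have c: "x \<in> carrier_vec m" "y \<in> carrier_vec n" using xy sp by auto
      have n: "nilp g *\<^sub>v x \<in> carrier_vec n" by (rule mult_mat_vec_carrier[OF nilp_carrier c(1)])
      have "rep_act Y g (x, y) \<in> N" by (rule f(5)[OF g xy])
      then have "(x, nilp g *\<^sub>v x + y) \<in> N" unfolding act[OF c] .
      from ad[OF this sm[OF xy, of "-1"]]
      have "(x + (-1) \<cdot>\<^sub>v x, nilp g *\<^sub>v x + y + (-1) \<cdot>\<^sub>v y) \<in> N" .
      moreover have "x + (-1) \<cdot>\<^sub>v x = 0\<^sub>v m" using c by (intro eq_vecI) auto
      moreover have "nilp g *\<^sub>v x + y + (-1) \<cdot>\<^sub>v y = nilp g *\<^sub>v x"
        using c n by (intro eq_vecI) (simp_all del: index_mult_mat_vec dim_mult_mat_vec add: carrier_vecD)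
      ultimately show ?thesis by simp
    qed
  qed
  have nilp12: "nilp g1 = A" "nilp g2 = B"
    unfolding nilp_def using generator_facts(2-7) by (simp_all del: one_DirProd)
  have subU: "fn.V.subspace (U N)" and subW: "fn.V.subspace (W N)"
    and AU: "mat_op A ` U N \<subseteq> W N" and BU: "mat_op B ` U N \<subseteq> W N"
    and zero: "U N = {0} \<Longrightarrow> W N = {0} \<Longrightarrow> N = {(0\<^sub>v m, 0\<^sub>v n)}"
    if N: "subrepresentation klein_four class_ring Y N" for N
  proof -
    note f = Nsub[OF N] N0[OF N] Nadd[OF N] Nsmult[OF N]
    have FF: "fn.V.subspace (first_funs k :: (nat \<Rightarrow> 'k) set)" for k by (rule subspace_first_funs)
    show "fn.V.subspace (U N)"
    proof (rule fn.V.subspaceI)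
      show "0 \<in> U N"
        unfolding U_def using f(2) fn.V.subspace_0[OF FF]
        by (intro CollectI conjI bexI[of _ "0\<^sub>v n"]) (simp_all add: vec_zero_fun)
    next
      fix p q assume "p \<in> U N" "q \<in> U N"
      then obtain y z where "p \<in> first_funs m" "q \<in> first_funs m" "y \<in> carrier_vec n" "z \<in> carrier_vec n"
        "(vec m p, y) \<in> N" "(vec m q, z) \<in> N" unfolding U_def by auto
      then show "p + q \<in> U N"
        unfolding U_def using f(3) fn.V.subspace_add[OF FF]
        by (intro CollectI conjI bexI[of _ "y + z"]) (simp_all add: vec_add_fun)
    next
      fix c p assume "p \<in> U N"
      then obtain y where "p \<in> first_funs m" "y \<in> carrier_vec n" "(vec m p, y) \<in> N" unfolding U_def by auto
      then show "fscale c p \<in> U N"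
        unfolding U_def using f(4) fn.V.subspace_scale[OF FF]
        by (intro CollectI conjI bexI[of _ "c \<cdot>\<^sub>v y"]) (simp_all add: vec_fscale)
    qed
    have z: "0\<^sub>v m + 0\<^sub>v m = (0\<^sub>v m :: 'k vec)" "c \<cdot>\<^sub>v 0\<^sub>v m = (0\<^sub>v m :: 'k vec)" for c :: 'k
      by (auto intro!: eq_vecI)
    show "fn.V.subspace (W N)"
    proof (rule fn.V.subspaceI)
      show "0 \<in> W N" unfolding W_def using f(2) fn.V.subspace_0[OF FF] by (simp add: vec_zero_fun)
    next
      fix p q assume "p \<in> W N" "q \<in> W N"
      then show "p + q \<in> W N"
        unfolding W_def using f(3)[of "0\<^sub>v m" "vec n p" "0\<^sub>v m" "vec n q"] fn.V.subspace_add[OF FF]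
        by (simp add: vec_add_fun z)
    next
      fix c p assume "p \<in> W N"
      then show "fscale c p \<in> W N"
        unfolding W_def using f(4)[of "0\<^sub>v m" "vec n p" c] fn.V.subspace_scale[OF FF]
        by (simp add: vec_fscale z)
    qed
    show "mat_op A ` U N \<subseteq> W N"
    proof clarify
      fix p assume "p \<in> U N"
      then obtain y where "(vec m p, y) \<in> N" unfolding U_def by auto
      from Nnilp[OF N gens(1) this]
      show "mat_op A p \<in> W N"
        unfolding W_def nilp12 using mat_op_first_funs[OF A] by (simp add: vec_mat_op[OF A])
    qed
    show "mat_op B ` U N \<subseteq> W N"
    proof clarify
      fix p assume "p \<in> U N"
      then obtain y where "(vec m p, y) \<in> N" unfolding U_def by auto
      from Nnilp[OF N gens(2) this]
      show "mat_op B p \<in> W N"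
        unfolding W_def nilp12 using mat_op_first_funs[OF B] by (simp add: vec_mat_op[OF B])
    qed
    show "N = {(0\<^sub>v m, 0\<^sub>v n)}" if U0: "U N = {0}" and W0: "W N = {0}"
    proof (intro equalityI subsetI)
      fix z assume z: "z \<in> N"
      obtain x y where xy: "z = (x, y)" by (cases z)
      have c: "x \<in> carrier_vec m" "y \<in> carrier_vec n" using f(1) z xy by auto
      obtain p where p: "p \<in> first_funs m" "x = vec m p" by (rule first_funs_vec_surj[OF c(1)])
      obtain q where q: "q \<in> first_funs n" "y = vec n q" by (rule first_funs_vec_surj[OF c(2)])
      have "p \<in> U N" unfolding U_def using p c(2) z xy by auto
      then have "x = 0\<^sub>v m" unfolding U0 using p(2) by (simp add: vec_zero_fun)
      then have "q \<in> W N" unfolding W_def using q z xy by simp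
      then have "y = 0\<^sub>v n" unfolding W0 using q(2) by (simp add: vec_zero_fun)
      then show "z \<in> {(0\<^sub>v m, 0\<^sub>v n)}" using xy \<open>x = 0\<^sub>v m\<close> by simp
    next
      fix z assume "z \<in> {(0\<^sub>v m, 0\<^sub>v n) :: 'k vec \<times> 'k vec}"
      then show "z \<in> N" using f(2) by simp
    qed
  qed
  have split: "\<exists>p\<in>U M. \<exists>q\<in>U M'. f = p + q" if f: "f \<in> first_funs m" for f
  proof -
    have "(vec m f, 0\<^sub>v n) \<in> set_add (rep_space Y) M M'" unfolding add by simp
    then obtain u v where uv: "u \<in> M" "v \<in> M'" "(vec m f, 0\<^sub>v n) = u \<oplus>\<^bsub>rep_space Y\<^esub> v"
      unfolding set_add_iff by (elim bexE) (rule that)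
    have c: "u \<in> space" "v \<in> space" using Nsub[OF sub(1)] Nsub[OF sub(2)] uv(1,2) by auto
    obtain p where p: "p \<in> first_funs m" "fst u = vec m p" by (rule first_funs_vec_surj[of "fst u" m]) (use c in auto)
    obtain q where q: "q \<in> first_funs m" "fst v = vec m q" by (rule first_funs_vec_surj[of "fst v" m]) (use c in auto)
    have "vec m f = vec m (p + q)" using uv(3) p q unfolding space_facts vec_add_fun by simp
    then have "f = p + q"
      by (rule first_funs_vec_inj[OF f fn.V.subspace_add[OF subspace_first_funs p(1) q(1)]])
    moreover have "p \<in> U M" unfolding U_def using p uv(1) c(1) by (cases u) auto
    moreover have "q \<in> U M'" unfolding U_def using q uv(2) c(2) by (cases v) auto
    ultimately show ?thesis by (intro bexI)
  qed
  have zero_fun: "f = 0" if "f \<in> first_funs k" "vec k f = 0\<^sub>v k" for f :: "nat \<Rightarrow> 'k" and k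
    by (rule first_funs_vec_inj[OF that(1) fn.V.subspace_0[OF subspace_first_funs]])
      (simp add: that(2) vec_zero_fun)
  have disjW: "f = 0" if "f \<in> W M" "f \<in> W M'" for f
  proof -
    have "(0\<^sub>v m, vec n f) \<in> M \<inter> M'" using that unfolding W_def by simp
    then have "vec n f = 0\<^sub>v n" unfolding inter by simp
    then show ?thesis using that(1) zero_fun[of f n] unfolding W_def by simp
  qed
  have sumU: "fn.internal_sum (first_funs m) (U M) (U M')"
    unfolding fn.internal_sum_def
  proof (intro conjI subU sub ballI)
    show "U M \<subseteq> first_funs m" "U M' \<subseteq> first_funs m" unfolding U_def by auto
    show "U M \<inter> U M' = {0}"
    proof (intro equalityI subsetI)
      fix f assume f: "f \<in> U M \<inter> U M'"
      have "mat_op A f = 0" "mat_op B f = 0"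
        by (rule disjW; use f AU[OF sub(1)] AU[OF sub(2)] BU[OF sub(1)] BU[OF sub(2)] in blast)+
      then have "f = 0" using ker[of f] f unfolding U_def by simp
      then show "f \<in> {0}" by simp
    next
      fix f assume "f \<in> {0 :: nat \<Rightarrow> 'k}"
      then show "f \<in> U M \<inter> U M'"
        using fn.V.subspace_0[OF subU[OF sub(1)]] fn.V.subspace_0[OF subU[OF sub(2)]] by simp
    qed
    show "\<exists>y\<in>U M. \<exists>z\<in>U M'. x = y + z" if "x \<in> first_funs m" for x by (rule split[OF that])
  qed
  have sumW: "fn.internal_sum (first_funs n) (W M) (W M')"
    unfolding fn.internal_sum_def
  proof (intro conjI subW sub ballI)
    show "W M \<subseteq> first_funs n" "W M' \<subseteq> first_funs n" unfolding W_def by auto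
    show "W M \<inter> W M' = {0}"
      using disjW fn.V.subspace_0[OF subW[OF sub(1)]] fn.V.subspace_0[OF subW[OF sub(2)]] by auto
    fix y :: "nat \<Rightarrow> 'k" assume "y \<in> first_funs n"
    then obtain f f' where f: "f \<in> first_funs m" "f' \<in> first_funs m" "y = mat_op A f + mat_op B f'"
      using surj by blast
    obtain p q where p: "p \<in> U M" "q \<in> U M'" "f = p + q" using split[OF f(1)] by blast
    obtain p' q' where p': "p' \<in> U M" "q' \<in> U M'" "f' = p' + q'" using split[OF f(2)] by blast
    have "y = (mat_op A p + mat_op B p') + (mat_op A q + mat_op B q')"
      unfolding f(3) p(3) p'(3) mat_op_add by (simp add: add_ac)
    moreover have "mat_op A p + mat_op B p' \<in> W M"
      by (rule fn.V.subspace_add[OF subW[OF sub(1)]]) (use AU[OF sub(1)] BU[OF sub(1)] p(1) p'(1) in auto)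
    moreover have "mat_op A q + mat_op B q' \<in> W M'"
      by (rule fn.V.subspace_add[OF subW[OF sub(2)]]) (use AU[OF sub(2)] BU[OF sub(2)] p(2) p'(2) in auto)
    ultimately show "\<exists>z\<in>W M. \<exists>z'\<in>W M'. y = z + z'" by (intro bexI)
  qed
  have "U M = {0} \<and> W M = {0} \<or> U M' = {0} \<and> W M' = {0}"
    by (rule ind[unfolded fn.indecomposable_pencil_def, rule_format,
          OF sumU sumW AU[OF sub(1)] BU[OF sub(1)] AU[OF sub(2)] BU[OF sub(2)]])
  then show False using zero[OF sub(1)] zero[OF sub(2)] nz by (elim disjE conjE) simp_all
qed

text \<open>Both maps of \<open>I\<^sub>0\<close> are zero, so \<open>indecomposable_T\<close> does not apply; but \<open>T I\<^sub>0\<close> has dimension one.\<close>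
lemma indecomposable_I_0:
  assumes "m = 1" "n = 0"
  shows "indecomposable_rep klein_four class_ring Y"
  unfolding indecomposable_rep_def Let_def space_facts
proof (intro conjI notI)
  let ?e = "(vec m (\<lambda>_. 1 :: 'k), 0\<^sub>v n :: 'k vec)"
  have e: "?e \<noteq> (0\<^sub>v m, 0\<^sub>v n)"
  proof
    assume "?e = (0\<^sub>v m, 0\<^sub>v n)"
    then have "vec m (\<lambda>_. 1 :: 'k) $ 0 = 0\<^sub>v m $ 0" by simp
    then show False using assms by simp
  qed
  {
    assume "space = {(0\<^sub>v m, 0\<^sub>v n)}"
    moreover have "?e \<in> space" by simp
    ultimately show False using e by (simp only: singleton_iff)
  }
  assume "\<exists>M M'. subrepresentation klein_four class_ring Y M \<and> subrepresentation klein_four class_ring Y M' \<and>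
    M \<noteq> {(0\<^sub>v m, 0\<^sub>v n)} \<and> M' \<noteq> {(0\<^sub>v m, 0\<^sub>v n)} \<and> M \<inter> M' = {(0\<^sub>v m, 0\<^sub>v n)} \<and>
    set_add (rep_space Y) M M' = space"
  then obtain M M' where sub: "subrepresentation klein_four class_ring Y M" "subrepresentation klein_four class_ring Y M'"
    and nz: "M \<noteq> {(0\<^sub>v m, 0\<^sub>v n)}" "M' \<noteq> {(0\<^sub>v m, 0\<^sub>v n)}"
    and inter: "M \<inter> M' = {(0\<^sub>v m, 0\<^sub>v n)}"
    by (elim exE conjE) (rule that)
  have "?e \<in> N"
    if N: "subrepresentation klein_four class_ring Y N" and nz: "N \<noteq> {(0\<^sub>v m, 0\<^sub>v n)}" for N
  proof -
    note f = subrepresentation_facts[OF N, unfolded space_facts]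
    obtain z where z: "z \<in> N" "z \<noteq> (0\<^sub>v m, 0\<^sub>v n)" using f(2) nz by auto
    obtain x y where xy: "z = (x, y)" "x \<in> carrier_vec m" "y \<in> carrier_vec n" using z(1) f(1) by (cases z) auto
    have y: "y = 0\<^sub>v n" using xy(3) assms(2) by (intro eq_vecI) simp_all
    have "x $ 0 \<noteq> 0"
    proof
      assume "x $ 0 = 0"
      then have "x = 0\<^sub>v m" using xy(2) assms(1) by (intro eq_vecI) simp_all
      then show False using z(2) xy(1) y by simp
    qed
    then have "((1 / x $ 0) \<cdot>\<^sub>v x, (1 / x $ 0) \<cdot>\<^sub>v y) = ?e"
      using xy(2,3) assms by (auto intro!: eq_vecI)
    moreover have "((1 / x $ 0) \<cdot>\<^sub>v x, (1 / x $ 0) \<cdot>\<^sub>v y) \<in> N"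
      using f(4)[OF z(1), of "1 / x $ 0"] xy(1) by simp
    ultimately show ?thesis by simp
  qed
  from this[OF sub(1) nz(1)] this[OF sub(2) nz(2)] have "?e \<in> M \<inter> M'" by (rule IntI)
  then show False using e unfolding inter by (simp only: singleton_iff)
qed

lemma fd_indecomposable_T:
  assumes model: "kronecker_model m n A B" and m: "m \<ge> 1"
  shows "fd_indecomposable_rep klein_four class_ring Y"
proof -
  note ind = kronecker_model_indecomposable[OF model]
  from model[unfolded kronecker_model_def] have "indecomposable_rep klein_four class_ring Y"
  proof (elim disjE conjE exE)
    assume P: "n = m + 1" "A = P_mat1 m" "B = P_mat2 m"
    show ?thesis
    proof (rule indecomposable_T[OF ind _ _ m])
      fix f :: "nat \<Rightarrow> 'k" assume "f \<in> first_funs m" "mat_op A f = 0"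
      then show "f = 0" by (simp add: P mat_op_P)
    next
      fix y :: "nat \<Rightarrow> 'k" assume y: "y \<in> first_funs n"
      let ?f = "\<lambda>i. if i < m then y i else 0" and ?g = "fscale (y m) (ind_fun (m - 1))"
      have fg: "?f \<in> first_funs m" "?g \<in> first_funs m" using m by (auto simp: first_funs_def ind_fun_def)
      have ops: "mat_op A ?f = ?f" "mat_op B ?g = (\<lambda>i. case i of 0 \<Rightarrow> 0 | Suc k \<Rightarrow> ?g k)"
        unfolding P by (rule mat_op_P[OF fg(1)], rule mat_op_P[OF fg(2)])
      have pt: "y i = mat_op A ?f i + mat_op B ?g i" for i
      proof (cases i)
        case 0
        then show ?thesis unfolding ops using m by simp
      next
        case (Suc k)
        then show ?thesis
          unfolding ops using y m
          by (cases "Suc k" m rule: linorder_cases) (auto simp: P first_funs_def ind_fun_def)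
      qed
      have "y = mat_op A ?f + mat_op B ?g" by (rule ext) (unfold plus_fun_apply, rule pt)
      then show "\<exists>f\<in>first_funs m. \<exists>f'\<in>first_funs m. y = mat_op A f + mat_op B f'"
        using fg by (intro bexI)
    qed
  next
    assume I: "m = n + 1" "A = I_mat1 n" "B = I_mat2 n"
    show ?thesis
    proof (cases "n = 0")
      case True
      then show ?thesis using I by (intro indecomposable_I_0) simp_all
    next
      case False
      then have n: "n \<ge> 1" by simp
      show ?thesis
      proof (rule indecomposable_T[OF ind _ _ m])
        fix f :: "nat \<Rightarrow> 'k" assume f: "f \<in> first_funs m" "mat_op A f = 0" "mat_op B f = 0"
        then have cut: "(\<lambda>i. if i < n then f i else 0) = 0" and sh: "(\<lambda>i. f (Suc i)) = 0"
          by (simp_all add: I mat_op_I)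
        show "f = 0"
        proof
          fix i show "f i = 0 i"
            using fun_cong[OF cut, of 0] fun_cong[OF sh, of "i - 1"] n by (cases i) simp_all
        qed
      next
        fix y :: "nat \<Rightarrow> 'k" assume y: "y \<in> first_funs n"
        then have yz: "y \<in> first_funs m" "0 \<in> first_funs m" by (auto simp: I first_funs_def)
        have "mat_op A y = y" "mat_op B 0 = 0"
          using y yz by (auto simp: I mat_op_I fun_eq_iff first_funs_def)
        then have "y = mat_op A y + mat_op B 0" by simp
        then show "\<exists>f\<in>first_funs m. \<exists>f'\<in>first_funs m. y = mat_op A f + mat_op B f'"
          using yz by (intro bexI)
      qed
    qed
  next
    fix \<mu> assume R1: "n = m" "A = jordan_block m \<mu>" "B = 1\<^sub>m m"
    have z: "(0 :: nat \<Rightarrow> 'k) \<in> first_funs m" by (simp add: first_funs_def)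
    show ?thesis
    proof (rule indecomposable_T[OF ind _ _ m])
      fix f :: "nat \<Rightarrow> 'k" assume f: "f \<in> first_funs m" "mat_op B f = 0"
      then show "f = 0" by (simp add: R1 mat_op_one)
    next
      fix y :: "nat \<Rightarrow> 'k" assume "y \<in> first_funs n"
      then have y: "y \<in> first_funs m" by (simp add: R1)
      have "mat_op A 0 = 0" using z by (simp add: R1 mat_op_jordan fun_eq_iff)
      then have "y = mat_op A 0 + mat_op B y" using y by (simp add: R1 mat_op_one)
      then show "\<exists>f\<in>first_funs m. \<exists>f'\<in>first_funs m. y = mat_op A f + mat_op B f'"
        using y z by (intro bexI)
    qed
  next
    fix \<mu> assume R2: "n = m" "A = 1\<^sub>m m" "B = jordan_block m \<mu>"
    have z: "(0 :: nat \<Rightarrow> 'k) \<in> first_funs m" by (simp add: first_funs_def)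
    show ?thesis
    proof (rule indecomposable_T[OF ind _ _ m])
      fix f :: "nat \<Rightarrow> 'k" assume f: "f \<in> first_funs m" "mat_op A f = 0"
      then show "f = 0" by (simp add: R2 mat_op_one)
    next
      fix y :: "nat \<Rightarrow> 'k" assume "y \<in> first_funs n"
      then have y: "y \<in> first_funs m" by (simp add: R2)
      have "mat_op B 0 = 0" using z by (simp add: R2 mat_op_jordan fun_eq_iff)
      then have "y = mat_op A y + mat_op B 0" using y by (simp add: R2 mat_op_one)
      then show "\<exists>f\<in>first_funs m. \<exists>f'\<in>first_funs m. y = mat_op A f + mat_op B f'"
        using y z by (intro bexI)
    qed
  qed
  then show ?thesis
    unfolding fd_indecomposable_rep_def using representation_T fin_dim_T by simp
qed

end

section \<open>The regular representation\<close>

abbreviation klein_regular :: "('k :: field, int \<times> int, int \<times> int \<Rightarrow> 'k) rep" where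
  "klein_regular \<equiv> regular_rep klein_four class_ring"

lemma regular_space_facts:
  "carrier (rep_space (klein_regular :: ('k :: field, _, _) rep)) = (carrier klein_four \<rightarrow>\<^sub>E UNIV)"
  "\<zero>\<^bsub>rep_space (klein_regular :: ('k, _, _) rep)\<^esub> = (\<lambda>h\<in>carrier klein_four. 0)"
  "f \<oplus>\<^bsub>rep_space (klein_regular :: ('k, _, _) rep)\<^esub> g = (\<lambda>h\<in>carrier klein_four. f h + g h)"
  "c \<odot>\<^bsub>rep_space (klein_regular :: ('k, _, _) rep)\<^esub> f = (\<lambda>h\<in>carrier klein_four. c * f h)"
proof -
  have r: "ring (class_ring :: 'k ring)" by (rule class_ring.ring_axioms)
  show "carrier (rep_space (klein_regular :: ('k :: field, _, _) rep)) = (carrier klein_four \<rightarrow>\<^sub>E UNIV)"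
    "\<zero>\<^bsub>rep_space (klein_regular :: ('k, _, _) rep)\<^esub> = (\<lambda>h\<in>carrier klein_four. 0)"
    "f \<oplus>\<^bsub>rep_space (klein_regular :: ('k, _, _) rep)\<^esub> g = (\<lambda>h\<in>carrier klein_four. f h + g h)"
    "c \<odot>\<^bsub>rep_space (klein_regular :: ('k, _, _) rep)\<^esub> f = (\<lambda>h\<in>carrier klein_four. c * f h)"
    by (simp_all add: regular_rep_def ring.func_space_def[OF r] del: carrier_DirProd)
qed

text \<open>Every element of the group is its own inverse.\<close>
lemma regular_act:
  assumes "f \<in> carrier klein_four \<rightarrow>\<^sub>E UNIV" "g \<in> carrier klein_four"
  shows "rep_act (klein_regular :: ('k :: field, _, _) rep) g f =
    (\<lambda>h\<in>carrier klein_four. f (g \<otimes>\<^bsub>klein_four\<^esub> h))"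
proof -
  have "f \<in> carrier (ring.func_space (class_ring :: 'k ring) (carrier klein_four))"
    using assms(1) regular_space_facts(1)[where 'k = 'k] by (simp add: regular_rep_def del: carrier_DirProd)
  then show ?thesis
    unfolding regular_rep_def using klein_four_inv[OF assms(2)]
    by (simp del: carrier_DirProd)
qed

lemma klein_four_closed:
  "g \<in> carrier klein_four \<Longrightarrow> h \<in> carrier klein_four \<Longrightarrow> g \<otimes>\<^bsub>klein_four\<^esub> h \<in> carrier klein_four"
  using group.is_monoid[OF group_klein_four] by (rule monoid.m_closed)

lemma vectorspace_regular: "vectorspace class_ring (rep_space (klein_regular :: ('k :: field, _, _) rep))"
proof -
  interpret vectorspace "class_ring :: 'k ring" "module_vec TYPE('k) 0" by (rule vec_vs)
  show ?thesis using func_space_is_vs[of "carrier klein_four"] by (simp add: regular_rep_def del: carrier_DirProd)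
qed

lemma representation_regular: "representation klein_four class_ring (klein_regular :: ('k :: field, _, _) rep)"
proof (rule representationI[OF group_klein_four vectorspace_regular])
  fix g assume g: "g \<in> carrier klein_four"
  show "rep_act (klein_regular :: ('k, _, _) rep) g \<in> extensional (carrier (rep_space (klein_regular :: ('k, _, _) rep)))"
    by (simp add: regular_rep_def del: carrier_DirProd)
  show "rep_act (klein_regular :: ('k, _, _) rep) g \<in>
      LinearCombinations.module_hom class_ring (rep_space klein_regular) (rep_space klein_regular)"
    unfolding LinearCombinations.module_hom_def regular_space_facts
    by (intro CollectI conjI allI impI funcsetI)
      (auto simp: regular_act[OF _ g] klein_four_closed[OF g] fun_eq_iff simp del: carrier_DirProd)
next
  fix g h and f :: "int \<times> int \<Rightarrow> 'k"
  assume gh: "g \<in> carrier klein_four" "h \<in> carrier klein_four"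
  assume "f \<in> carrier (rep_space (klein_regular :: ('k, _, _) rep))"
  then have f: "f \<in> carrier klein_four \<rightarrow>\<^sub>E UNIV" unfolding regular_space_facts .
  have "g \<otimes>\<^bsub>klein_four\<^esub> h \<otimes>\<^bsub>klein_four\<^esub> x = h \<otimes>\<^bsub>klein_four\<^esub> (g \<otimes>\<^bsub>klein_four\<^esub> x)"
    if "x \<in> carrier klein_four" for x
    unfolding klein_four_commute[of g h]
    by (rule monoid.m_assoc[OF group.is_monoid[OF group_klein_four] gh(2,1) that])
  then show "rep_act (klein_regular :: ('k, _, _) rep) (g \<otimes>\<^bsub>klein_four\<^esub> h) f = rep_act klein_regular g (rep_act klein_regular h f)"
    unfolding regular_act[OF f klein_four_closed[OF gh]] regular_act[OF f gh(2)]
    by (subst regular_act[OF _ gh(1)])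
      (simp_all add: klein_four_closed[OF gh(1)] cong: restrict_cong del: carrier_DirProd)
next
  fix f :: "int \<times> int \<Rightarrow> 'k" assume "f \<in> carrier (rep_space (klein_regular :: ('k, _, _) rep))"
  then have f: "f \<in> carrier klein_four \<rightarrow>\<^sub>E UNIV" unfolding regular_space_facts .
  have one: "\<one>\<^bsub>klein_four\<^esub> \<in> carrier klein_four"
    by (rule monoid.one_closed[OF group.is_monoid[OF group_klein_four]])
  have "\<one>\<^bsub>klein_four\<^esub> \<otimes>\<^bsub>klein_four\<^esub> x = x" if "x \<in> carrier klein_four" for x
    by (rule monoid.l_one[OF group.is_monoid[OF group_klein_four] that])
  then show "rep_act klein_regular \<one>\<^bsub>klein_four\<^esub> f = f"
    unfolding regular_act[OF f one] using f
    by (auto simp: fun_eq_iff PiE_def extensional_def simp del: carrier_DirProd one_DirProd)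
qed

lemma fin_dim_regular: "vectorspace.fin_dim class_ring (rep_space (klein_regular :: ('k :: field, _, _) rep))"
proof (rule fin_dimI[OF vectorspace_regular])
  let ?i = "\<lambda>(a, b). nat (2 * a + b)"
  let ?f = "\<lambda>v :: 'k vec. \<lambda>h\<in>carrier klein_four. v $ ?i h"
  have i: "?i h < 4" if "h \<in> carrier klein_four" for h
    using that unfolding klein_four_simps(1) by auto
  show "?f \<in> LinearCombinations.module_hom class_ring (module_vec TYPE('k) 4) (rep_space klein_regular)"
    unfolding LinearCombinations.module_hom_def regular_space_facts module_vec_simps
    using i by (auto simp: fun_eq_iff simp del: carrier_DirProd)
  show "?f ` carrier_vec 4 = carrier (rep_space (klein_regular :: ('k, _, _) rep))"
    unfolding regular_space_facts
  proof (intro equalityI subsetI)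
    fix f :: "int \<times> int \<Rightarrow> 'k" assume f: "f \<in> carrier klein_four \<rightarrow>\<^sub>E UNIV"
    let ?v = "vec 4 (\<lambda>i. f (int i div 2, int i mod 2))"
    have "?f ?v h = f h" for h
    proof (cases "h \<in> carrier klein_four")
      case True
      then show ?thesis unfolding klein_four_simps(1) by auto
    next
      case False
      then show ?thesis using PiE_arb[OF f False] by (simp del: carrier_DirProd)
    qed
    then have "f = ?f ?v" by (simp add: fun_eq_iff)
    then show "f \<in> ?f ` carrier_vec 4" by (intro image_eqI[of _ _ ?v]) simp_all
  next
    fix f assume "f \<in> ?f ` carrier_vec 4"
    then show "f \<in> carrier klein_four \<rightarrow>\<^sub>E UNIV" by (elim imageE) (simp del: carrier_DirProd)
  qed
qed

context klein_generators
begin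

text \<open>If \<open>g\<close> does not fix \<open>f\<close>, then \<open>g f + f\<close> is a non-zero vector of \<open>M\<close> fixed by \<open>g\<close>, because \<open>g\<^sup>2 = 1\<close> and the
  characteristic is 2; commutativity keeps it fixed by whatever fixes \<open>f\<close>.\<close>
lemma regular_fixed_step:
  fixes f :: "int \<times> int \<Rightarrow> 'k :: field"
  assumes char2: "CHAR('k) = 2"
    and M: "subrepresentation klein_four class_ring (klein_regular :: ('k, _, _) rep) M"
    and f: "f \<in> M" "h \<in> carrier klein_four" "f h \<noteq> 0" and g: "g \<in> carrier klein_four"
  shows "\<exists>u\<in>M. (\<exists>h\<in>carrier klein_four. u h \<noteq> 0) \<and> (\<forall>h\<in>carrier klein_four. u (g \<otimes>\<^bsub>klein_four\<^esub> h) = u h) \<and>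
    (\<forall>g'\<in>carrier klein_four. (\<forall>h\<in>carrier klein_four. f (g' \<otimes>\<^bsub>klein_four\<^esub> h) = f h) \<longrightarrow>
       (\<forall>h\<in>carrier klein_four. u (g' \<otimes>\<^bsub>klein_four\<^esub> h) = u h))"
proof (cases "\<forall>h\<in>carrier klein_four. f (g \<otimes>\<^bsub>klein_four\<^esub> h) = f h")
  case True
  show ?thesis
    by (intro bexI[of _ f] conjI bexI[of _ h] True f ballI impI) (elim bspec)
next
  case False
  note m = subrepresentation_facts[OF M, unfolded regular_space_facts]
  have fc: "f \<in> carrier klein_four \<rightarrow>\<^sub>E UNIV" by (rule subsetD[OF m(1) f(1)])
  define u where "u = (\<lambda>h\<in>carrier klein_four. rep_act (klein_regular :: ('k, _, _) rep) g f h + f h)"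
  have u: "u h = f (g \<otimes>\<^bsub>klein_four\<^esub> h) + f h" if "h \<in> carrier klein_four" for h
    unfolding u_def regular_act[OF fc g] using that by (simp del: carrier_DirProd)
  have assoc: "x \<otimes>\<^bsub>klein_four\<^esub> y \<otimes>\<^bsub>klein_four\<^esub> z = x \<otimes>\<^bsub>klein_four\<^esub> (y \<otimes>\<^bsub>klein_four\<^esub> z)"
    if "x \<in> carrier klein_four" "y \<in> carrier klein_four" "z \<in> carrier klein_four" for x y z
    by (rule monoid.m_assoc[OF group.is_monoid[OF group_klein_four] that])
  have "u \<in> M" unfolding u_def by (rule m(3)[OF m(5)[OF g f(1)] f(1)])
  moreover have "\<exists>h\<in>carrier klein_four. u h \<noteq> 0"
  proof -
    obtain h where h: "h \<in> carrier klein_four" "f (g \<otimes>\<^bsub>klein_four\<^esub> h) \<noteq> f h"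
      using False unfolding ball_simps(10) by (elim bexE) (rule that)
    have "u h \<noteq> 0"
    proof
      assume "u h = 0"
      then have "f (g \<otimes>\<^bsub>klein_four\<^esub> h) + f h = f h + f h"
        unfolding u[OF h(1)] char_2_add_self[OF char2] .
      then show False using h(2) by simp
    qed
    then show ?thesis using h(1) by (rule bexI)
  qed
  moreover have "u (g \<otimes>\<^bsub>klein_four\<^esub> h) = u h" if h: "h \<in> carrier klein_four" for h
  proof -
    have "g \<otimes>\<^bsub>klein_four\<^esub> (g \<otimes>\<^bsub>klein_four\<^esub> h) = h"
      unfolding assoc[OF g g h, symmetric] klein_four_square[OF g]
      by (rule monoid.l_one[OF group.is_monoid[OF group_klein_four] h])
    then show ?thesis
      unfolding u[OF h] u[OF klein_four_closed[OF g h]] by (simp only: add.commute)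
  qed
  moreover have "u (g' \<otimes>\<^bsub>klein_four\<^esub> h) = u h"
    if g': "g' \<in> carrier klein_four" and inv: "\<forall>h\<in>carrier klein_four. f (g' \<otimes>\<^bsub>klein_four\<^esub> h) = f h"
      and h: "h \<in> carrier klein_four" for g' h
  proof -
    have "g \<otimes>\<^bsub>klein_four\<^esub> (g' \<otimes>\<^bsub>klein_four\<^esub> h) = g' \<otimes>\<^bsub>klein_four\<^esub> (g \<otimes>\<^bsub>klein_four\<^esub> h)"
      unfolding assoc[OF g g' h, symmetric] assoc[OF g' g h, symmetric] klein_four_commute[of g g'] ..
    then show ?thesis
      unfolding u[OF h] u[OF klein_four_closed[OF g' h]]
      by (simp only: bspec[OF inv h] bspec[OF inv klein_four_closed[OF g h]])
  qed
  ultimately show ?thesis by (intro bexI[of _ u] conjI ballI impI)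
qed

text \<open>Applying \<open>regular_fixed_step\<close> to both generators, every non-zero subrepresentation contains a
  non-zero constant function, so two of them intersect.\<close>
lemma fd_indecomposable_regular:
  assumes char2: "CHAR('k :: field) = 2"
  shows "fd_indecomposable_rep klein_four class_ring (klein_regular :: ('k, _, _) rep)"
proof -
  let ?X = "klein_regular :: ('k, int \<times> int, int \<times> int \<Rightarrow> 'k) rep"
  let ?one = "\<lambda>h\<in>carrier klein_four. 1 :: 'k" and ?zero = "\<lambda>h\<in>carrier klein_four. 0 :: 'k"
  have e: "\<one>\<^bsub>klein_four\<^esub> \<in> carrier klein_four"
    by (rule monoid.one_closed[OF group.is_monoid[OF group_klein_four]])
  have neq: "?one \<noteq> ?zero"
  proof
    assume "?one = ?zero"
    then have "?one \<one>\<^bsub>klein_four\<^esub> = ?zero \<one>\<^bsub>klein_four\<^esub>" by (rule fun_cong)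
    then show False unfolding restrict_apply'[OF e] by simp
  qed
  have one_in: "?one \<in> M"
    if M: "subrepresentation klein_four class_ring ?X M" and nz: "M \<noteq> {?zero}" for M
  proof -
    note m = subrepresentation_facts[OF M, unfolded regular_space_facts]
    obtain f where f: "f \<in> M" "f \<noteq> ?zero" using nz m(2) by auto
    have fc: "f \<in> carrier klein_four \<rightarrow>\<^sub>E UNIV" by (rule subsetD[OF m(1) f(1)])
    have "\<exists>h\<in>carrier klein_four. f h \<noteq> 0"
    proof (rule ccontr)
      assume no: "\<not> (\<exists>h\<in>carrier klein_four. f h \<noteq> 0)"
      have "f = ?zero"
      proof
        fix h show "f h = ?zero h"
        proof (cases "h \<in> carrier klein_four")
          case True
          then show ?thesis unfolding restrict_apply'[OF True] using no by blast
        next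
          case False
          then show ?thesis using PiE_arb[OF fc False] by (simp only: restrict_apply if_False)
        qed
      qed
      with f(2) show False ..
    qed
    then obtain h where h: "h \<in> carrier klein_four" "f h \<noteq> 0" by (elim bexE) (rule that)
    from regular_fixed_step[OF char2 M f(1) h gens(1)]
    obtain u h where u: "u \<in> M" "h \<in> carrier klein_four" "u h \<noteq> 0"
      and u1: "\<forall>h\<in>carrier klein_four. u (g1 \<otimes>\<^bsub>klein_four\<^esub> h) = u h" by (elim bexE conjE) (rule that)
    from regular_fixed_step[OF char2 M u gens(2)]
    obtain w h where w: "w \<in> M" "h \<in> carrier klein_four" "w h \<noteq> 0"
      and w2: "\<forall>h\<in>carrier klein_four. w (g2 \<otimes>\<^bsub>klein_four\<^esub> h) = w h"
      and keep: "\<forall>g'\<in>carrier klein_four. (\<forall>h\<in>carrier klein_four. u (g' \<otimes>\<^bsub>klein_four\<^esub> h) = u h) \<longrightarrow>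
         (\<forall>h\<in>carrier klein_four. w (g' \<otimes>\<^bsub>klein_four\<^esub> h) = w h)"
      by (elim bexE conjE) (rule that)
    have w1: "\<forall>h\<in>carrier klein_four. w (g1 \<otimes>\<^bsub>klein_four\<^esub> h) = w h"
      by (rule mp[OF bspec[OF keep gens(1)] u1])
    have r_one: "g \<otimes>\<^bsub>klein_four\<^esub> \<one>\<^bsub>klein_four\<^esub> = g" if "g \<in> carrier klein_four" for g
      by (rule monoid.r_one[OF group.is_monoid[OF group_klein_four] that])
    have wg: "w g1 = w \<one>\<^bsub>klein_four\<^esub>" "w g2 = w \<one>\<^bsub>klein_four\<^esub>"
      using bspec[OF w1 e] bspec[OF w2 e] unfolding r_one[OF gens(1)] r_one[OF gens(2)] .
    have w12: "w (g1 \<otimes>\<^bsub>klein_four\<^esub> g2) = w \<one>\<^bsub>klein_four\<^esub>" using bspec[OF w1 gens(2)] unfolding wg(2) .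
    have const: "w h = w \<one>\<^bsub>klein_four\<^esub>" if "h \<in> carrier klein_four" for h
      using that unfolding generator_facts(1) by (elim insertE emptyE) (simp_all only: wg w12)
    let ?c = "w \<one>\<^bsub>klein_four\<^esub>"
    have c: "?c \<noteq> 0" using w(3) unfolding const[OF w(2)] .
    have "(\<lambda>h\<in>carrier klein_four. (1 / ?c) * w h) = ?one"
    proof (rule restrict_ext)
      fix h assume h: "h \<in> carrier klein_four"
      show "(1 / ?c) * w h = 1" unfolding const[OF h] using c by simp
    qed
    moreover have "(\<lambda>h\<in>carrier klein_four. (1 / ?c) * w h) \<in> M" by (rule m(4)[OF w(1)])
    ultimately show ?thesis by (simp only:)
  qed
  have "indecomposable_rep klein_four class_ring ?X"
    unfolding indecomposable_rep_def Let_def regular_space_facts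
  proof (intro conjI notI)
    assume eq: "carrier klein_four \<rightarrow>\<^sub>E UNIV = {?zero}"
    have "?one \<in> carrier klein_four \<rightarrow>\<^sub>E UNIV" by (intro restrict_PiE_iff[THEN iffD2] ballI UNIV_I)
    then show False using neq unfolding eq by (simp only: singleton_iff)
  next
    assume "\<exists>M M'. subrepresentation klein_four class_ring ?X M \<and> subrepresentation klein_four class_ring ?X M' \<and>
      M \<noteq> {?zero} \<and> M' \<noteq> {?zero} \<and> M \<inter> M' = {?zero} \<and>
      set_add (rep_space ?X) M M' = carrier klein_four \<rightarrow>\<^sub>E UNIV"
    then obtain M M' where s: "subrepresentation klein_four class_ring ?X M"
      "subrepresentation klein_four class_ring ?X M'" "M \<noteq> {?zero}" "M' \<noteq> {?zero}"
      and inter: "M \<inter> M' = {?zero}"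
      by (elim exE conjE) (rule that)
    have "?one \<in> M \<inter> M'" by (rule IntI[OF one_in[OF s(1,3)] one_in[OF s(2,4)]])
    then show False using neq unfolding inter by (simp only: singleton_iff)
  qed
  then show ?thesis
    unfolding fd_indecomposable_rep_def by (intro conjI representation_regular fin_dim_regular)
qed

lemma iso_repI:
  fixes X :: "('k :: field, int \<times> int, 'v) rep" and Y :: "('k, int \<times> int, 'w) rep"
  assumes X: "representation klein_four class_ring X" and Y: "representation klein_four class_ring Y"
    and f: "f \<in> LinearCombinations.module_hom class_ring (rep_space X) (rep_space Y)"
    and bij: "bij_betw f (carrier (rep_space X)) (carrier (rep_space Y))"
    and f1: "\<And>x. x \<in> carrier (rep_space X) \<Longrightarrow> f (rep_act X g1 x) = rep_act Y g1 (f x)"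
    and f2: "\<And>x. x \<in> carrier (rep_space X) \<Longrightarrow> f (rep_act X g2 x) = rep_act Y g2 (f x)"
  shows "iso_rep klein_four class_ring X Y"
  unfolding iso_rep_def
proof (intro bexI[OF _ f] conjI bij ballI)
  note fX = representation_facts[OF X] and fY = representation_facts[OF Y]
  fix g x assume g: "g \<in> carrier klein_four" and x: "x \<in> carrier (rep_space X)"
  have fx: "f x \<in> carrier (rep_space Y)" by (rule bij_betw_apply[OF bij x])
  have 12: "f (rep_act X (g1 \<otimes>\<^bsub>klein_four\<^esub> g2) x) = rep_act Y (g1 \<otimes>\<^bsub>klein_four\<^esub> g2) (f x)"
    unfolding fX(6)[OF gens(1,2) x] fY(6)[OF gens(1,2) fx] f1[OF fX(3)[OF gens(2) x]] f2[OF x] ..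
  have 1: "f (rep_act X \<one>\<^bsub>klein_four\<^esub> x) = rep_act Y \<one>\<^bsub>klein_four\<^esub> (f x)"
    unfolding fX(7)[OF x] fY(7)[OF fx] ..
  from g show "f (rep_act X g x) = rep_act Y g (f x)"
    unfolding generator_facts(1) using 1 12 f1[OF x] f2[OF x]
    by (elim insertE emptyE) (simp_all only:)
qed

end

section \<open>Representations in coordinates\<close>

text \<open>The map \<open>d\<close> forms the linear combination of a basis \<open>\<beta>\<close> with given coefficients; it is bijective
  on the functions supported on \<open>\<beta>\<close>.  Since the carrier of \<open>V\<close> may be a small part of its type,
  the functions are on the whole type.\<close>
lemma vectorspace_coordinates:
  fixes V :: "('k :: field, 'v) module"
  assumes V: "vectorspace class_ring V" and fin: "vectorspace.fin_dim class_ring V"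
  obtains S T and d :: "('v \<Rightarrow> 'k) \<Rightarrow> 'v" where "fn.V.subspace S" "S \<subseteq> fn.V.span T" "finite T"
    "bij_betw d S (carrier V)" "\<And>f. d f \<in> carrier V"
    "\<And>f g. d (f + g) = d f \<oplus>\<^bsub>V\<^esub> d g" "\<And>c f. d (fscale c f) = c \<odot>\<^bsub>V\<^esub> d f"
proof -
  interpret W: vectorspace "class_ring :: 'k ring" V by (rule V)
  obtain \<beta> where \<beta>: "finite \<beta>" "W.basis \<beta>" using W.finite_basis_exists[OF fin] by (elim exE conjE) (rule that)
  have \<beta>V: "\<beta> \<subseteq> carrier V" using \<beta>(2) by (simp add: W.basis_def)
  have unique: "\<exists>!f. f \<in> \<beta> \<rightarrow>\<^sub>E UNIV \<and> W.lincomb f \<beta> = x" if "x \<in> carrier V" for x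
    using W.basis_criterion[OF \<beta>(1) \<beta>V] \<beta>(2) that by simp
  have coeff: "f \<in> \<beta> \<rightarrow> carrier (class_ring :: 'k ring)" for f by simp
  define d where "d = (\<lambda>f. W.lincomb f \<beta>)"
  have cong: "d f = d g" if "\<And>v. v \<in> \<beta> \<Longrightarrow> f v = g v" for f g
    unfolding d_def by (rule W.lincomb_cong[OF refl \<beta>V that coeff])
  define S :: "('v \<Rightarrow> 'k) set" where "S = {f. \<forall>v. v \<notin> \<beta> \<longrightarrow> f v = 0}"
  let ?e = "\<lambda>v i. if i = v then 1 else 0 :: 'k"
  show thesis
  proof (rule that)
    show "fn.V.subspace S"
      by (rule fn.V.subspaceI) (simp_all add: S_def)
    show "S \<subseteq> fn.V.span (?e ` \<beta>)"
    proof
      fix f assume f: "f \<in> S"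
      have "f = (\<Sum>v\<in>\<beta>. fscale (f v) (?e v))"
      proof
        fix i
        have "(\<Sum>v\<in>A. fscale (f v) (?e v)) i = (\<Sum>v\<in>A. if i = v then f v else 0)" for A
          by (induction A rule: infinite_finite_induct) simp_all
        then have "(\<Sum>v\<in>\<beta>. fscale (f v) (?e v)) i = (\<Sum>v\<in>\<beta>. if i = v then f v else 0)" .
        also have "(\<Sum>v\<in>\<beta>. if i = v then f v else 0) = f i" using f \<beta>(1) by (simp add: S_def)
        finally show "f i = (\<Sum>v\<in>\<beta>. fscale (f v) (?e v)) i" ..
      qed
      also have "\<dots> \<in> fn.V.span (?e ` \<beta>)"
        by (intro fn.V.span_sum fn.V.span_scale fn.V.span_base imageI)
      finally show "f \<in> fn.V.span (?e ` \<beta>)" .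
    qed
    show "finite (?e ` \<beta>)" using \<beta>(1) by simp
    show mem: "d f \<in> carrier V" for f unfolding d_def by (rule W.lincomb_closed[OF \<beta>V coeff])
    show "d (f + g) = d f \<oplus>\<^bsub>V\<^esub> d g" for f g
      using W.lincomb_sum[OF \<beta>(1) \<beta>V coeff coeff, of f g] by (simp add: d_def plus_fun_def)
    show "d (fscale c f) = c \<odot>\<^bsub>V\<^esub> d f" for c f
      using W.lincomb_smult[OF \<beta>V coeff, of c f] by (simp add: d_def fscale_def)
    show "bij_betw d S (carrier V)"
    proof (rule bij_betw_imageI)
      show "inj_on d S"
      proof (rule inj_onI)
        fix f g assume f: "f \<in> S" and g: "g \<in> S" and eq: "d f = d g"
        have r: "restrict h \<beta> \<in> \<beta> \<rightarrow>\<^sub>E UNIV \<and> W.lincomb (restrict h \<beta>) \<beta> = d h" for h :: "'v \<Rightarrow> 'k"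
          using cong[of "restrict h \<beta>" h] by (simp add: d_def)
        note u = unique[OF mem[of g]]
        have "restrict f \<beta> = restrict g \<beta>"
          by (rule trans[OF sym[OF the1_equality[OF u]] the1_equality[OF u, OF r]])
            (rule r[of f, unfolded eq])
        note on = fun_cong[OF this]
        have on: "f v = g v" if "v \<in> \<beta>" for v using on[of v] unfolding restrict_apply'[OF that] .
        show "f = g"
        proof
          fix v show "f v = g v" using on[of v] f g by (cases "v \<in> \<beta>") (simp_all add: S_def)
        qed
      qed
      show "d ` S = carrier V"
      proof
        show "d ` S \<subseteq> carrier V" using mem by (rule image_subsetI)
        show "carrier V \<subseteq> d ` S"
        proof
          fix x assume "x \<in> carrier V"
          from ex1_implies_ex[OF unique[OF this]] obtain f where f: "W.lincomb f \<beta> = x" by (elim exE conjE) (rule that)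
          have "d (\<lambda>v. if v \<in> \<beta> then f v else 0) = d f" by (rule cong) simp
          then have "x = d (\<lambda>v. if v \<in> \<beta> then f v else 0)" using f by (simp add: d_def)
          moreover have "(\<lambda>v. if v \<in> \<beta> then f v else 0) \<in> S" by (simp add: S_def)
          ultimately show "x \<in> d ` S" by (simp only: imageI)
        qed
      qed
    qed
  qed
qed

text \<open>The map \<open>d\<close> is an isomorphism from the function space \<open>S\<close> to the space of the representation.\<close>
locale coordinatised_rep = klein_generators g1 g2
  for g1 g2 :: "int \<times> int" +
  fixes X :: "('k :: alg_closed_field, int \<times> int, 'v) rep"
    and S T :: "('v \<Rightarrow> 'k) set" and d :: "('v \<Rightarrow> 'k) \<Rightarrow> 'v"
  assumes char2: "CHAR('k) = 2"
    and X: "fd_indecomposable_rep klein_four class_ring X"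
    and S: "fn.V.subspace S" and S_fin: "S \<subseteq> fn.V.span T" "finite T"
    and d_bij: "bij_betw d S (carrier (rep_space X))" and d_mem: "d f \<in> carrier (rep_space X)"
    and d_add: "d (f + f') = d f \<oplus>\<^bsub>rep_space X\<^esub> d f'"
    and d_smult: "d (fscale c f) = c \<odot>\<^bsub>rep_space X\<^esub> d f"
begin

lemma rep: "representation klein_four class_ring X" "indecomposable_rep klein_four class_ring X"
  using X by (simp_all only: fd_indecomposable_rep_def)

lemmas rep_facts = representation_facts[OF rep(1)]

definition coord :: "'v \<Rightarrow> 'v \<Rightarrow> 'k" where
  "coord = inv_into S d"

lemma coord_mem: "x \<in> carrier (rep_space X) \<Longrightarrow> coord x \<in> S"
  and d_coord: "x \<in> carrier (rep_space X) \<Longrightarrow> d (coord x) = x"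
  and coord_d: "f \<in> S \<Longrightarrow> coord (d f) = f"
  and coord_bij: "bij_betw coord (carrier (rep_space X)) S"
  unfolding coord_def
  using inv_into_into[of x d S] f_inv_into_f[of x d S] inv_into_f_f[of d S f] d_bij bij_betw_inv_into[OF d_bij]
  by (simp_all add: bij_betw_def)

lemma coord_add:
  assumes "x \<in> carrier (rep_space X)" "y \<in> carrier (rep_space X)"
  shows "coord (x \<oplus>\<^bsub>rep_space X\<^esub> y) = coord x + coord y"
  using coord_d[OF fn.V.subspace_add[OF S coord_mem[OF assms(1)] coord_mem[OF assms(2)]]]
  unfolding d_add d_coord[OF assms(1)] d_coord[OF assms(2)] .

lemma coord_smult:
  assumes "x \<in> carrier (rep_space X)"
  shows "coord (c \<odot>\<^bsub>rep_space X\<^esub> x) = fscale c (coord x)"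
  using coord_d[OF fn.V.subspace_scale[OF S coord_mem[OF assms]]]
  unfolding d_smult d_coord[OF assms] .

definition shift :: "int \<times> int \<Rightarrow> ('v \<Rightarrow> 'k) \<Rightarrow> 'v \<Rightarrow> 'k" where
  "shift g f = coord (rep_act X g (d f))"

text \<open>In characteristic 2 this is \<open>g - 1\<close>, an element of the augmentation ideal.\<close>
definition aug :: "int \<times> int \<Rightarrow> ('v \<Rightarrow> 'k) \<Rightarrow> 'v \<Rightarrow> 'k" where
  "aug g f = shift g f + f"

lemma self_cancel: "f + f = (0 :: 'v \<Rightarrow> 'k)"
  by (rule ext) (simp only: plus_fun_apply zero_fun_apply char_2_add_self[OF char2])

lemma self_cancel_left: "f + (f + f') = (f' :: 'v \<Rightarrow> 'k)"
  unfolding add.assoc[symmetric] self_cancel by simp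

lemma shift_mem: "g \<in> carrier klein_four \<Longrightarrow> shift g f \<in> S"
  unfolding shift_def by (rule coord_mem[OF rep_facts(3)[OF _ d_mem]])

lemma d_shift: "g \<in> carrier klein_four \<Longrightarrow> d (shift g f) = rep_act X g (d f)"
  unfolding shift_def by (rule d_coord[OF rep_facts(3)[OF _ d_mem]])

lemma shift_add: "g \<in> carrier klein_four \<Longrightarrow> shift g (f + f') = shift g f + shift g f'"
  unfolding shift_def d_add by (simp only: rep_facts(4) coord_add d_mem rep_facts(3))

lemma shift_scale: "g \<in> carrier klein_four \<Longrightarrow> shift g (fscale c f) = fscale c (shift g f)"
  unfolding shift_def d_smult by (simp only: rep_facts(5) coord_smult d_mem rep_facts(3))

lemma shift_mult:
  assumes "g \<in> carrier klein_four" "h \<in> carrier klein_four"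
  shows "shift g (shift h f) = shift (g \<otimes>\<^bsub>klein_four\<^esub> h) f"
  unfolding shift_def[of g] d_shift[OF assms(2)] unfolding shift_def
  by (simp only: rep_facts(6)[OF assms d_mem])

lemma shift_one: "f \<in> S \<Longrightarrow> shift \<one>\<^bsub>klein_four\<^esub> f = f"
  unfolding shift_def rep_facts(7)[OF d_mem] by (rule coord_d)

lemma shift_coord:
  "x \<in> carrier (rep_space X) \<Longrightarrow> coord (rep_act X g x) = shift g (coord x)"
  unfolding shift_def by (simp only: d_coord)

lemma shift_aug: "shift g f = aug g f + f"
  unfolding aug_def add.assoc self_cancel by simp

lemma aug_endo:
  assumes g: "g \<in> carrier klein_four"
  shows "fn.endo (aug g)"
  unfolding Vector_Spaces.linear_iff
proof (intro conjI allI fn.V.vector_space_axioms)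
  show "aug g (f + f') = aug g f + aug g f'" for f f'
    unfolding aug_def shift_add[OF g] by (simp only: add.assoc add.left_commute)
  show "aug g (fscale c f) = fscale c (aug g f)" for c f
    unfolding aug_def shift_scale[OF g] by (simp only: fn.V.scale_right_distrib)
qed

text \<open>The squares vanish because \<open>(g + 1)\<^sup>2 = g\<^sup>2 + 1 = 0\<close>, and a subspace stable under \<open>g + 1\<close> is stable
  under \<open>g\<close>, so that it corresponds to a subrepresentation.\<close>
lemma klein_module: "klein_module fscale (aug g1) (aug g2) S T"
proof (intro klein_module.intro klein_module_axioms.intro lin_space_alg_closed.intro lin_space_fscale)
  note g = gens(1,2)
  note exp = aug_def shift_add[OF g(1)] shift_add[OF g(2)] shift_mult[OF g(1) g(1)] shift_mult[OF g(2) g(2)]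
    shift_mult[OF g(1) g(2)] shift_mult[OF g(2) g(1)] klein_four_square[OF g(1)] klein_four_square[OF g(2)]
  show "fn.endo (aug g1)" "fn.endo (aug g2)" by (rule aug_endo[OF g(1)], rule aug_endo[OF g(2)])
  show "fn.V.subspace S" "S \<subseteq> fn.V.span T" "finite T" by (rule S, rule S_fin, rule S_fin)
  show "aug g1 f \<in> S" "aug g2 f \<in> S" if "f \<in> S" for f
    unfolding aug_def by (intro fn.V.subspace_add[OF S] shift_mem g that)+
  show "aug g1 (aug g1 f) = 0" if "f \<in> S" for f
    by (simp only: exp shift_one[OF that] add.assoc add.left_commute self_cancel_left self_cancel)
  show "aug g2 (aug g2 f) = 0" if "f \<in> S" for f
    by (simp only: exp shift_one[OF that] add.assoc add.left_commute self_cancel_left self_cancel)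
  show "aug g2 (aug g1 f) = aug g1 (aug g2 f)" if "f \<in> S" for f
    by (simp only: exp klein_four_commute[of g2 g1] add.assoc add.left_commute)
  have d0: "d 0 = \<zero>\<^bsub>rep_space X\<^esub>"
  proof -
    interpret W: vectorspace class_ring "rep_space X" by (rule rep_facts(2))
    have "d 0 \<oplus>\<^bsub>rep_space X\<^esub> d 0 = d 0" unfolding d_add[symmetric] by simp
    then show ?thesis using d_mem[of 0] W.M.add.l_cancel_one[of "d 0" "d 0"] by (simp only:)
  qed
  have inj: "inj_on d S" and img: "d ` S = carrier (rep_space X)" using d_bij by (simp_all add: bij_betw_def)
  have S0: "0 \<in> S" by (rule fn.V.subspace_0[OF S])
  have trivial: "M = {0}" if "M \<subseteq> S" "0 \<in> M" "d ` M = {\<zero>\<^bsub>rep_space X\<^esub>}" for M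
  proof -
    have "f = 0" if f: "f \<in> M" for f
    proof (rule inj_onD[OF inj _ subsetD[OF \<open>M \<subseteq> S\<close> f] S0])
      have "d f \<in> d ` M" by (rule imageI[OF f])
      then show "d f = d 0" unfolding d0 \<open>d ` M = _\<close> by (rule singletonD)
    qed
    then show ?thesis using \<open>0 \<in> M\<close> by blast
  qed
  note indec = rep(2)[unfolded indecomposable_rep_def Let_def]
  show "S \<noteq> {0}"
  proof
    assume "S = {0}"
    then have "carrier (rep_space X) = {\<zero>\<^bsub>rep_space X\<^esub>}" unfolding img[symmetric] by (simp add: d0)
    then show False using indec by simp
  qed
  show "M = {0} \<or> M' = {0}"
    if sum: "lin_space.internal_sum fscale S M M'" and stable: "aug g1 ` M \<subseteq> M" "aug g2 ` M \<subseteq> M"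
      "aug g1 ` M' \<subseteq> M'" "aug g2 ` M' \<subseteq> M'" for M M'
  proof (rule ccontr)
    assume no: "\<not> (M = {0} \<or> M' = {0})"
    have M: "fn.V.subspace M" "fn.V.subspace M'" "M \<subseteq> S" "M' \<subseteq> S" "M \<inter> M' = {0}"
      using sum by (simp_all only: fn.internal_sum_def)
    have sub: "subrepresentation klein_four class_ring X (d ` N)"
      if N: "fn.V.subspace N" and st: "aug g1 ` N \<subseteq> N" "aug g2 ` N \<subseteq> N" for N
    proof (rule subrepresentationI[OF rep_facts(2)])
      show "d ` N \<subseteq> carrier (rep_space X)" by (rule image_subsetI) (rule d_mem)
      show "\<zero>\<^bsub>rep_space X\<^esub> \<in> d ` N" unfolding d0[symmetric] by (rule imageI[OF fn.V.subspace_0[OF N]])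
      show "x \<oplus>\<^bsub>rep_space X\<^esub> y \<in> d ` N" if xy: "x \<in> d ` N" "y \<in> d ` N" for x y
      proof -
        from xy obtain f f' where f: "f \<in> N" "f' \<in> N" "x = d f" "y = d f'" by (elim imageE) (rule that)
        show ?thesis unfolding f(3,4) d_add[symmetric] by (rule imageI[OF fn.V.subspace_add[OF N f(1,2)]])
      qed
      show "c \<odot>\<^bsub>rep_space X\<^esub> x \<in> d ` N" if x: "x \<in> d ` N" for c x
      proof -
        from x obtain f where f: "f \<in> N" "x = d f" by (elim imageE) (rule that)
        show ?thesis unfolding f(2) d_smult[symmetric] by (rule imageI[OF fn.V.subspace_scale[OF N f(1)]])
      qed
      have s1: "rep_act X g x \<in> d ` N" if g: "g \<in> carrier klein_four" "aug g ` N \<subseteq> N" and x: "x \<in> d ` N" for g x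
      proof -
        from x obtain f where f: "f \<in> N" "x = d f" by (elim imageE) (rule that)
        show ?thesis unfolding f(2) d_shift[OF g(1), symmetric] shift_aug
          by (rule imageI[OF fn.V.subspace_add[OF N subsetD[OF g(2) imageI[OF f(1)]] f(1)]])
      qed
      show "rep_act X h x \<in> d ` N" if h: "h \<in> carrier klein_four" and x: "x \<in> d ` N" for h x
      proof -
        have xX: "x \<in> carrier (rep_space X)" using x d_mem by (elim imageE) (simp only:)
        note 1 = s1[OF gens(1) st(1)] and 2 = s1[OF gens(2) st(2)]
        have "rep_act X \<one>\<^bsub>klein_four\<^esub> x \<in> d ` N" unfolding rep_facts(7)[OF xX] by (rule x)
        moreover have "rep_act X (g1 \<otimes>\<^bsub>klein_four\<^esub> g2) x \<in> d ` N"
          unfolding rep_facts(6)[OF gens(1,2) xX] by (rule 1[OF 2[OF x]])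
        ultimately show ?thesis using h 1[OF x] 2[OF x] unfolding generator_facts(1)
          by (elim insertE emptyE) (simp_all only:)
      qed
    qed
    have "d ` M \<noteq> {\<zero>\<^bsub>rep_space X\<^esub>}" "d ` M' \<noteq> {\<zero>\<^bsub>rep_space X\<^esub>}"
      using no trivial[OF M(3) fn.V.subspace_0[OF M(1)]] trivial[OF M(4) fn.V.subspace_0[OF M(2)]] by iprover+
    moreover have "d ` M \<inter> d ` M' = {\<zero>\<^bsub>rep_space X\<^esub>}"
      unfolding inj_on_image_Int[OF inj M(3,4), symmetric] M(5) by (simp add: d0)
    moreover have "set_add (rep_space X) (d ` M) (d ` M') = carrier (rep_space X)"
    proof
      interpret W: vectorspace class_ring "rep_space X" by (rule rep_facts(2))
      show "set_add (rep_space X) (d ` M) (d ` M') \<subseteq> carrier (rep_space X)"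
        using d_mem by (auto simp: set_add_iff)
      show "carrier (rep_space X) \<subseteq> set_add (rep_space X) (d ` M) (d ` M')"
      proof
        fix x assume x: "x \<in> carrier (rep_space X)"
        obtain y z where yz: "y \<in> M" "z \<in> M'" "coord x = y + z"
          by (rule fn.internal_sumE[OF sum coord_mem[OF x]])
        have eq: "x = d y \<oplus>\<^bsub>rep_space X\<^esub> d z" unfolding d_add[symmetric] yz(3)[symmetric] d_coord[OF x] ..
        show "x \<in> set_add (rep_space X) (d ` M) (d ` M')"
          unfolding set_add_iff
          by (rule bexI[of _ "d y"], rule bexI[of _ "d z"], rule eq, rule imageI[OF yz(2)], rule imageI[OF yz(1)])
      qed
    qed
    ultimately show False
      using indec sub[OF M(1) stable(1,2)] sub[OF M(2) stable(3,4)] by blast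
  qed
qed

lemma shift_both: "shift (g1 \<otimes>\<^bsub>klein_four\<^esub> g2) f = aug g1 (aug g2 f) + aug g1 f + aug g2 f + f"
  unfolding shift_mult[OF gens(1,2), symmetric]
  unfolding shift_aug fn.E.linear_add[OF aug_endo[OF gens(1)]]
  by (simp only: add.assoc)

text \<open>The isomorphism sends \<open>x\<close> to the function \<open>h \<mapsto> \<phi> (h x)\<close>, with \<open>\<phi>\<close> from \<open>free_case\<close>.  The four values
  of this function and the four numbers \<open>\<phi> x\<close>, \<open>\<phi> (a x)\<close>, \<open>\<phi> (b x)\<close>, \<open>\<phi> (a (b x))\<close> determine each other by
  a unitriangular matrix, so bijectivity carries over.\<close>
lemma iso_regular:
  assumes v: "v \<in> S" "aug g1 (aug g2 v) \<noteq> 0"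
  shows "iso_rep klein_four class_ring X (klein_regular :: ('k, _, _) rep)"
proof -
  interpret M: klein_module fscale "aug g1" "aug g2" S T by (rule klein_module)
  obtain \<phi> where \<phi>: "fn.functional \<phi>"
    and trivial: "\<And>f. f \<in> S \<Longrightarrow> \<phi> f = 0 \<Longrightarrow> \<phi> (aug g1 f) = 0 \<Longrightarrow> \<phi> (aug g2 f) = 0 \<Longrightarrow>
      \<phi> (aug g1 (aug g2 f)) = 0 \<Longrightarrow> f = 0"
    and attained: "\<And>\<alpha> \<beta> \<gamma> \<delta>. \<exists>f\<in>S. \<phi> f = \<alpha> \<and> \<phi> (aug g1 f) = \<beta> \<and> \<phi> (aug g2 f) = \<gamma> \<and>
      \<phi> (aug g1 (aug g2 f)) = \<delta>"
    by (rule M.free_case[OF v]) (rule that)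
  note \<phi>_add = fn.F.linear_add[OF \<phi>] and \<phi>_scale = fn.F.linear_scale[OF \<phi>]
  have cancel: "z + (z + w) = w" for z w :: 'k
    unfolding add.assoc[symmetric] char_2_add_self[OF char2] by simp
  have e: "\<one>\<^bsub>klein_four\<^esub> \<in> carrier klein_four"
    by (rule monoid.one_closed[OF group.is_monoid[OF group_klein_four]])
  have g12: "g1 \<otimes>\<^bsub>klein_four\<^esub> g2 \<in> carrier klein_four" by (rule klein_four_closed[OF gens(1,2)])
  have \<phi>_shift: "\<phi> (shift \<one>\<^bsub>klein_four\<^esub> f) = \<phi> f" "\<phi> (shift g1 f) = \<phi> (aug g1 f) + \<phi> f"
    "\<phi> (shift g2 f) = \<phi> (aug g2 f) + \<phi> f"
    "\<phi> (shift (g1 \<otimes>\<^bsub>klein_four\<^esub> g2) f) = \<phi> (aug g1 (aug g2 f)) + \<phi> (aug g1 f) + \<phi> (aug g2 f) + \<phi> f"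
    if "f \<in> S" for f
    unfolding shift_both shift_one[OF that] \<phi>_add unfolding shift_aug \<phi>_add by (rule refl)+
  let ?J = "\<lambda>x. \<lambda>h\<in>carrier klein_four. \<phi> (coord (rep_act X h x))"
  have J: "?J x h = \<phi> (shift h (coord x))" if "x \<in> carrier (rep_space X)" "h \<in> carrier klein_four" for x h
    unfolding restrict_apply'[OF that(2)] shift_coord[OF that(1)] ..
  have J_mem: "?J x \<in> carrier klein_four \<rightarrow>\<^sub>E UNIV" for x
    by (intro restrict_PiE_iff[THEN iffD2] ballI UNIV_I)
  have hom: "?J \<in> LinearCombinations.module_hom class_ring (rep_space X) (rep_space (klein_regular :: ('k, _, _) rep))"
    unfolding LinearCombinations.module_hom_def regular_space_facts
  proof (intro CollectI conjI allI impI funcsetI J_mem; (elim conjE)?)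
    fix x y assume x: "x \<in> carrier (rep_space X)" "y \<in> carrier (rep_space X)"
    show "?J (x \<oplus>\<^bsub>rep_space X\<^esub> y) = (\<lambda>h\<in>carrier klein_four. ?J x h + ?J y h)"
    proof (rule restrict_ext)
      fix h assume h: "h \<in> carrier klein_four"
      show "\<phi> (coord (rep_act X h (x \<oplus>\<^bsub>rep_space X\<^esub> y))) = ?J x h + ?J y h"
        unfolding restrict_apply'[OF h]
        by (simp only: rep_facts(4)[OF h x] coord_add[OF rep_facts(3)[OF h x(1)] rep_facts(3)[OF h x(2)]] \<phi>_add)
    qed
  next
    fix c x assume x: "x \<in> carrier (rep_space X)"
    show "?J (c \<odot>\<^bsub>rep_space X\<^esub> x) = (\<lambda>h\<in>carrier klein_four. c * ?J x h)"
    proof (rule restrict_ext)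
      fix h assume h: "h \<in> carrier klein_four"
      show "\<phi> (coord (rep_act X h (c \<odot>\<^bsub>rep_space X\<^esub> x))) = c * ?J x h"
        unfolding restrict_apply'[OF h]
        by (simp only: rep_facts(5)[OF h x] coord_smult[OF rep_facts(3)[OF h x]] \<phi>_scale)
    qed
  qed
  have bij: "bij_betw ?J (carrier (rep_space X)) (carrier (rep_space (klein_regular :: ('k, _, _) rep)))"
    unfolding regular_space_facts
  proof (rule bij_betw_imageI)
    show "inj_on ?J (carrier (rep_space X))"
    proof (rule inj_onI)
      fix x y assume x: "x \<in> carrier (rep_space X)" and y: "y \<in> carrier (rep_space X)" and eq: "?J x = ?J y"
      let ?f = "coord x + coord y"
      have f: "?f \<in> S" by (rule fn.V.subspace_add[OF S coord_mem[OF x] coord_mem[OF y]])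
      have zero: "\<phi> (shift h ?f) = 0" if h: "h \<in> carrier klein_four" for h
        using fun_cong[OF eq, of h]
        unfolding J[OF x h] J[OF y h] shift_add[OF h] \<phi>_add by (simp only: char_2_add_self[OF char2])
      have z0: "\<phi> ?f = 0" using zero[OF e] unfolding \<phi>_shift[OF f] .
      have z1: "\<phi> (aug g1 ?f) = 0" using zero[OF gens(1)] unfolding \<phi>_shift[OF f] z0 by simp
      have z2: "\<phi> (aug g2 ?f) = 0" using zero[OF gens(2)] unfolding \<phi>_shift[OF f] z0 by simp
      have z3: "\<phi> (aug g1 (aug g2 ?f)) = 0" using zero[OF g12] unfolding \<phi>_shift[OF f] z0 z1 z2 by simp
      have "coord x + (coord x + coord y) = coord x + 0"
        by (rule arg_cong[of ?f 0]) (rule trivial[OF f z0 z1 z2 z3])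
      then have "coord y = coord x" unfolding self_cancel_left by simp
      then have "d (coord x) = d (coord y)" by simp
      then show "x = y" unfolding d_coord[OF x] d_coord[OF y] .
    qed
    show "?J ` carrier (rep_space X) = carrier klein_four \<rightarrow>\<^sub>E UNIV"
    proof
      show "?J ` carrier (rep_space X) \<subseteq> carrier klein_four \<rightarrow>\<^sub>E UNIV" by (rule image_subsetI) (rule J_mem)
      show "carrier klein_four \<rightarrow>\<^sub>E UNIV \<subseteq> ?J ` carrier (rep_space X)"
      proof
        fix y :: "int \<times> int \<Rightarrow> 'k" assume y: "y \<in> carrier klein_four \<rightarrow>\<^sub>E UNIV"
        let ?e = "\<one>\<^bsub>klein_four\<^esub>" and ?g = "g1 \<otimes>\<^bsub>klein_four\<^esub> g2"
        obtain f where f: "f \<in> S" "\<phi> f = y ?e" "\<phi> (aug g1 f) = y g1 + y ?e" "\<phi> (aug g2 f) = y g2 + y ?e"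
          "\<phi> (aug g1 (aug g2 f)) = y ?g + (y g1 + y g2 + y ?e)"
          using attained[of "y ?e" "y g1 + y ?e" "y g2 + y ?e" "y ?g + (y g1 + y g2 + y ?e)"]
          by (elim bexE conjE) (rule that)
        have vals: "\<phi> (shift ?e f) = y ?e" "\<phi> (shift g1 f) = y g1" "\<phi> (shift g2 f) = y g2"
          "\<phi> (shift ?g f) = y ?g"
          unfolding \<phi>_shift[OF f(1)] f(2-5)
          by (simp_all only: add.assoc add.left_commute add.commute cancel char_2_add_self[OF char2] add_0_right add_0_left)
        have sh: "\<phi> (shift h f) = y h" if "h \<in> carrier klein_four" for h
          using that vals unfolding generator_facts(1) by (elim insertE emptyE) (simp_all only:)
        have x: "d f \<in> carrier (rep_space X)" by (rule d_mem)
        have "y = ?J (d f)"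
        proof (rule PiE_ext[OF y J_mem])
          fix h assume h: "h \<in> carrier klein_four"
          show "y h = ?J (d f) h" unfolding J[OF x h] coord_d[OF f(1)] sh[OF h] ..
        qed
        then show "y \<in> ?J ` carrier (rep_space X)" by (rule image_eqI[OF _ x])
      qed
    qed
  qed
  have equivariant: "?J (rep_act X g x) = rep_act klein_regular g (?J x)"
    if g: "g \<in> carrier klein_four" and x: "x \<in> carrier (rep_space X)" for g x
    unfolding regular_act[OF J_mem g]
  proof (rule restrict_ext)
    fix h assume h: "h \<in> carrier klein_four"
    show "\<phi> (coord (rep_act X h (rep_act X g x))) = ?J x (g \<otimes>\<^bsub>klein_four\<^esub> h)"
      unfolding restrict_apply'[OF klein_four_closed[OF g h]]
      unfolding klein_four_commute[of g h] rep_facts(6)[OF h g x] ..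
  qed
  show ?thesis
    by (rule iso_repI[OF rep(1) representation_regular hom bij equivariant[OF gens(1)] equivariant[OF gens(2)]])
qed

lemma iso_T:
  assumes "\<And>f. f \<in> S \<Longrightarrow> aug g1 (aug g2 f) = 0"
  obtains m n and A B :: "'k mat" where "kronecker_model m n A B" "m \<ge> 1"
    "iso_rep klein_four class_ring X (T_rep klein_four g1 g2 (matrix_kronecker_rep m n A B))"
proof -
  interpret M: klein_module fscale "aug g1" "aug g2" S T by (rule klein_module)
  obtain m n A B F where model: "kronecker_model m n A B" "m \<ge> 1"
    and F_bij: "bij_betw F S (carrier_vec m \<times> carrier_vec n)"
    and F_add: "\<And>f f'. F (f + f') = (fst (F f) + fst (F f'), snd (F f) + snd (F f'))"
    and F_scale: "\<And>c f. F (fscale c f) = (c \<cdot>\<^sub>v fst (F f), c \<cdot>\<^sub>v snd (F f))"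
    and F1: "\<And>f. f \<in> S \<Longrightarrow> F (aug g1 f) = (0\<^sub>v m, A *\<^sub>v fst (F f))"
    and F2: "\<And>f. f \<in> S \<Longrightarrow> F (aug g2 f) = (0\<^sub>v m, B *\<^sub>v fst (F f))"
    by (rule M.square_zero_case[OF assms]) (assumption, rule that)
  interpret Y: T_model g1 g2 m n A B
    by (intro T_model.intro T_model_axioms.intro klein_generators_axioms char2 kronecker_model_carrier[OF model(1)])
  let ?J = "\<lambda>x. F (coord x)"
  have F_mem: "F f \<in> carrier_vec m \<times> carrier_vec n" if "f \<in> S" for f by (rule bij_betw_apply[OF F_bij that])
  have hom: "?J \<in> LinearCombinations.module_hom class_ring (rep_space X) (rep_space Y.Y)"
    unfolding LinearCombinations.module_hom_def Y.space_facts
    by (intro CollectI conjI allI impI funcsetI; (elim conjE)?)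
      (rule F_mem[OF coord_mem], assumption, simp only: coord_add F_add, simp only: coord_smult F_scale)
  have bij: "bij_betw ?J (carrier (rep_space X)) (carrier (rep_space Y.Y))"
    unfolding Y.space_facts using bij_betw_trans[OF coord_bij F_bij] unfolding comp_def .
  have equivariant: "?J (rep_act X g x) = rep_act Y.Y g (?J x)"
    if N: "F (aug g (coord x)) = (0\<^sub>v m, Y.nilp g *\<^sub>v fst (?J x))" and x: "x \<in> carrier (rep_space X)" for g x
  proof -
    obtain u w where uw: "?J x = (u, w)" by (rule prod.exhaust[of "?J x"]) (rule that)
    have c: "u \<in> carrier_vec m" "w \<in> carrier_vec n" using F_mem[OF coord_mem[OF x]] unfolding uw by simp_all
    show ?thesis
      unfolding shift_coord[OF x] shift_aug F_add N uw Y.act[OF c] fst_conv snd_conv left_zero_vec[OF c(1)] ..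
  qed
  have nilp: "Y.nilp g1 = A" "Y.nilp g2 = B"
    unfolding Y.nilp_def using generator_facts(2-4) generator_facts(4)[symmetric] by (simp_all only: if_False if_True simp_thms)
  have "iso_rep klein_four class_ring X Y.Y"
    by (rule iso_repI[OF rep(1) Y.representation_T hom bij equivariant equivariant])
      (simp_all only: nilp F1[OF coord_mem] F2[OF coord_mem])
  then show thesis by (rule that[OF model])
qed

end

section \<open>The classification\<close>

lemma P_rep_eq: "P_rep r = matrix_kronecker_rep r (r + 1) (P_mat1 r) (P_mat2 r)"
  and I_rep_eq: "I_rep r = matrix_kronecker_rep (r + 1) r (I_mat1 r) (I_mat2 r)"
  by (simp_all only: P_rep_def I_rep_def P_mat1_def P_mat2_def I_mat1_def I_mat2_def)

theorem corollary12p4p3: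
  fixes K :: "'k :: alg_closed_field ring" and g1 g2 :: "int \<times> int"
  assumes K: "K = class_ring"
    and char: "CHAR('k) = 2"
    and gens: "g1 \<in> carrier klein_four" "g2 \<in> carrier klein_four"
      "generate klein_four {g1, g2} = carrier klein_four"
  shows
    "(fd_indecomposable_rep klein_four K (regular_rep klein_four K) \<and>
      (\<forall>r\<ge>1. fd_indecomposable_rep klein_four K (T_rep klein_four g1 g2 (P_rep r))) \<and>
      (\<forall>r. fd_indecomposable_rep klein_four K (T_rep klein_four g1 g2 (I_rep r))) \<and>
      (\<forall>p\<ge>1. \<forall>l\<in>proj_line. \<forall>Y\<in>R_reps p l.
          fd_indecomposable_rep klein_four K (T_rep klein_four g1 g2 Y))) \<and>
     (\<forall>X :: ('k, int \<times> int, 'v) rep. fd_indecomposable_rep klein_four K X \<longrightarrow>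
        iso_rep klein_four K X (regular_rep klein_four K) \<or>
        (\<exists>r\<ge>1. iso_rep klein_four K X (T_rep klein_four g1 g2 (P_rep r))) \<or>
        (\<exists>r. iso_rep klein_four K X (T_rep klein_four g1 g2 (I_rep r))) \<or>
        (\<exists>p\<ge>1. \<exists>l\<in>proj_line. \<exists>Y\<in>R_reps p l.
            iso_rep klein_four K X (T_rep klein_four g1 g2 Y)))"
proof -
  interpret klein_generators g1 g2 by (rule klein_generators.intro[OF gens])
  have model: "fd_indecomposable_rep klein_four K (T_rep klein_four g1 g2 (matrix_kronecker_rep m n A B))"
    if "kronecker_model m n A B" "m \<ge> 1" for m n and A B :: "'k mat"
  proof -
    interpret Y: T_model g1 g2 m n A B
      by (intro T_model.intro T_model_axioms.intro klein_generators_axioms char kronecker_model_carrier[OF that(1)])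
    show ?thesis unfolding K by (rule Y.fd_indecomposable_T[OF that])
  qed
  have complete: "iso_rep klein_four K X (regular_rep klein_four K) \<or>
        (\<exists>r\<ge>1. iso_rep klein_four K X (T_rep klein_four g1 g2 (P_rep r))) \<or>
        (\<exists>r. iso_rep klein_four K X (T_rep klein_four g1 g2 (I_rep r))) \<or>
        (\<exists>p\<ge>1. \<exists>l\<in>proj_line. \<exists>Y\<in>R_reps p l.
            iso_rep klein_four K X (T_rep klein_four g1 g2 Y))" (is "?reg \<or> ?P \<or> ?I \<or> ?R")
    if X: "fd_indecomposable_rep klein_four K X" for X :: "('k, int \<times> int, 'v) rep"
  proof -
    note X' = X[unfolded K]
    note rep = X'[unfolded fd_indecomposable_rep_def, THEN conjunct1]
    note fin = X'[unfolded fd_indecomposable_rep_def, THEN conjunct2, THEN conjunct1]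
    obtain S T :: "('v \<Rightarrow> 'k) set" and d where c: "fn.V.subspace S" "S \<subseteq> fn.V.span T" "finite T"
      "bij_betw d S (carrier (rep_space X))" "\<And>f. d f \<in> carrier (rep_space X)"
      "\<And>f g. d (f + g) = d f \<oplus>\<^bsub>rep_space X\<^esub> d g" "\<And>c f. d (fscale c f) = c \<odot>\<^bsub>rep_space X\<^esub> d f"
      by (rule vectorspace_coordinates[OF representation_facts(2)[OF rep] fin]) (rule that)
    interpret C: coordinatised_rep g1 g2 X S T d
      by (intro coordinatised_rep.intro coordinatised_rep_axioms.intro klein_generators_axioms char X' c)
    show ?thesis
    proof (cases "\<exists>v\<in>S. C.aug g1 (C.aug g2 v) \<noteq> 0")
      case True
      then obtain v where v: "v \<in> S" "C.aug g1 (C.aug g2 v) \<noteq> 0" by (elim bexE) (rule that)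
      have ?reg unfolding K by (rule C.iso_regular[OF v])
      then show ?thesis ..
    next
      case False
      have zero: "C.aug g1 (C.aug g2 v) = 0" if "v \<in> S" for v
        by (rule ccontr) (rule notE[OF False bexI[of _ v, OF _ that]])
      obtain m n and A B :: "'k mat" where AB: "kronecker_model m n A B" "m \<ge> 1"
        and iso: "iso_rep klein_four class_ring X (T_rep klein_four g1 g2 (matrix_kronecker_rep m n A B))"
        by (rule C.iso_T[OF zero]) (assumption, rule that)
      \<comment> \<open>The bound \<open>m \<ge> 1\<close> rules out \<open>P\<^sub>0\<close>, for which \<open>T P\<^sub>0\<close> is isomorphic to \<open>T I\<^sub>0\<close>.\<close>
      have R: ?R if "m = n" "l = proj_point a b" "(a, b) \<noteq> (0, 0)" "matrix_kronecker_rep m n A B \<in> R_reps m l"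
        for l a b
      proof (intro exI[of _ m] conjI AB(2) bexI[of _ l] bexI[OF _ that(4)])
        show "iso_rep klein_four K X (T_rep klein_four g1 g2 (matrix_kronecker_rep m n A B))"
          unfolding K by (rule iso)
        show "l \<in> proj_line" unfolding proj_line_def using that(2,3) by blast
      qed
      from AB(1)[unfolded kronecker_model_def] show ?thesis
      proof (elim disjE conjE exE)
        assume "n = m + 1" "A = P_mat1 m" "B = P_mat2 m"
        then have "iso_rep klein_four K X (T_rep klein_four g1 g2 (P_rep m))"
          unfolding P_rep_eq K using iso by (simp only:)
        with AB(2) have ?P by (intro exI[of _ m] conjI)
        then show ?thesis by simp
      next
        assume "m = n + 1" "A = I_mat1 n" "B = I_mat2 n"
        then have "iso_rep klein_four K X (T_rep klein_four g1 g2 (I_rep n))"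
          unfolding I_rep_eq K using iso by (simp only:)
        then have ?I by (rule exI[of _ n])
        then show ?thesis by simp
      next
        fix \<mu> assume eq: "n = m" "A = jordan_block m \<mu>" "B = 1\<^sub>m m"
        have ?R
        proof (rule R)
          show "m = n" by (rule eq(1)[symmetric])
          show "(\<mu>, 1 :: 'k) \<noteq> (0, 0)" by simp
          show "matrix_kronecker_rep m n A B \<in> R_reps m (proj_point \<mu> 1)"
            unfolding eq R_reps_def by blast
        qed (rule refl)
        then show ?thesis by simp
      next
        fix \<mu> assume eq: "n = m" "A = 1\<^sub>m m" "B = jordan_block m \<mu>"
        have ?R
        proof (rule R)
          show "m = n" by (rule eq(1)[symmetric])
          show "(1 :: 'k, \<mu>) \<noteq> (0, 0)" by simp
          show "matrix_kronecker_rep m n A B \<in> R_reps m (proj_point 1 \<mu>)"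
            unfolding eq R_reps_def by blast
        qed (rule refl)
        then show ?thesis by simp
      qed
    qed
  qed
  show ?thesis
  proof (intro conjI allI impI ballI complete)
    show "fd_indecomposable_rep klein_four K (regular_rep klein_four K)"
      unfolding K by (rule fd_indecomposable_regular[OF char])
    show "fd_indecomposable_rep klein_four K (T_rep klein_four g1 g2 (P_rep r))" if "r \<ge> 1" for r
      unfolding P_rep_eq by (rule model[OF _ that]) (simp only: kronecker_model_def simp_thms)
    show "fd_indecomposable_rep klein_four K (T_rep klein_four g1 g2 (I_rep r))" for r
      unfolding I_rep_eq by (rule model) (simp_all add: kronecker_model_def)
    show "fd_indecomposable_rep klein_four K (T_rep klein_four g1 g2 Y)"
      if p: "p \<ge> 1" and Y: "Y \<in> R_reps p l" for p l Y
    proof -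
      from Y obtain A B where Y: "Y = matrix_kronecker_rep p p A B" and m: "kronecker_model p p A B"
        using p unfolding R_reps_def kronecker_model_def by blast
      show ?thesis unfolding Y by (rule model[OF m p])
    qed
  qed
qed

end
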